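(* Let $Q$ be a quiver, and for each $n\in\mathbb{N}=\{0,1,2,\dots\}$ let $I_{Q,\mathrm{nil}}^{n}$ denote the set of isomorphism classes of finite-dimensional indecomposable nilpotent $\mathbb{F}_1$-representations of $Q$ with nice length $n$. Let $I_{Q,\mathrm{nil}}^{\operatorname{nice}}=\bigcup_{n\in\mathbb{N}}I_{Q,\mathrm{nil}}^{n}$. Then, for indecomposable nilpotent $\mathbb{F}_1$-representations $M$ of $Q$ with associated winding $c_M:\Gamma_M\to Q$, the following hold: (1) $M\in I_{Q,\mathrm{nil}}^{0}$ if and only if $M$ admits a nice grading $\partial$ that restricts to an injection on $c_M^{-1}(v)$ for all $v\in Q_0$. (2) If the coefficient quiver $\Gamma_M$ is a tree, then $M\in I_{Q,\mathrm{nil}}^{\operatorname{nice}}$. In general $M\notin I_{Q,\mathrm{nil}}^{0}$ (that is, there are quivers $Q$ and such $M$ with $M\notin I^0_{Q,\mathrm{nil}}$). (3) If $\Gamma_M$ is an affine Dynkin quiver of type $\tilde{\mathbb{A}}$, then $M\in I_{Q,\mathrm{nil}}^{\operatorname{nice}}$ if and only if $c_M:\Gamma_M\to Q$ is primitive. In general $M\notin I_{Q,\mathrm{nil}}^{0}$ (that is, there are quivers $Q$ and such $M\in I_{Q,\mathrm{nil}}^{\operatorname{nice}}$ with $M\notin I^0_{Q,\mathrm{nil}}$). If $Q$ is a (not necessarily proper) pseudotree, then every $M\in I_{Q,\mathrm{nil}}^{\operatorname{nice}}$ belongs to at least one of these three cases (i.e. $M\in I_{Q,\mathrm{nil}}^{0}$,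 or $\Gamma_M$ is a tree, or $\Gamma_M$ is of type $\tilde{\mathbb{A}}$ with $c_M$ primitive). If $Q=\mathbb{L}_n$ with $n\ge2$, then $I_{Q,\mathrm{nil}}^{\operatorname{nice}}$ contains $\mathbb{F}_1$-representations that do not belong to any of these three cases.
   Context: Quivers $Q=(Q_0,Q_1,s,t)$ are finite; loops and multiple arrows are allowed. $\mathbb{L}_n$ is the quiver with one vertex and $n$ loops. Graph-theoretic terms (tree, connected) refer to the underlying undirected graph; a quiver of affine Dynkin type $\tilde{\mathbb{A}}$ is one whose underlying graph is a cycle. A pseudotree is a connected quiver $Q$ with $\operatorname{rank}H_1(Q,\mathbb{Z})\le1$, where $H_1(Q,\mathbb{Z})=\ker(\mathbb{Z}Q_1\to\mathbb{Z}Q_0,\ \alpha\mapsto t(\alpha)-s(\alpha))$; it is proper if it is neither a tree nor of type $\tilde{\mathbb{A}}$. An $\mathbb{F}_1$-vector space is a finite pointed set; an $\mathbb{F}_1$-linear map is a pointed function injective on the complement of the preimage of $0$. An $\mathbb{F}_1$-representation $M$ of $Q$ consists of $\mathbb{F}_1$-vector spaces $M_v$ ($v\in Q_0$) and $\mathbb{F}_1$-linear maps $M_\alpha:M_{s(\alpha)}\to M_{t(\alpha)}$ ($\alpha\in Q_1$). Direct sums are obtained by gluing pointed sets at $0$; $M$ is indecomposable if it is not a nontrivial direct sum of subrepresentations. $M$ is nilpotent if there is $N$ such that for all $n\ge N$ the composite of the $M_\alpha$ along every directed path of length $n$ is zero. A winding is a quiver map $c:\Gamma\to Q$ such that distinct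 arrows of $\Gamma$ with the same source, or with the same target, have distinct images in $Q_1$. The winding associated to $M$ is $c_M:\Gamma_M\to Q$: the vertices of the coefficient quiver $\Gamma_M$ are the nonzero elements of all the $M_v$ (elements of $M_v$ being sent to $v$), with one arrow $x\to y$ sent to $\alpha$ whenever $M_\alpha(x)=y\ne0$. A grading of $M$ is a map $\partial:\Gamma_0\to\mathbb{Z}$, $\Gamma=\Gamma_M$. It is nice if $c_M(\beta)=c_M(\beta')$ implies $\partial(t(\beta))-\partial(s(\beta))=\partial(t(\beta'))-\partial(s(\beta'))$. It is $(\partial_0,\dots,\partial_{i-1})$-nice if this equality holds for all $\beta,\beta'\in\Gamma_1$ with $c_M(\beta)=c_M(\beta')$, $\partial_j(s(\beta))=\partial_j(s(\beta'))$ and $\partial_j(t(\beta))=\partial_j(t(\beta'))$ for all $j<i$. A nice sequence is $(\partial_i)_{i\ge0}$ with $\partial_0$ nice and $\partial_i$ a $(\partial_0,\dots,\partial_{i-1})$-nice grading for all $i>0$. The nice length of $M$ is the smallest $n\ge0$ for which there is a nice sequence such that for all distinct $x,y\in\Gamma_0$ one has $\partial_i(x)\ne\partial_i(y)$ for some $i\le n$ ($\infty$ if none exists). If $\Gamma$ is of type $\tilde{\mathbb{A}}$, write it as a closed walk $\Gamma=\beta_1^{\delta_1}\cdots\beta_d^{\delta_d}$ once around the cycle ($\delta_i=\pm1$, $+1$ meaning traversed from source to target, $-1$ the opposite). A winding $c:\Gamma\to Q$ is primitive if $c(\beta_1)^{\delta_1}\cdots c(\beta_d)^{\delta_d}\ne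 q^k$ for every closed walk (cycle) $q$ in $Q$ and every $k>1$. *)

theory Defs
  imports
    "Graph_Theory.Digraph_Component"
    "HOL-Library.Poly_Mapping"
    "HOL-Library.Extended_Nat"
    "HOL.Modules"
begin

section \<open>Quivers\<close>

text \<open>
  A quiver is a \<^typ>\<open>('v, 'a) pre_digraph\<close> satisfying \<^locale>\<open>fin_digraph\<close>, with
  \<^const>\<open>tail\<close> as source and \<^const>\<open>head\<close> as target. The constant \<^const>\<open>connected\<close>
  of the library is already connectedness of the underlying undirected graph (and
  requires a vertex); the constant \<^const>\<open>tree\<close> of the library only forbids directed
  cycles and is not used.
\<close>

definition loop_quiver :: "nat \<Rightarrow> (unit, nat) pre_digraph" where
  "loop_quiver n = \<lparr>verts = {()}, arcs = {..<n}, tail = \<lambda>_. (), head = \<lambda>_. ()\<rparr>"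

text \<open>
  Undirected walks in \<open>Q\<close> are directed walks in its double: the letter \<open>(\<beta>, \<delta>)\<close> is
  \<open>\<beta>\<close> traversed from source to target if \<open>\<delta>\<close> is \<^const>\<open>True\<close> (sign \<open>+1\<close>), and from
  target to source if \<open>\<delta>\<close> is \<^const>\<open>False\<close> (sign \<open>-1\<close>).
\<close>

definition double_quiver :: "('v, 'a) pre_digraph \<Rightarrow> ('v, 'a \<times> bool) pre_digraph" where
  "double_quiver Q =
     \<lparr>verts = verts Q,
      arcs = arcs Q \<times> UNIV,
      tail = (\<lambda>(\<beta>, \<delta>). if \<delta> then tail Q \<beta> else head Q \<beta>),
      head = (\<lambda>(\<beta>, \<delta>). if \<delta> then head Q \<beta> else tail Q \<beta>)\<rparr>"

definition closed_walk :: "('v, 'a) pre_digraph \<Rightarrow> ('a \<times> bool) list \<Rightarrow> bool" where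
  "closed_walk Q q \<longleftrightarrow> (\<exists>u. pre_digraph.awalk (double_quiver Q) u q u)"

text \<open>
  Cycles of the underlying undirected graph. Distinctness of the arrows excludes
  \<open>\<beta>\<beta>\<^sup>-\<^sup>1\<close>; a loop is a cycle of length 1 and two parallel or opposite arrows form a
  cycle of length 2.
\<close>

definition undirected_cycle :: "('v, 'a) pre_digraph \<Rightarrow> ('a \<times> bool) list \<Rightarrow> bool" where
  "undirected_cycle Q w \<longleftrightarrow>
     pre_digraph.cycle (double_quiver Q) w \<and> distinct (map fst w)"

definition tree_quiver :: "('v, 'a) pre_digraph \<Rightarrow> bool" where
  "tree_quiver Q \<longleftrightarrow> connected Q \<and> \<not> (\<exists>w. undirected_cycle Q w)"

text \<open>\<open>w\<close> is a closed walk once around \<open>Q\<close>, and \<open>Q\<close> has no further vertices or arrows.\<close>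

definition once_around :: "('v, 'a) pre_digraph \<Rightarrow> ('a \<times> bool) list \<Rightarrow> bool" where
  "once_around Q w \<longleftrightarrow>
     undirected_cycle Q w \<and> fst ` set w = arcs Q \<and>
     tail (double_quiver Q) ` set w = verts Q"

definition affine_A_quiver :: "('v, 'a) pre_digraph \<Rightarrow> bool" where
  "affine_A_quiver Q \<longleftrightarrow> (\<exists>w. once_around Q w)"

definition H1 :: "('v, 'a) pre_digraph \<Rightarrow> ('a \<Rightarrow>\<^sub>0 int) set" where
  "H1 Q = {z. Poly_Mapping.keys z \<subseteq> arcs Q \<and>
              frag_extend (\<lambda>\<alpha>. frag_of (head Q \<alpha>) - frag_of (tail Q \<alpha>)) z = 0}"

text \<open>The rank of an abelian group: the largest size of a \<open>\<int>\<close>-linearly independent subset.\<close>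

definition rank_H1 :: "('v, 'a) pre_digraph \<Rightarrow> enat" where
  "rank_H1 Q =
     (SUP B \<in> {B. B \<subseteq> H1 Q \<and> finite B \<and> \<not> module.dependent frag_cmul B}. enat (card B))"

definition pseudotree :: "('v, 'a) pre_digraph \<Rightarrow> bool" where
  "pseudotree Q \<longleftrightarrow> fin_digraph Q \<and> connected Q \<and> rank_H1 Q \<le> 1"


section \<open>Windings\<close>

record ('w, 'b, 'v, 'a) quiver_map =
  on_verts :: "'w \<Rightarrow> 'v"
  on_arcs :: "'b \<Rightarrow> 'a"

definition is_quiver_map ::
  "('w, 'b) pre_digraph \<Rightarrow> ('v, 'a) pre_digraph \<Rightarrow> ('w, 'b, 'v, 'a) quiver_map \<Rightarrow> bool" where
  "is_quiver_map \<Gamma> Q c \<longleftrightarrow>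
     (\<forall>x \<in> verts \<Gamma>. on_verts c x \<in> verts Q) \<and>
     (\<forall>\<beta> \<in> arcs \<Gamma>. on_arcs c \<beta> \<in> arcs Q \<and>
        tail Q (on_arcs c \<beta>) = on_verts c (tail \<Gamma> \<beta>) \<and>
        head Q (on_arcs c \<beta>) = on_verts c (head \<Gamma> \<beta>))"

definition winding ::
  "('w, 'b) pre_digraph \<Rightarrow> ('v, 'a) pre_digraph \<Rightarrow> ('w, 'b, 'v, 'a) quiver_map \<Rightarrow> bool" where
  "winding \<Gamma> Q c \<longleftrightarrow>
     is_quiver_map \<Gamma> Q c \<and>
     (\<forall>\<beta> \<in> arcs \<Gamma>. \<forall>\<beta>' \<in> arcs \<Gamma>.
        \<beta> \<noteq> \<beta>' \<and> (tail \<Gamma> \<beta> = tail \<Gamma> \<beta>' \<or> head \<Gamma> \<beta> = head \<Gamma> \<beta>') \<longrightarrow>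
        on_arcs c \<beta> \<noteq> on_arcs c \<beta>')"

text \<open>
  Only meant for \<open>\<Gamma>\<close> of affine type A. Two closed walks once around \<open>\<Gamma>\<close> differ by a
  rotation and possibly a reversal, which preserves being a proper power, so the
  choice of \<open>w\<close> does not matter.
\<close>

definition primitive ::
  "('w, 'b) pre_digraph \<Rightarrow> ('v, 'a) pre_digraph \<Rightarrow> ('w, 'b, 'v, 'a) quiver_map \<Rightarrow> bool" where
  "primitive \<Gamma> Q c \<longleftrightarrow>
     (\<exists>w. once_around \<Gamma> w \<and>
        (\<forall>q k. closed_walk Q q \<and> k > 1 \<longrightarrow>
           map (\<lambda>(\<beta>, \<delta>). (on_arcs c \<beta>, \<delta>)) w \<noteq> concat (replicate k q)))"


section \<open>Representations over the field with one element\<close>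

record 'x pointed_set =
  pcarrier :: "'x set"
  pzero :: 'x

definition f1_space :: "'x pointed_set \<Rightarrow> bool" where
  "f1_space V \<longleftrightarrow> finite (pcarrier V) \<and> pzero V \<in> pcarrier V"

definition f1_linear :: "'x pointed_set \<Rightarrow> 'x pointed_set \<Rightarrow> ('x \<Rightarrow> 'x) \<Rightarrow> bool" where
  "f1_linear V W f \<longleftrightarrow>
     (\<forall>x \<in> pcarrier V. f x \<in> pcarrier W) \<and> f (pzero V) = pzero W \<and>
     inj_on f {x \<in> pcarrier V. f x \<noteq> pzero W}"

record ('v, 'a, 'x) f1_rep =
  rep_space :: "'v \<Rightarrow> 'x pointed_set"
  rep_map :: "'a \<Rightarrow> 'x \<Rightarrow> 'x"

definition f1_representation :: "('v, 'a) pre_digraph \<Rightarrow> ('v, 'a, 'x) f1_rep \<Rightarrow> bool" where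
  "f1_representation Q M \<longleftrightarrow>
     (\<forall>v \<in> verts Q. f1_space (rep_space M v)) \<and>
     (\<forall>\<alpha> \<in> arcs Q.
        f1_linear (rep_space M (tail Q \<alpha>)) (rep_space M (head Q \<alpha>)) (rep_map M \<alpha>))"

definition f1_iso ::
  "('v, 'a) pre_digraph \<Rightarrow> (('v, 'a, 'x) f1_rep \<times> ('v, 'a, 'x) f1_rep) set" where
  "f1_iso Q =
     {(M, N). f1_representation Q M \<and> f1_representation Q N \<and>
        (\<exists>\<phi>. (\<forall>v \<in> verts Q.
                 bij_betw (\<phi> v) (pcarrier (rep_space M v)) (pcarrier (rep_space N v)) \<and>
                 \<phi> v (pzero (rep_space M v)) = pzero (rep_space N v)) \<and>
              (\<forall>\<alpha> \<in> arcs Q. \<forall>x \<in> pcarrier (rep_space M (tail Q \<alpha>)).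
                 \<phi> (head Q \<alpha>) (rep_map M \<alpha> x) = rep_map N \<alpha> (\<phi> (tail Q \<alpha>) x)))}"

definition iso_class ::
  "('v, 'a) pre_digraph \<Rightarrow> ('v, 'a, 'x) f1_rep \<Rightarrow> ('v, 'a, 'x) f1_rep set" where
  "iso_class Q M = f1_iso Q `` {M}"

definition subrepresentation ::
  "('v, 'a) pre_digraph \<Rightarrow> ('v, 'a, 'x) f1_rep \<Rightarrow> ('v \<Rightarrow> 'x set) \<Rightarrow> bool" where
  "subrepresentation Q M U \<longleftrightarrow>
     (\<forall>v \<in> verts Q. U v \<subseteq> pcarrier (rep_space M v) \<and> pzero (rep_space M v) \<in> U v) \<and>
     (\<forall>\<alpha> \<in> arcs Q. \<forall>x \<in> U (tail Q \<alpha>). rep_map M \<alpha> x \<in> U (head Q \<alpha>))"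

definition nonzero_family ::
  "('v, 'a) pre_digraph \<Rightarrow> ('v, 'a, 'x) f1_rep \<Rightarrow> ('v \<Rightarrow> 'x set) \<Rightarrow> bool" where
  "nonzero_family Q M U \<longleftrightarrow> (\<exists>v \<in> verts Q. U v \<noteq> {pzero (rep_space M v)})"

text \<open>\<open>M\<close> is obtained by gluing the subrepresentations \<open>U\<close> and \<open>W\<close> at zero.\<close>

definition is_direct_sum ::
  "('v, 'a) pre_digraph \<Rightarrow> ('v, 'a, 'x) f1_rep \<Rightarrow>
     ('v \<Rightarrow> 'x set) \<Rightarrow> ('v \<Rightarrow> 'x set) \<Rightarrow> bool" where
  "is_direct_sum Q M U W \<longleftrightarrow>
     subrepresentation Q M U \<and> subrepresentation Q M W \<and>
     (\<forall>v \<in> verts Q. U v \<union> W v = pcarrier (rep_space M v) \<and>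
                    U v \<inter> W v = {pzero (rep_space M v)})"

text \<open>The zero representation does not count as indecomposable.\<close>

definition indecomposable :: "('v, 'a) pre_digraph \<Rightarrow> ('v, 'a, 'x) f1_rep \<Rightarrow> bool" where
  "indecomposable Q M \<longleftrightarrow>
     nonzero_family Q M (\<lambda>v. pcarrier (rep_space M v)) \<and>
     \<not> (\<exists>U W. is_direct_sum Q M U W \<and> nonzero_family Q M U \<and> nonzero_family Q M W)"

definition nilpotent :: "('v, 'a) pre_digraph \<Rightarrow> ('v, 'a, 'x) f1_rep \<Rightarrow> bool" where
  "nilpotent Q M \<longleftrightarrow>
     (\<exists>N. \<forall>n \<ge> N. \<forall>u p v. pre_digraph.awalk Q u p v \<and> length p = n \<longrightarrow>
        (\<forall>x \<in> pcarrier (rep_space M u). fold (rep_map M) p x = pzero (rep_space M v)))"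

text \<open>
  Finite-dimensionality is automatic: \<open>Q\<close> is finite and each \<open>M\<^sub>v\<close> is a finite set.
\<close>

definition indec_nil :: "('v, 'a) pre_digraph \<Rightarrow> ('v, 'a, 'x) f1_rep set" where
  "indec_nil Q = {M. f1_representation Q M \<and> indecomposable Q M \<and> nilpotent Q M}"


section \<open>Coefficient quivers\<close>

text \<open>
  The sets \<open>M\<^sub>v\<close> need not be disjoint, so an element \<open>x\<close> of \<open>M\<^sub>v\<close> becomes the vertex
  \<open>(v, x)\<close>, and the arrow over \<open>\<alpha>\<close> starting at \<open>x\<close> is \<open>(\<alpha>, x)\<close>.
\<close>

definition coeff_quiver ::
  "('v, 'a) pre_digraph \<Rightarrow> ('v, 'a, 'x) f1_rep \<Rightarrow> ('v \<times> 'x, 'a \<times> 'x) pre_digraph" where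
  "coeff_quiver Q M =
     \<lparr>verts = (SIGMA v : verts Q. pcarrier (rep_space M v) - {pzero (rep_space M v)}),
      arcs = {(\<alpha>, x). \<alpha> \<in> arcs Q \<and>
                x \<in> pcarrier (rep_space M (tail Q \<alpha>)) - {pzero (rep_space M (tail Q \<alpha>))} \<and>
                rep_map M \<alpha> x \<noteq> pzero (rep_space M (head Q \<alpha>))},
      tail = (\<lambda>(\<alpha>, x). (tail Q \<alpha>, x)),
      head = (\<lambda>(\<alpha>, x). (head Q \<alpha>, rep_map M \<alpha> x))\<rparr>"

definition coeff_winding ::
  "('v, 'a) pre_digraph \<Rightarrow> ('v, 'a, 'x) f1_rep \<Rightarrow>
     ('v \<times> 'x, 'a \<times> 'x, 'v, 'a) quiver_map" where
  "coeff_winding Q M = \<lparr>on_verts = fst, on_arcs = fst\<rparr>"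

lemma fin_digraph_coeff_quiver:
  assumes "fin_digraph Q" "f1_representation Q M"
  shows "fin_digraph (coeff_quiver Q M)"
proof -
  interpret fin_digraph Q by fact
  have fin: "finite (pcarrier (rep_space M v))" if "v \<in> verts Q" for v
    using assms(2) that by (auto simp: f1_representation_def f1_space_def)
  have "arcs (coeff_quiver Q M) \<subseteq> (SIGMA \<alpha> : arcs Q. pcarrier (rep_space M (tail Q \<alpha>)))"
    by (auto simp: coeff_quiver_def)
  moreover have "finite \<dots>" using fin by (intro finite_SigmaI) auto
  ultimately have "finite (arcs (coeff_quiver Q M))" by (rule finite_subset)
  moreover have "finite (verts (coeff_quiver Q M))"
    using fin by (auto simp: coeff_quiver_def)
  ultimately show ?thesis
    using assms(2)
    by unfold_locales (auto simp: coeff_quiver_def f1_representation_def f1_linear_def)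
qed

lemma winding_coeff_winding:
  assumes "fin_digraph Q" "f1_representation Q M"
  shows "winding (coeff_quiver Q M) Q (coeff_winding Q M)"
proof -
  interpret fin_digraph Q by fact
  have "x = y"
    if "\<alpha> \<in> arcs Q" "rep_map M \<alpha> x = rep_map M \<alpha> y"
      "x \<in> pcarrier (rep_space M (tail Q \<alpha>))" "y \<in> pcarrier (rep_space M (tail Q \<alpha>))"
      "rep_map M \<alpha> y \<noteq> pzero (rep_space M (head Q \<alpha>))" for \<alpha> x y
    using assms(2) that
    by (auto simp: f1_representation_def f1_linear_def dest!: bspec[where x = \<alpha>] inj_onD)
  then show ?thesis
    by (auto simp: winding_def is_quiver_map_def coeff_quiver_def coeff_winding_def)
qed


section \<open>Gradings and nice length\<close>

definition nice_grading ::
  "('w, 'b) pre_digraph \<Rightarrow> ('w, 'b, 'v, 'a) quiver_map \<Rightarrow> ('w \<Rightarrow> int) \<Rightarrow> bool" where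
  "nice_grading \<Gamma> c d \<longleftrightarrow>
     (\<forall>\<beta> \<in> arcs \<Gamma>. \<forall>\<beta>' \<in> arcs \<Gamma>. on_arcs c \<beta> = on_arcs c \<beta>' \<longrightarrow>
        d (head \<Gamma> \<beta>) - d (tail \<Gamma> \<beta>) = d (head \<Gamma> \<beta>') - d (tail \<Gamma> \<beta>'))"

text \<open>\<open>d\<close> is a \<open>(ds 0, \<dots>, ds (i - 1))\<close>-nice grading.\<close>

definition nice_relative_to ::
  "('w, 'b) pre_digraph \<Rightarrow> ('w, 'b, 'v, 'a) quiver_map \<Rightarrow> (nat \<Rightarrow> 'w \<Rightarrow> int) \<Rightarrow> nat \<Rightarrow>
     ('w \<Rightarrow> int) \<Rightarrow> bool" where
  "nice_relative_to \<Gamma> c ds i d \<longleftrightarrow>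
     (\<forall>\<beta> \<in> arcs \<Gamma>. \<forall>\<beta>' \<in> arcs \<Gamma>.
        on_arcs c \<beta> = on_arcs c \<beta>' \<and>
        (\<forall>j < i. ds j (tail \<Gamma> \<beta>) = ds j (tail \<Gamma> \<beta>') \<and>
                 ds j (head \<Gamma> \<beta>) = ds j (head \<Gamma> \<beta>')) \<longrightarrow>
        d (head \<Gamma> \<beta>) - d (tail \<Gamma> \<beta>) = d (head \<Gamma> \<beta>') - d (tail \<Gamma> \<beta>'))"

definition nice_sequence ::
  "('w, 'b) pre_digraph \<Rightarrow> ('w, 'b, 'v, 'a) quiver_map \<Rightarrow> (nat \<Rightarrow> 'w \<Rightarrow> int) \<Rightarrow> bool" where
  "nice_sequence \<Gamma> c ds \<longleftrightarrow>
     nice_grading \<Gamma> c (ds 0) \<and> (\<forall>i > 0. nice_relative_to \<Gamma> c ds i (ds i))"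

definition separates_up_to ::
  "('w, 'b) pre_digraph \<Rightarrow> (nat \<Rightarrow> 'w \<Rightarrow> int) \<Rightarrow> nat \<Rightarrow> bool" where
  "separates_up_to \<Gamma> ds n \<longleftrightarrow>
     (\<forall>x \<in> verts \<Gamma>. \<forall>y \<in> verts \<Gamma>. x \<noteq> y \<longrightarrow> (\<exists>i \<le> n. ds i x \<noteq> ds i y))"

text \<open>The infimum of the empty set in \<^typ>\<open>enat\<close> is \<open>\<infinity>\<close>.\<close>

definition nice_length :: "('v, 'a) pre_digraph \<Rightarrow> ('v, 'a, 'x) f1_rep \<Rightarrow> enat" where
  "nice_length Q M =
     Inf {enat n | n. \<exists>ds. nice_sequence (coeff_quiver Q M) (coeff_winding Q M) ds \<and>
                           separates_up_to (coeff_quiver Q M) ds n}"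

definition I_nil :: "('v, 'a) pre_digraph \<Rightarrow> nat \<Rightarrow> ('v, 'a, 'x) f1_rep set set" where
  "I_nil Q n = {M \<in> indec_nil Q. nice_length Q M = enat n} // f1_iso Q"

definition I_nil_nice :: "('v, 'a) pre_digraph \<Rightarrow> ('v, 'a, 'x) f1_rep set set" where
  "I_nil_nice Q = (\<Union>n. I_nil Q n)"

end

theory Submission
  imports Defs
begin

text \<open>
  Grading steps as cochains. Suppose that finitely many gradings of \<open>\<Gamma>\<close> have been chosen and let \<open>\<kappa>\<close> be
  the tuple of their values. Identifying vertices with equal \<open>\<kappa>\<close>, and arrows with identified ends and
  equal image under \<open>c\<close>, gives a quotient quiver, and \<open>\<Gamma>\<close> is immersed in it because \<open>c\<close> is a winding.
  The next grading may be any function whose coboundary is pulled back from a \<open>1\<close>-cochain on that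
  quotient. It separates \<open>x\<close> from \<open>y\<close> with \<open>\<kappa> x = \<kappa> y\<close> when the cochain is nonzero on the closed walk
  onto which a path from \<open>x\<close> to \<open>y\<close> is mapped. As \<open>\<Gamma>\<close> is finite, the nice length is finite as soon as
  every \<open>\<kappa>\<close> that is not injective admits such a step (\<open>separated_if_refinable\<close>).

  Trees. Every cochain pulls back to a coboundary. A shortest path between distinct vertices with equal
  \<open>\<kappa>\<close> maps to a simple cycle of the quotient, hence crosses its first arrow once, and the indicator of
  that arrow separates its ends (\<open>tree_separating_grading\<close>).

  Cycles. A cochain pulls back to a coboundary iff it vanishes on the image \<open>W\<close> of the cycle. If no step
  separates anything, every closed arc of \<open>W\<close> is homologous to a rational multiple of a shortest one,
  \<open>C\<close>, and so uses every arrow off \<open>C\<close> zero times in total. Then the reduced walk \<open>W\<close> can never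
  leave \<open>C\<close> (\<open>shortest_closed_arc_repeats\<close>): the first closed arc formed after leaving it would be
  simple and would cross an arrow off \<open>C\<close> exactly once. So \<open>W\<close> is a power of \<open>C\<close>, and so is its image in
  \<open>Q\<close>, contradicting primitivity. Conversely, if \<open>c\<close> maps the cycle to \<open>q\<^sup>k\<close>, every grading of a nice
  sequence changes by the same amount each time \<open>q\<close> is traversed; these \<open>k\<close> equal changes add up to
  zero, so the gradings are invariant under the shift by \<open>q\<close> (\<open>separated_imp_primitive\<close>).

  Pseudotrees. If \<open>rank H\<^sub>1 \<le> 1\<close>, all closed walks of \<open>Q\<close> have proportional homology classes, so the same
  combinatorial statement shows that the image of a cycle of \<open>\<Gamma>\<close> is a power of a simple cycle, of nonzero
  class. A nice grading vanishes on that class, hence on every closed walk of \<open>Q\<close>, hence is constant on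
  the fibres of \<open>c\<close>; this propagates along a nice sequence. A separating sequence therefore forces \<open>c\<close> to
  be injective on vertices, and the nice length is \<open>0\<close>. So over a pseudotree, every \<open>M\<close> of finite nice
  length whose coefficient quiver is not a tree belongs to the first case.

  Examples. All three live on a quiver with one vertex and loops \<open>a, b\<close> (further loops act as zero)
  and contain the path
  \<open>4 \<rightarrow> 3 \<rightarrow> 1 \<leftarrow> 2 \<leftarrow> 5\<close> labelled \<open>a, b, a, b\<close>, i.e. the commutator \<open>a b a\<^sup>-\<^sup>1 b\<^sup>-\<^sup>1\<close>. It is null-homologous,
  so no nice grading separates its ends. Alone it is a tree; the arrow \<open>5 \<rightarrow> 4\<close> over \<open>a\<close> closes it to a
  cycle; the further arrow \<open>6 \<rightarrow> 5\<close> over \<open>a\<close> gives a quiver that is neither.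
\<close>

section \<open>Walks in the underlying undirected graph\<close>

abbreviation uwalk :: "('w, 'b) pre_digraph \<Rightarrow> 'w \<Rightarrow> ('b \<times> bool) list \<Rightarrow> 'w \<Rightarrow> bool" where
  "uwalk \<Gamma> \<equiv> pre_digraph.awalk (double_quiver \<Gamma>)"

lemma double_quiver_simps [simp]:
  "verts (double_quiver \<Gamma>) = verts \<Gamma>"
  "arcs (double_quiver \<Gamma>) = arcs \<Gamma> \<times> UNIV"
  "tail (double_quiver \<Gamma>) (\<beta>, \<delta>) = (if \<delta> then tail \<Gamma> \<beta> else head \<Gamma> \<beta>)"
  "head (double_quiver \<Gamma>) (\<beta>, \<delta>) = (if \<delta> then head \<Gamma> \<beta> else tail \<Gamma> \<beta>)"
  by (simp_all add: double_quiver_def)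

lemma wf_digraph_double_quiver:
  assumes "wf_digraph \<Gamma>" shows "wf_digraph (double_quiver \<Gamma>)"
proof -
  interpret wf_digraph \<Gamma> by fact
  show ?thesis by unfold_locales (auto split: if_splits)
qed

text \<open>
  Naming the vertices of a walk by a function of the position makes subwalks and periodic
  continuations simple reindexings.
\<close>

lemma cas_iff_positions:
  "pre_digraph.cas G u p v \<longleftrightarrow>
     (\<exists>x. x 0 = u \<and> x (length p) = v \<and>
          (\<forall>i < length p. tail G (p ! i) = x i \<and> head G (p ! i) = x (Suc i)))"
proof (induction p arbitrary: u)
  case Nil
  show ?case by (auto simp: pre_digraph.cas.simps intro: exI[of _ "\<lambda>_. u"])
next
  case (Cons e p)
  show ?case
  proof
    assume "pre_digraph.cas G u (e # p) v"
    then have u: "tail G e = u" and "pre_digraph.cas G (head G e) p v"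
      by (auto simp: pre_digraph.cas.simps)
    then obtain x where x: "x 0 = head G e" "x (length p) = v"
      "\<forall>i < length p. tail G (p ! i) = x i \<and> head G (p ! i) = x (Suc i)"
      using Cons.IH by blast
    have "tail G ((e # p) ! i) = (case i of 0 \<Rightarrow> u | Suc k \<Rightarrow> x k) \<and>
          head G ((e # p) ! i) = x i" if "i < length (e # p)" for i
      using that x u by (cases i) auto
    with x show "\<exists>x. x 0 = u \<and> x (length (e # p)) = v \<and>
        (\<forall>i < length (e # p). tail G ((e # p) ! i) = x i \<and> head G ((e # p) ! i) = x (Suc i))"
      by (intro exI[of _ "\<lambda>i. case i of 0 \<Rightarrow> u | Suc k \<Rightarrow> x k"]) auto
  next
    assume "\<exists>x. x 0 = u \<and> x (length (e # p)) = v \<and>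
        (\<forall>i < length (e # p). tail G ((e # p) ! i) = x i \<and> head G ((e # p) ! i) = x (Suc i))"
    then obtain x where x: "x 0 = u" "x (length (e # p)) = v"
      "\<And>i. i < length (e # p) \<Longrightarrow> tail G ((e # p) ! i) = x i \<and> head G ((e # p) ! i) = x (Suc i)"
      by blast
    have "pre_digraph.cas G (head G e) p v"
      unfolding Cons.IH using x(2) x(3)[of 0] x(3)[of "Suc i" for i]
      by (intro exI[of _ "\<lambda>i. x (Suc i)"]) auto
    with x(1) x(3)[of 0] show "pre_digraph.cas G u (e # p) v"
      by (auto simp: pre_digraph.cas.simps)
  qed
qed

lemma awalk_iff_positions:
  "pre_digraph.awalk G u p v \<longleftrightarrow> u \<in> verts G \<and> set p \<subseteq> arcs G \<and>
     (\<exists>x. x 0 = u \<and> x (length p) = v \<and>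
          (\<forall>i < length p. tail G (p ! i) = x i \<and> head G (p ! i) = x (Suc i)))"
  by (simp add: pre_digraph.awalk_def cas_iff_positions)

lemma awalk_slice:
  assumes "wf_digraph G" "set p \<subseteq> arcs G" "i \<le> j" "j \<le> length p" "x i \<in> verts G"
    "\<forall>i < length p. tail G (p ! i) = x i \<and> head G (p ! i) = x (Suc i)"
  shows "pre_digraph.awalk G (x i) (take (j - i) (drop i p)) (x j)"
  unfolding awalk_iff_positions
  using assms set_take_subset[of "j - i" "drop i p"] set_drop_subset[of i p]
  by (intro conjI exI[of _ "\<lambda>k. x (i + k)"]) auto

lemma awalk_position_in_verts:
  assumes "wf_digraph G" "x 0 \<in> verts G" "set p \<subseteq> arcs G" "i \<le> length p"
    "\<forall>i < length p. tail G (p ! i) = x i \<and> head G (p ! i) = x (Suc i)"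
  shows "x i \<in> verts G"
proof (cases i)
  case 0
  with assms show ?thesis by simp
next
  case (Suc k)
  with assms have "k < length p" "p ! k \<in> arcs G" "head G (p ! k) = x i" by auto
  then show ?thesis using assms(1) by (metis wf_digraph.head_in_verts)
qed

text \<open>
  A cyclic form of the definition: successor positions are taken modulo the length, so that the
  cycle can be read as a periodic sequence without a distinguished starting point.
\<close>

lemma undirected_cycle_iff:
  assumes "wf_digraph \<Gamma>"
  shows "undirected_cycle \<Gamma> w \<longleftrightarrow>
     w \<noteq> [] \<and> fst ` set w \<subseteq> arcs \<Gamma> \<and> distinct (map fst w) \<and>
     distinct (map (tail (double_quiver \<Gamma>)) w) \<and>
     (\<forall>i < length w. head (double_quiver \<Gamma>) (w ! i) =
                     tail (double_quiver \<Gamma>) (w ! (Suc i mod length w)))" (is "?L \<longleftrightarrow> ?R")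
proof -
  let ?D = "double_quiver \<Gamma>"
  interpret D: wf_digraph ?D using assms by (rule wf_digraph_double_quiver)
  have arcs: "set w \<subseteq> arcs ?D \<longleftrightarrow> fst ` set w \<subseteq> arcs \<Gamma>" by (auto simp: image_iff subset_iff)
  show ?thesis
  proof
    assume L: ?L
    then obtain u where u: "D.awalk u w u" "distinct (tl (D.awalk_verts u w))" "w \<noteq> []"
      "distinct (map fst w)"
      by (auto simp: undirected_cycle_def D.cycle_def)
    then obtain x where x: "x 0 = u" "x (length w) = u"
      "\<And>i. i < length w \<Longrightarrow> tail ?D (w ! i) = x i \<and> head ?D (w ! i) = x (Suc i)"
      by (auto simp: awalk_iff_positions)
    have "D.awalk_verts u w = u # map (head ?D) w"
      using u x(3)[of 0] x(1) D.awalk_verts_conv'[of u w u]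
      by (auto simp: D.awalk_def hd_conv_nth)
    then have dh: "distinct (map (head ?D) w)" using u by simp
    have nxt: "head ?D (w ! i) = tail ?D (w ! (Suc i mod length w))" if "i < length w" for i
      using x(1,2) x(3)[of 0] x(3)[of i] x(3)[of "Suc i"] that u(3) by (cases "Suc i = length w") auto
    have dhD: "i = j" if "i < length w" "j < length w" "head ?D (w ! i) = head ?D (w ! j)" for i j
      using nth_eq_iff_index_eq[OF dh, of i j] that by simp
    have prev: "\<exists>k < length w. head ?D (w ! k) = tail ?D (w ! i) \<and> i = Suc k mod length w"
      if "i < length w" for i
    proof (cases i)
      case 0
      then show ?thesis using that nxt[of "length w - 1"] u(3) by (intro exI[of _ "length w - 1"]) auto
    next
      case (Suc k)
      then show ?thesis using that nxt[of k] by (intro exI[of _ k]) auto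
    qed
    have "inj_on (\<lambda>i. tail ?D (w ! i)) {..<length w}"
    proof (rule inj_onI)
      fix i j assume ij: "i \<in> {..<length w}" "j \<in> {..<length w}"
        and eq: "tail ?D (w ! i) = tail ?D (w ! j)"
      obtain k m where "k < length w" "head ?D (w ! k) = tail ?D (w ! i)" "i = Suc k mod length w"
        "m < length w" "head ?D (w ! m) = tail ?D (w ! j)" "j = Suc m mod length w"
        using prev[of i] prev[of j] ij unfolding lessThan_iff by blast
      then show "i = j" using dhD[of k m] eq by simp
    qed
    then have "distinct (map (tail ?D) w)" by (auto simp: distinct_conv_nth inj_on_def)
    with u nxt show ?R by (auto simp: D.awalk_def)
  next
    assume R: ?R
    let ?x = "\<lambda>i. tail ?D (w ! (i mod length w))"
    have ne: "w \<noteq> []" using R by blast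
    have x: "\<forall>i < length w. tail ?D (w ! i) = ?x i \<and> head ?D (w ! i) = ?x (Suc i)"
      using R by auto
    have w0: "w ! 0 \<in> arcs ?D" using R arcs by (meson length_greater_0_conv nth_mem subsetD)
    then have "?x 0 \<in> verts ?D" using D.tail_in_verts by simp
    with R x arcs have aw: "D.awalk (?x 0) w (?x 0)"
      unfolding awalk_iff_positions by (intro conjI exI[of _ ?x]) auto
    have "D.awalk_verts (?x 0) w = ?x 0 # map (head ?D) w"
      using ne aw D.awalk_verts_conv'[of "?x 0" w "?x 0"]
      by (auto simp: D.awalk_def hd_conv_nth)
    moreover have "distinct (map (head ?D) w)"
    proof -
      have "i = j" if "i < length w" "j < length w" "head ?D (w ! i) = head ?D (w ! j)" for i j
      proof -
        have "tail ?D (w ! (Suc i mod length w)) = tail ?D (w ! (Suc j mod length w))"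
          using that R by auto
        moreover have "Suc i mod length w < length w" "Suc j mod length w < length w"
          using ne by simp_all
        moreover have "distinct (map (tail ?D) w)" using R by blast
        ultimately have "Suc i mod length w = Suc j mod length w"
          using nth_eq_iff_index_eq[of "map (tail ?D) w" "Suc i mod length w" "Suc j mod length w"]
          by simp
        then show ?thesis using that by (auto simp: mod_Suc split: if_splits)
      qed
      then show ?thesis by (auto simp: distinct_conv_nth)
    qed
    ultimately show ?L using R aw ne by (auto simp: undirected_cycle_def D.cycle_def)
  qed
qed

section \<open>Cochains on walks and potentials\<close>

text \<open>
  The value of a \<open>1\<close>-cochain on an arrow traversed in either direction.
\<close>

definition signed :: "('e \<Rightarrow> int) \<Rightarrow> 'e \<times> bool \<Rightarrow> int" where
  "signed f l = (if snd l then f (fst l) else - f (fst l))"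

lemma signed_simps [simp]: "signed f (e, True) = f e" "signed f (e, False) = - f e"
  by (simp_all add: signed_def)

abbreviation walk_sum :: "('e \<Rightarrow> int) \<Rightarrow> ('e \<times> bool) list \<Rightarrow> int" where
  "walk_sum f p \<equiv> sum_list (map (signed f) p)"

text \<open>
  A simple arc of a reduced walk crosses each arrow at most once. Crossing it twice in the same
  direction repeats its starting vertex; crossing it in opposite directions forces the two crossings
  to be adjacent, and reducedness excludes backtracking. The arc may be closed: its last vertex is
  not compared with the others.
\<close>

lemma letter_distinct_in_simple_closed_arc:
  fixes l :: "nat \<Rightarrow> 'e \<times> bool" and v :: "nat \<Rightarrow> 'v" and H :: "('v, 'e) pre_digraph"
  assumes letters: "\<And>i. a \<le> i \<Longrightarrow> i < b \<Longrightarrow>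
      tail (double_quiver H) (l i) = v i \<and> head (double_quiver H) (l i) = v (Suc i)"
    and simple: "inj_on v {a..<b}"
    and reduced: "\<And>i. a \<le> i \<Longrightarrow> Suc i < b \<Longrightarrow> fst (l (Suc i)) = fst (l i) \<Longrightarrow> l (Suc i) = l i"
  shows "inj_on (\<lambda>i. fst (l i)) {a..<b}"
proof -
  have "False" if "a \<le> p" "p < q" "q < b" "fst (l p) = fst (l q)" for p q
  proof -
    have p: "tail (double_quiver H) (l p) = v p" "head (double_quiver H) (l p) = v (Suc p)"
      and q: "tail (double_quiver H) (l q) = v q"
      using letters that by auto
    show False
    proof (cases "snd (l p) = snd (l q)")
      case True
      then have "l p = l q" using that(4) by (simp add: prod_eq_iff)
      then have "v p = v q" using p q by simp
      then show False using simple that by (auto dest: inj_onD)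
    next
      case False
      have "head (double_quiver H) (l p) = tail (double_quiver H) (l q)"
        using that(4) False by (cases "l p"; cases "l q") auto
      then have "v (Suc p) = v q" using p q by simp
      then have "Suc p = q" using simple that by (auto dest: inj_onD)
      then have "l q = l p" using reduced[of p] that by auto
      then show False using False by simp
    qed
  qed
  then show ?thesis unfolding inj_on_def by (metis atLeastLessThan_iff linorder_neqE_nat)
qed

definition reverse_walk :: "('e \<times> bool) list \<Rightarrow> ('e \<times> bool) list" where
  "reverse_walk p = rev (map (\<lambda>(e, \<delta>). (e, \<not> \<delta>)) p)"

lemma walk_sum_reverse: "walk_sum f (reverse_walk p) = - walk_sum f p"
  by (induction p) (auto simp: reverse_walk_def signed_def)

lemma uwalk_append:
  assumes "wf_digraph \<Gamma>" "uwalk \<Gamma> u p v" "uwalk \<Gamma> v q w"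
  shows "uwalk \<Gamma> u (p @ q) w"
  using wf_digraph.awalk_appendI[OF wf_digraph_double_quiver] assms by metis

lemma uwalk_reverse:
  assumes "wf_digraph \<Gamma>" "uwalk \<Gamma> u p v"
  shows "uwalk \<Gamma> v (reverse_walk p) u"
  using assms(2)
proof (induction p arbitrary: u)
  case Nil
  then show ?case
    by (auto simp: reverse_walk_def wf_digraph.awalk_Nil_iff[OF wf_digraph_double_quiver[OF assms(1)]])
next
  case (Cons l p)
  interpret D: wf_digraph "double_quiver \<Gamma>" by (rule wf_digraph_double_quiver) fact
  obtain e \<delta> where l: "l = (e, \<delta>)" by force
  have h: "e \<in> arcs \<Gamma>" "u = tail (double_quiver \<Gamma>) l" "D.awalk (head (double_quiver \<Gamma>) l) p v"
    using Cons.prems l by (auto simp: D.awalk_Cons_iff)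
  have "D.awalk (head (double_quiver \<Gamma>) l) [(e, \<not> \<delta>)] u"
    using h l D.arc_implies_awalk[of "(e, \<not> \<delta>)"] by auto
  with Cons.IH[OF h(3)] have "D.awalk v (reverse_walk p @ [(e, \<not> \<delta>)]) u"
    by (rule D.awalk_appendI)
  then show ?case by (simp add: reverse_walk_def l)
qed

lemma uwalk_in_verts:
  assumes "wf_digraph \<Gamma>" "uwalk \<Gamma> u p v"
  shows "u \<in> verts \<Gamma>" "v \<in> verts \<Gamma>"
  using wf_digraph.awalk_hd_in_verts[OF wf_digraph_double_quiver[OF assms(1)] assms(2)]
    wf_digraph.awalk_last_in_verts[OF wf_digraph_double_quiver[OF assms(1)] assms(2)]
  by auto

lemma uwalk_positions:
  assumes "wf_digraph \<Gamma>" "uwalk \<Gamma> u p v"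
  obtains x where "x 0 = u" "x (length p) = v" "set p \<subseteq> arcs (double_quiver \<Gamma>)"
    "\<forall>i < length p. tail (double_quiver \<Gamma>) (p ! i) = x i \<and> head (double_quiver \<Gamma>) (p ! i) = x (Suc i)"
    "\<And>i. i \<le> length p \<Longrightarrow> x i \<in> verts \<Gamma>"
    "\<And>i j. i \<le> j \<Longrightarrow> j \<le> length p \<Longrightarrow> uwalk \<Gamma> (x i) (take (j - i) (drop i p)) (x j)"
    "\<And>i j. i \<le> j \<Longrightarrow> j \<le> length p \<Longrightarrow> x i = x j \<Longrightarrow> uwalk \<Gamma> u (take i p @ drop j p) v"
proof -
  let ?D = "double_quiver \<Gamma>"
  have wfD: "wf_digraph ?D" using assms(1) by (rule wf_digraph_double_quiver)
  from assms(2) obtain x where x: "x 0 = u" "x (length p) = v" "set p \<subseteq> arcs ?D"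
    "\<forall>i < length p. tail ?D (p ! i) = x i \<and> head ?D (p ! i) = x (Suc i)"
    unfolding awalk_iff_positions by blast
  have u: "x 0 \<in> verts ?D" using uwalk_in_verts[OF assms] x(1) by simp
  have V: "x i \<in> verts ?D" if "i \<le> length p" for i
    using awalk_position_in_verts[OF wfD u x(3) that x(4)] .
  have sl: "uwalk \<Gamma> (x i) (take (j - i) (drop i p)) (x j)" if "i \<le> j" "j \<le> length p" for i j
    using awalk_slice[OF wfD x(3) that _ x(4)] V that by simp
  have cut: "uwalk \<Gamma> u (take i p @ drop j p) v" if "i \<le> j" "j \<le> length p" "x i = x j" for i j
    using uwalk_append[OF assms(1) sl[of 0 i]] sl[of j "length p"] that x by simp
  show ?thesis using that[OF x] V sl cut by simp
qed

text \<open>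
  A closed walk with a repeated inner vertex splits into two shorter closed walks. A simple one either is an
  undirected cycle or runs back and forth along a single arrow, where the two contributions cancel.
\<close>

lemma closed_walk_sum_zero_if_no_cycle:
  assumes wf: "wf_digraph \<Gamma>" and nocyc: "\<nexists>w. undirected_cycle \<Gamma> w"
    and "uwalk \<Gamma> u p u"
  shows "walk_sum f p = 0"
  using assms(3)
proof (induction p arbitrary: u rule: length_induct)
  case (1 p)
  let ?D = "double_quiver \<Gamma>"
  obtain x where x: "x 0 = u" "x (length p) = u" "set p \<subseteq> arcs ?D"
    "\<forall>i < length p. tail ?D (p ! i) = x i \<and> head ?D (p ! i) = x (Suc i)"
    and slice: "\<And>i j. i \<le> j \<Longrightarrow> j \<le> length p \<Longrightarrow> uwalk \<Gamma> (x i) (take (j - i) (drop i p)) (x j)"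
    and cut: "\<And>i j. i \<le> j \<Longrightarrow> j \<le> length p \<Longrightarrow> x i = x j \<Longrightarrow> uwalk \<Gamma> u (take i p @ drop j p) u"
    using uwalk_positions[OF wf 1(2)] by metis
  show ?case
  proof (cases "p = []")
    case False
    show ?thesis
    proof (cases "inj_on x {0..<length p}")
      case False
      then obtain i j where ij: "i < j" "j < length p" "x i = x j"
        by (metis atLeastLessThan_iff inj_onI linorder_neqE_nat)
      let ?m = "take (j - i) (drop i p)"
      have split: "p = take i p @ ?m @ drop j p"
        using ij append_take_drop_id[of "j - i" "drop i p"] append_take_drop_id[of i p]
        by (simp add: drop_drop)
      have IH: "walk_sum f q = 0" if "length q < length p" "uwalk \<Gamma> y q y" for q y
        using 1(1) that by blast
      have "walk_sum f ?m = 0"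
        by (rule IH[of _ "x i"]) (use slice[of i j] ij in auto)
      moreover have "walk_sum f (take i p @ drop j p) = 0"
        by (rule IH[of _ u]) (use cut[of i j] ij in \<open>auto simp: min_def\<close>)
      ultimately show ?thesis by (subst split) simp
    next
      case inj: True
      show ?thesis
      proof (cases "\<exists>i. Suc i < length p \<and> fst (p ! Suc i) = fst (p ! i) \<and> p ! Suc i \<noteq> p ! i")
        case True
        then obtain i where i: "Suc i < length p" "fst (p ! Suc i) = fst (p ! i)" "p ! Suc i \<noteq> p ! i"
          by blast
        have "head ?D (p ! Suc i) = tail ?D (p ! i)"
          using i by (cases "p ! i"; cases "p ! Suc i") auto
        then have ret: "x (Suc (Suc i)) = x i" using x(4) i by simp
        have len: "length p = 2 \<and> i = 0"
        proof (cases "Suc (Suc i) < length p")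
          case True
          then show ?thesis using inj ret by (auto dest!: inj_onD)
        next
          case False
          then have "Suc (Suc i) = length p" using i by simp
          then have "x i = x 0" using ret x by simp
          then have "i = 0" using inj i by (auto dest!: inj_onD)
          then show ?thesis using False i by simp
        qed
        then obtain l l' where p: "p = [l, l']"
          by (metis One_nat_def Suc_1 length_0_conv length_Suc_conv)
        show ?thesis using i len p by (cases l; cases l') (auto simp: signed_def)
      next
        case False
        have "inj_on (\<lambda>i. fst (p ! i)) {0..<length p}"
          by (rule letter_distinct_in_simple_closed_arc[where v = x and H = \<Gamma>])
            (use x inj False in auto)
        then have "distinct (map fst p)" by (auto simp: distinct_conv_nth inj_on_def)
        moreover have "distinct (map (tail ?D) p)"
          using inj x(4) by (auto simp: distinct_conv_nth inj_on_def)
        moreover have "head ?D (p ! i) = tail ?D (p ! (Suc i mod length p))" if "i < length p" for i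
          using x that \<open>p \<noteq> []\<close> by (cases "Suc i = length p") auto
        ultimately have "undirected_cycle \<Gamma> p"
          using x(3) \<open>p \<noteq> []\<close> by (auto simp: undirected_cycle_iff[OF wf])
        then show ?thesis using nocyc by blast
      qed
    qed
  qed simp
qed

lemma walk_sum_coboundary:
  assumes "wf_digraph \<Gamma>" "uwalk \<Gamma> u p v"
    "\<And>\<beta>. \<beta> \<in> arcs \<Gamma> \<Longrightarrow> d (head \<Gamma> \<beta>) - d (tail \<Gamma> \<beta>) = f \<beta>"
  shows "walk_sum f p = d v - d u"
  using assms(2)
proof (induction p arbitrary: u)
  case Nil
  then show ?case
    by (simp add: wf_digraph.awalk_Nil_iff[OF wf_digraph_double_quiver[OF assms(1)]])
next
  case (Cons l p)
  interpret D: wf_digraph "double_quiver \<Gamma>" by (rule wf_digraph_double_quiver) fact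
  obtain e \<delta> where l: "l = (e, \<delta>)" by force
  have h: "e \<in> arcs \<Gamma>" "u = tail (double_quiver \<Gamma>) l" "D.awalk (head (double_quiver \<Gamma>) l) p v"
    using Cons.prems l by (auto simp: D.awalk_Cons_iff)
  show ?case using Cons.IH[OF h(3)] h(1,2) assms(3)[OF h(1)] l by (cases \<delta>) auto
qed

lemma connected_imp_uwalk:
  assumes "wf_digraph \<Gamma>" "connected \<Gamma>" "u \<in> verts \<Gamma>" "v \<in> verts \<Gamma>"
  obtains p where "uwalk \<Gamma> u p v"
proof -
  interpret D: wf_digraph "double_quiver \<Gamma>" by (rule wf_digraph_double_quiver) fact
  have "u \<rightarrow>\<^sup>*\<^bsub>with_proj (mk_symmetric \<Gamma>)\<^esub> v"
    using assms by (auto simp: connected_def strongly_connected_def mk_symmetric_def)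
  then have "(u, v) \<in> (arcs_ends (with_proj (mk_symmetric \<Gamma>)))\<^sup>*"
    by (rule reachable_rtranclI)
  then have "\<exists>p. D.awalk u p v"
  proof induction
    case base
    then show ?case using assms(3) by (metis D.awalk_Nil_iff double_quiver_simps(1))
  next
    case (step y z)
    then obtain e where "e \<in> arcs \<Gamma>" "(y, z) \<in> {(tail \<Gamma> e, head \<Gamma> e), (head \<Gamma> e, tail \<Gamma> e)}"
      by (auto simp: mk_symmetric_def arcs_ends_def arc_to_ends_def)
    then have "D.awalk y [(e, True)] z \<or> D.awalk y [(e, False)] z"
      using D.arc_implies_awalk[of "(e, True)"] D.arc_implies_awalk[of "(e, False)"] by auto
    moreover from step.IH obtain p where "D.awalk u p y" by blast
    ultimately show ?case using D.awalk_appendI[of u p y] by metis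
  qed
  then show ?thesis using that by blast
qed

text \<open>
  The discrete Poincare lemma: integrate the cochain along a path from a fixed base vertex.
\<close>

lemma ex_potential:
  assumes wf: "wf_digraph \<Gamma>" and con: "connected \<Gamma>"
    and zero: "\<And>u p. uwalk \<Gamma> u p u \<Longrightarrow> walk_sum f p = 0"
  obtains d where "\<And>\<beta>. \<beta> \<in> arcs \<Gamma> \<Longrightarrow> d (head \<Gamma> \<beta>) - d (tail \<Gamma> \<beta>) = f \<beta>"
proof -
  interpret D: wf_digraph "double_quiver \<Gamma>" by (rule wf_digraph_double_quiver) fact
  obtain r where r: "r \<in> verts \<Gamma>"
    using con by (auto simp: connected_def strongly_connected_def mk_symmetric_def)
  define path where "path = (\<lambda>z. SOME p. uwalk \<Gamma> r p z)"
  have path: "uwalk \<Gamma> r (path z) z" if "z \<in> verts \<Gamma>" for z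
    unfolding path_def by (rule someI_ex) (use connected_imp_uwalk[OF wf con r that] in blast)
  define d where "d z = walk_sum f (path z)" for z
  have "d (head \<Gamma> \<beta>) - d (tail \<Gamma> \<beta>) = f \<beta>" if "\<beta> \<in> arcs \<Gamma>" for \<beta>
  proof -
    have b: "uwalk \<Gamma> (tail \<Gamma> \<beta>) [(\<beta>, True)] (head \<Gamma> \<beta>)"
      using D.arc_implies_awalk[of "(\<beta>, True)"] that by simp
    have v: "tail \<Gamma> \<beta> \<in> verts \<Gamma>" "head \<Gamma> \<beta> \<in> verts \<Gamma>"
      using wf that by (simp_all add: wf_digraph.head_in_verts wf_digraph.tail_in_verts)
    have "uwalk \<Gamma> r (path (tail \<Gamma> \<beta>) @ [(\<beta>, True)] @ reverse_walk (path (head \<Gamma> \<beta>))) r"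
      by (rule uwalk_append[OF wf path[OF v(1)] uwalk_append[OF wf b uwalk_reverse[OF wf path[OF v(2)]]]])
    from zero[OF this] show ?thesis
      by (simp add: d_def walk_sum_reverse)
  qed
  then show ?thesis using that by blast
qed

section \<open>Periodic reduced walks\<close>

text \<open>
  The image of a cycle under a winding: a closed walk in \<open>H\<close>, continued periodically, without
  backtracking even where it closes up.
\<close>

locale periodic_reduced_walk =
  fixes H :: "('k, 'e) pre_digraph" and l :: "nat \<Rightarrow> 'e \<times> bool" and D :: nat
  assumes period_pos: "D > 0" and period: "l (i + D) = l i"
    and step: "head (double_quiver H) (l i) = tail (double_quiver H) (l (Suc i))"
    and reduced: "fst (l (Suc i)) = fst (l i) \<Longrightarrow> l (Suc i) = l i"
begin

definition pos :: "nat \<Rightarrow> 'k" where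
  "pos i = tail (double_quiver H) (l i)"

definition arc_sum :: "('e \<Rightarrow> int) \<Rightarrow> nat \<Rightarrow> nat \<Rightarrow> int" where
  "arc_sum f a b = (\<Sum>i\<in>{a..<b}. signed f (l i))"

lemma ends: "tail (double_quiver H) (l i) = pos i" "head (double_quiver H) (l i) = pos (Suc i)"
  by (simp_all add: pos_def step)

lemma pos_period: "pos (i + D) = pos i"
  by (simp add: pos_def period)

lemma letter_multiple_period: "l (i + k * D) = l i"
proof (induction k)
  case (Suc k)
  show ?case using period[of "i + k * D"] Suc by (simp add: algebra_simps)
qed simp

lemma simple_arc_letters:
  assumes "inj_on pos {a..<b}"
  shows "inj_on (\<lambda>i. fst (l i)) {a..<b}"
  by (rule letter_distinct_in_simple_closed_arc[where v = pos and H = H])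
    (use ends reduced assms in auto)

lemma arc_sum_indicator_of_letter:
  assumes "inj_on pos {a..<b}" "p \<in> {a..<b}"
  shows "arc_sum (\<lambda>x. of_bool (x = fst (l p))) a b = (if snd (l p) then 1 else - 1)"
proof -
  have "fst (l i) = fst (l p) \<longleftrightarrow> i = p" if "i \<in> {a..<b}" for i
    using inj_onD[OF simple_arc_letters[OF assms(1)]] that assms(2) by blast
  then have "arc_sum (\<lambda>x. of_bool (x = fst (l p))) a b
      = (\<Sum>i\<in>{a..<b}. if i = p then (if snd (l p) then 1 else - 1) else 0)"
    unfolding arc_sum_def by (intro sum.cong) (auto simp: signed_def)
  then show ?thesis using assms(2) by simp
qed

definition shortest_closed_arc :: "nat \<Rightarrow> nat \<Rightarrow> bool" where
  "shortest_closed_arc i n \<longleftrightarrow>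
     n > 0 \<and> pos (i + n) = pos i \<and> (\<forall>a b. a < b \<and> pos a = pos b \<longrightarrow> n \<le> b - a)"

lemma ex_shortest_closed_arc: obtains i n where "shortest_closed_arc i n"
proof -
  let ?P = "\<lambda>n. n > 0 \<and> (\<exists>i. pos (i + n) = pos i)"
  have "?P D" using period_pos pos_period[of 0] by (auto intro!: exI[of _ 0])
  then have L: "?P (LEAST n. ?P n)" by (rule LeastI)
  then obtain i where i: "pos (i + (LEAST n. ?P n)) = pos i" by blast
  have "(LEAST n. ?P n) \<le> b - a" if "a < b" "pos a = pos b" for a b
    by (rule Least_le) (use that in \<open>auto intro!: exI[of _ a]\<close>)
  with L i show ?thesis using that unfolding shortest_closed_arc_def by blast
qed

lemma short_arc_inj:
  assumes "shortest_closed_arc i n" "b - a \<le> n"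
  shows "inj_on pos {a..<b}"
proof -
  have "False" if "p < q" "p \<in> {a..<b}" "q \<in> {a..<b}" "pos p = pos q" for p q
  proof -
    have "n \<le> q - p" using assms(1) that unfolding shortest_closed_arc_def by blast
    then show False using that assms(2) by auto
  qed
  then show ?thesis unfolding inj_on_def by (metis linorder_neqE_nat)
qed

text \<open>
  The hypothesis on the arrows off a shortest closed arc \<open>C\<close> is what remains of the assumption that all
  closed arcs are homologous to multiples of \<open>C\<close>. It prevents the walk from leaving \<open>C\<close>, since the first
  closed arc formed afterwards would cross some arrow off \<open>C\<close> exactly once.
\<close>

lemma shortest_closed_arc_repeats_once:
  assumes C: "shortest_closed_arc i n"
    and off: "\<And>e a b. e \<notin> (\<lambda>p. fst (l p)) ` {i..<i + n} \<Longrightarrow> a < b \<Longrightarrow> pos a = pos b \<Longrightarrow>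
                arc_sum (\<lambda>x. of_bool (x = e)) a b = 0"
  shows "l (i + n) = l i"
proof (cases "n = D")
  case True
  then show ?thesis by (simp add: period)
next
  case False
  let ?A = "(\<lambda>p. fst (l p)) ` {i..<i + n}"
  have n: "n > 0" "pos (i + n) = pos i"
    and min: "\<And>a b. a < b \<Longrightarrow> pos a = pos b \<Longrightarrow> n \<le> b - a"
    using C unfolding shortest_closed_arc_def by blast+
  have "n < D" using min[of i "i + D"] False pos_period[of i] period_pos by simp
  have inj: "inj_on pos {i..<i + n}" using short_arc_inj[OF C] by simp
  show ?thesis
  \<comment> \<open>If the arrow after \<open>C\<close> lies on \<open>C\<close>, it is the first or the last one, because no other touches the
    end point of the simple arc \<open>C\<close>; the last one, reversed, would be a backtrack.\<close>
  proof (cases "fst (l (i + n)) \<in> ?A")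
    case True
    then obtain q where q: "q \<in> {i..<i + n}" "fst (l (i + n)) = fst (l q)" by blast
    show ?thesis
    proof (cases "snd (l q) = snd (l (i + n))")
      case True
      then have eq: "l q = l (i + n)" using q by (simp add: prod_eq_iff)
      then have "pos q = pos i" using n by (simp add: pos_def)
      then have "q = i" using inj q n by (auto dest: inj_onD)
      then show ?thesis using eq by simp
    next
      case False
      then have "head (double_quiver H) (l q) = tail (double_quiver H) (l (i + n))"
        using q(2) by (cases "l q"; cases "l (i + n)") auto
      then have "pos (Suc q) = pos i" using ends n by simp
      then have "Suc q = i + n"
        using min[of i "Suc q"] q by auto
      then show ?thesis using reduced[of q] q False by simp
    qed
  next
    case offC: False
    \<comment> \<open>Otherwise the first vertex repetition after position \<open>i\<close> bounds a simple closed arc from \<open>j\<close> to \<open>m\<close>.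
      If \<open>j\<close> is still on \<open>C\<close>, that arc contains the arrow by which the walk left \<open>C\<close>; if not, its first
      arrow starts at a vertex off \<open>C\<close>. Being simple, it crosses that arrow once.\<close>
    have ex: "\<exists>m. \<exists>j. i < j \<and> j < m \<and> pos j = pos m"
      using \<open>n < D\<close> n pos_period[of i] by (intro exI[of _ "i + D"] exI[of _ "i + n"]) auto
    define m where "m = (LEAST m. \<exists>j. i < j \<and> j < m \<and> pos j = pos m)"
    obtain j where j: "i < j" "j < m" "pos j = pos m"
      using LeastI_ex[OF ex] unfolding m_def by blast
    have least: "\<not> (i < a \<and> a < b \<and> pos a = pos b)" if "b < m" for a b
      using not_less_Least[of b "\<lambda>m. \<exists>j. i < j \<and> j < m \<and> pos j = pos m"] that
      unfolding m_def by blast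
    have inj_m: "inj_on pos {Suc i..<m}"
      using least unfolding inj_on_def by (metis Suc_le_lessD atLeastLessThan_iff linorder_neqE_nat)
    have m: "i + n < m" using min[OF j(2,3)] j by simp
    have "\<exists>p. p \<in> {j..<m} \<and> fst (l p) \<notin> ?A"
    proof (cases "j \<le> i + n")
      case True
      then show ?thesis using m offC by (intro exI[of _ "i + n"]) auto
    next
      case False
      have "fst (l j) \<noteq> fst (l q)" if q: "q \<in> {i..<i + n}" for q
      proof
        assume "fst (l j) = fst (l q)"
        then have "tail (double_quiver H) (l j) \<in>
            {tail (double_quiver H) (l q), head (double_quiver H) (l q)}"
          by (cases "l j"; cases "l q") auto
        then have "pos j \<in> {pos q, pos (Suc q)}" using ends by simp
        then have "\<exists>k. i < k \<and> k \<le> i + n \<and> pos j = pos k"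
          using q n by (cases "q = i"; cases "pos j = pos q") (auto intro: exI[of _ "i + n"] exI[of _ q] exI[of _ "Suc q"])
        then obtain k where "i < k" "k \<le> i + n" "pos j = pos k" by blast
        then show False using least[of j k] False j by auto
      qed
      then have "fst (l j) \<notin> ?A" by blast
      then show ?thesis using j by (intro exI[of _ j]) simp
    qed
    then obtain p where p: "p \<in> {j..<m}" "fst (l p) \<notin> ?A" by blast
    have "inj_on pos {j..<m}" by (rule inj_on_subset[OF inj_m]) (use j in auto)
    from arc_sum_indicator_of_letter[OF this p(1)] off[OF p(2) j(2,3)]
    show ?thesis by (simp split: if_splits)
  qed
qed

text \<open>
  The arc that starts one position later uses the same arrows and is again a shortest closed arc, so
  the previous lemma can be iterated: the walk is a power of \<open>C\<close>.
\<close>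

theorem shortest_closed_arc_repeats:
  assumes C: "shortest_closed_arc i n"
    and off: "\<And>e a b. e \<notin> (\<lambda>p. fst (l p)) ` {i..<i + n} \<Longrightarrow> a < b \<Longrightarrow> pos a = pos b \<Longrightarrow>
                arc_sum (\<lambda>x. of_bool (x = e)) a b = 0"
  shows "l (p + n) = l p" "n dvd D"
proof -
  have n: "n > 0" and min: "\<And>a b. a < b \<Longrightarrow> pos a = pos b \<Longrightarrow> n \<le> b - a"
    using C unfolding shortest_closed_arc_def by blast+
  have shift: "shortest_closed_arc (i + k) n \<and>
      (\<lambda>p. fst (l p)) ` {i + k..<i + k + n} = (\<lambda>p. fst (l p)) ` {i..<i + n} \<and>
      l (i + k + n) = l (i + k)" for k
  proof (induction k)
    case 0
    have "l (i + n) = l i" by (rule shortest_closed_arc_repeats_once[OF C off])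
    then show ?case using C by simp
  next
    case (Suc k)
    then have "pos (Suc (i + k) + n) = pos (Suc (i + k))"
      using ends(2)[of "i + k + n"] ends(2)[of "i + k"] by simp
    then have C': "shortest_closed_arc (i + Suc k) n"
      using n min unfolding shortest_closed_arc_def by simp
    have "{i + k..<i + k + n} = insert (i + k) {i + Suc k..<i + k + n}"
      "{i + Suc k..<i + Suc k + n} = insert (i + k + n) {i + Suc k..<i + k + n}"
      using n by auto
    then have A: "(\<lambda>p. fst (l p)) ` {i + Suc k..<i + Suc k + n} = (\<lambda>p. fst (l p)) ` {i..<i + n}"
      using Suc.IH by simp
    have "l (i + Suc k + n) = l (i + Suc k)"
      by (rule shortest_closed_arc_repeats_once[OF C'], rule off) (simp_all only: A not_False_eq_True)
    with C' A show ?case by blast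
  qed
  have per: "l (p + n) = l p" for p
  proof -
    have "i \<le> p + i * D" using period_pos by (simp add: trans_le_add2)
    then obtain k where k: "p + i * D = i + k" by (metis le_Suc_ex)
    have "l (p + n) = l (p + i * D + n)"
      using letter_multiple_period[of "p + n" i] by (simp add: algebra_simps)
    also have "\<dots> = l (p + i * D)" using shift[of k] k by simp
    finally show ?thesis by (simp add: letter_multiple_period)
  qed
  then show "l (p + n) = l p" .
  have "l (D mod n + k * n) = l (D mod n)" for k
  proof (induction k)
    case (Suc k)
    show ?case using per[of "D mod n + k * n"] Suc by (simp add: algebra_simps)
  qed simp
  from this[of "D div n"] have "l D = l (D mod n)" by simp
  then have "pos (D mod n) = pos 0"
    using pos_period[of 0] by (simp add: pos_def)
  then have "D mod n = 0"
    using min[of 0 "D mod n"] n by (metis diff_zero gr0I mod_less_divisor not_le)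
  then show "n dvd D" by auto
qed

end

section \<open>Gradings relative to a partition of the vertices\<close>

text \<open>
  The arrow of the quotient onto which \<open>\<beta>\<close> is mapped when vertices with equal \<open>\<kappa>\<close> are identified.
\<close>

definition quotient_arrow ::
  "('w, 'b) pre_digraph \<Rightarrow> ('w, 'b, 'v, 'a) quiver_map \<Rightarrow> ('w \<Rightarrow> 'k) \<Rightarrow> 'b \<Rightarrow> 'k \<times> 'a \<times> 'k" where
  "quotient_arrow \<Gamma> c \<kappa> \<beta> = (\<kappa> (tail \<Gamma> \<beta>), on_arcs c \<beta>, \<kappa> (head \<Gamma> \<beta>))"

definition quotient_quiver ::
  "('w, 'b) pre_digraph \<Rightarrow> ('w, 'b, 'v, 'a) quiver_map \<Rightarrow> ('w \<Rightarrow> 'k) \<Rightarrow>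
     ('k, 'k \<times> 'a \<times> 'k) pre_digraph" where
  "quotient_quiver \<Gamma> c \<kappa> =
     \<lparr>verts = \<kappa> ` verts \<Gamma>, arcs = quotient_arrow \<Gamma> c \<kappa> ` arcs \<Gamma>, tail = fst, head = snd \<circ> snd\<rparr>"

text \<open>
  Being nice relative to a sequence of gradings, stated for the partition into fibres of \<open>\<kappa>\<close> that the
  gradings define. Equivalently, the coboundary of \<open>d\<close> is pulled back from the quotient quiver.
\<close>

definition nice_modulo ::
  "('w, 'b) pre_digraph \<Rightarrow> ('w, 'b, 'v, 'a) quiver_map \<Rightarrow> ('w \<Rightarrow> 'k) \<Rightarrow> ('w \<Rightarrow> int) \<Rightarrow> bool" where
  "nice_modulo \<Gamma> c \<kappa> d \<longleftrightarrow>
     (\<forall>\<beta> \<in> arcs \<Gamma>. \<forall>\<beta>' \<in> arcs \<Gamma>. quotient_arrow \<Gamma> c \<kappa> \<beta> = quotient_arrow \<Gamma> c \<kappa> \<beta>' \<longrightarrow>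
        d (head \<Gamma> \<beta>) - d (tail \<Gamma> \<beta>) = d (head \<Gamma> \<beta>') - d (tail \<Gamma> \<beta>'))"

lemma nice_modulo_if_cochain:
  assumes "\<And>\<beta>. \<beta> \<in> arcs \<Gamma> \<Longrightarrow> d (head \<Gamma> \<beta>) - d (tail \<Gamma> \<beta>) = \<phi> (quotient_arrow \<Gamma> c \<kappa> \<beta>)"
  shows "nice_modulo \<Gamma> c \<kappa> d"
  using assms by (simp add: nice_modulo_def)

text \<open>
  This is where the winding condition enters: if two consecutive letters of a walk have mutually
  inverse images, the letters themselves are inverse to each other. Hence reduced walks have reduced
  images, in \<open>Q\<close> and in every quotient by some \<open>\<kappa>\<close>.
\<close>

lemma winding_no_backtrack:
  assumes "winding \<Gamma> Q c" "fst l \<in> arcs \<Gamma>" "fst l' \<in> arcs \<Gamma>"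
    "head (double_quiver \<Gamma>) l = tail (double_quiver \<Gamma>) l'"
    "on_arcs c (fst l) = on_arcs c (fst l')" "snd l \<noteq> snd l'"
  shows "fst l = fst l'"
  using assms by (cases l; cases l') (auto simp: winding_def split: if_splits)

section \<open>Coefficient quivers that are trees\<close>

text \<open>
  Among all walks between distinct vertices with equal \<open>\<kappa>\<close> take a shortest one. Its image in the
  quotient is a simple reduced closed walk, so it crosses its first arrow once; on a tree the indicator of
  that arrow has a potential, which takes different values at the two ends.
\<close>

lemma tree_separating_grading:
  assumes wf: "wf_digraph \<Gamma>" and wind: "winding \<Gamma> Q c" and tree: "tree_quiver \<Gamma>"
    and ninj: "\<not> inj_on \<kappa> (verts \<Gamma>)"
  obtains d x y where "nice_modulo \<Gamma> c \<kappa> d" "x \<in> verts \<Gamma>" "y \<in> verts \<Gamma>" "\<kappa> x = \<kappa> y" "d x \<noteq> d y"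
proof -
  let ?D = "double_quiver \<Gamma>"
  have con: "connected \<Gamma>" and nocyc: "\<nexists>w. undirected_cycle \<Gamma> w"
    using tree by (auto simp: tree_quiver_def)
  let ?P = "\<lambda>n. \<exists>x p y. uwalk \<Gamma> x p y \<and> x \<noteq> y \<and> \<kappa> x = \<kappa> y \<and> length p = n"
  have "\<exists>n. ?P n"
  proof -
    from ninj obtain x y where "x \<in> verts \<Gamma>" "y \<in> verts \<Gamma>" "x \<noteq> y" "\<kappa> x = \<kappa> y"
      by (auto simp: inj_on_def)
    then show ?thesis using connected_imp_uwalk[OF wf con] by metis
  qed
  then have L: "?P (LEAST n. ?P n)" by (rule LeastI_ex)
  then obtain x p y where p: "uwalk \<Gamma> x p y" "x \<noteq> y" "\<kappa> x = \<kappa> y" "length p = (LEAST n. ?P n)"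
    by blast
  have shortest: "length p \<le> length q" if "uwalk \<Gamma> x' q y'" "x' \<noteq> y'" "\<kappa> x' = \<kappa> y'" for x' q y'
    unfolding p(4) by (rule Least_le) (use that in blast)
  obtain X where X: "X 0 = x" "X (length p) = y" "set p \<subseteq> arcs ?D"
    "\<forall>i < length p. tail ?D (p ! i) = X i \<and> head ?D (p ! i) = X (Suc i)"
    and slice: "\<And>i j. i \<le> j \<Longrightarrow> j \<le> length p \<Longrightarrow> uwalk \<Gamma> (X i) (take (j - i) (drop i p)) (X j)"
    and cut: "\<And>i j. i \<le> j \<Longrightarrow> j \<le> length p \<Longrightarrow> X i = X j \<Longrightarrow> uwalk \<Gamma> x (take i p @ drop j p) y"
    using uwalk_positions[OF wf p(1)] by metis
  have X_inj: "X i \<noteq> X j" if "i < j" "j \<le> length p" for i j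
    using shortest[OF cut[of i j] p(2,3)] that by (auto simp: min_def)
  \<comment> \<open>Equal \<open>\<kappa>\<close> inside the walk means a shorter walk of the same kind; equal vertices allow a shortcut.\<close>
  have \<kappa>_inj: "inj_on (\<lambda>i. \<kappa> (X i)) {0..<length p}"
  proof -
    have "\<kappa> (X i) \<noteq> \<kappa> (X j)" if "i < j" "j < length p" for i j
      using shortest[OF slice[of i j] X_inj[of i j]] that by auto
    then show ?thesis unfolding inj_on_def by (metis atLeastLessThan_iff linorder_neqE_nat)
  qed
  have arc: "fst (p ! i) \<in> arcs \<Gamma>" if "i < length p" for i
    using X(3) that nth_mem[of i p] by (cases "p ! i") auto
  let ?l = "\<lambda>i. (quotient_arrow \<Gamma> c \<kappa> (fst (p ! i)), snd (p ! i))"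
  have dist: "inj_on (\<lambda>i. fst (?l i)) {0..<length p}"
  proof (rule letter_distinct_in_simple_closed_arc[where v = "\<lambda>i. \<kappa> (X i)" and H = "quotient_quiver \<Gamma> c \<kappa>"])
    fix i assume "i < length p"
    then show "tail (double_quiver (quotient_quiver \<Gamma> c \<kappa>)) (?l i) = \<kappa> (X i) \<and>
        head (double_quiver (quotient_quiver \<Gamma> c \<kappa>)) (?l i) = \<kappa> (X (Suc i))"
      using X(4)[rule_format, of i] by (cases "p ! i") (auto simp: quotient_quiver_def quotient_arrow_def)
  next
    fix i assume i: "Suc i < length p" "fst (?l (Suc i)) = fst (?l i)"
    show "?l (Suc i) = ?l i"
    proof (rule ccontr)
      assume "\<not> ?thesis"
      then have ne: "snd (p ! i) \<noteq> snd (p ! Suc i)" using i by auto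
      have "fst (p ! i) = fst (p ! Suc i)"
        by (rule winding_no_backtrack[OF wind])
          (use i arc[of i] arc[of "Suc i"] X(4) ne in \<open>auto simp: quotient_arrow_def\<close>)
      then have "tail ?D (p ! i) = head ?D (p ! Suc i)"
        using ne by (cases "p ! i"; cases "p ! Suc i") auto
      then have "X i = X (Suc (Suc i))" using X(4) i by simp
      then show False using X_inj[of i "Suc (Suc i)"] i by simp
    qed
  qed (use \<kappa>_inj in auto)
  have ne: "p \<noteq> []" using p(2) X(1,2) by auto
  define \<phi> :: "_ \<Rightarrow> int" where "\<phi> = (\<lambda>e. of_bool (e = quotient_arrow \<Gamma> c \<kappa> (fst (p ! 0))))"
  have zero: "walk_sum (\<lambda>\<beta>. \<phi> (quotient_arrow \<Gamma> c \<kappa> \<beta>)) q = 0" if "uwalk \<Gamma> u q u" for u q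
    by (rule closed_walk_sum_zero_if_no_cycle[OF wf nocyc that])
  obtain d where d: "\<And>\<beta>. \<beta> \<in> arcs \<Gamma> \<Longrightarrow> d (head \<Gamma> \<beta>) - d (tail \<Gamma> \<beta>) = \<phi> (quotient_arrow \<Gamma> c \<kappa> \<beta>)"
    using ex_potential[OF wf con, where f = "\<lambda>\<beta>. \<phi> (quotient_arrow \<Gamma> c \<kappa> \<beta>)"] zero by blast
  have "d y - d x = walk_sum (\<lambda>\<beta>. \<phi> (quotient_arrow \<Gamma> c \<kappa> \<beta>)) p"
    using walk_sum_coboundary[OF wf p(1) d] by simp
  also have "\<dots> = (\<Sum>i<length p. signed (\<lambda>\<beta>. \<phi> (quotient_arrow \<Gamma> c \<kappa> \<beta>)) (p ! i))"
    by (simp add: sum_list_sum_nth atLeast0LessThan)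
  also have "\<dots> = (\<Sum>i<length p. if i = 0 then (if snd (p ! 0) then 1 else - 1) else 0)"
  proof (rule sum.cong)
    fix i assume "i \<in> {..<length p}"
    then show "signed (\<lambda>\<beta>. \<phi> (quotient_arrow \<Gamma> c \<kappa> \<beta>)) (p ! i) = (if i = 0 then (if snd (p ! 0) then 1 else - 1) else 0)"
      using inj_onD[OF dist, of i 0] ne by (auto simp: signed_def \<phi>_def)
  qed simp
  also have "\<dots> \<noteq> 0" using ne by simp
  finally have "d x \<noteq> d y" by auto
  with that[of d x y] nice_modulo_if_cochain[OF d] uwalk_in_verts[OF wf p(1)] p(3) show ?thesis
    by blast
qed

section \<open>Coefficient quivers that are cycles\<close>

text \<open>
  The map \<open>g\<close> on arrows, over \<open>h\<close> on vertices, is either the winding itself or the projection to a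
  quotient through which the winding factors on arrows.
\<close>

lemma cycle_image:
  assumes wf: "wf_digraph \<Gamma>" and wind: "winding \<Gamma> Q c" and cyc: "undirected_cycle \<Gamma> w"
    and g: "\<And>\<beta>. \<beta> \<in> arcs \<Gamma> \<Longrightarrow> tail H (g \<beta>) = h (tail \<Gamma> \<beta>) \<and> head H (g \<beta>) = h (head \<Gamma> \<beta>)"
    and gc: "\<And>\<beta> \<beta>'. \<beta> \<in> arcs \<Gamma> \<Longrightarrow> \<beta>' \<in> arcs \<Gamma> \<Longrightarrow> g \<beta> = g \<beta>' \<Longrightarrow> on_arcs c \<beta> = on_arcs c \<beta>'"
  shows "periodic_reduced_walk H (\<lambda>i. (g (fst (w ! (i mod length w))), snd (w ! (i mod length w)))) (length w)"
proof -
  let ?D = "double_quiver \<Gamma>" and ?n = "length w"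
  have ne: "w \<noteq> []" and arcs: "fst ` set w \<subseteq> arcs \<Gamma>" and dist: "distinct (map fst w)"
    and nxt: "\<And>i. i < ?n \<Longrightarrow> head ?D (w ! i) = tail ?D (w ! (Suc i mod ?n))"
    using cyc unfolding undirected_cycle_iff[OF wf] by auto
  have nxt': "head ?D (w ! (i mod ?n)) = tail ?D (w ! (Suc i mod ?n))" for i
    using nxt[of "i mod ?n"] ne by (simp add: mod_Suc_eq)
  have arc: "fst (w ! (i mod ?n)) \<in> arcs \<Gamma>" for i using arcs ne by (auto simp: subset_iff)
  show ?thesis
  proof
    show "0 < ?n" using ne by simp
  next
    fix i show "(g (fst (w ! ((i + ?n) mod ?n))), snd (w ! ((i + ?n) mod ?n))) =
        (g (fst (w ! (i mod ?n))), snd (w ! (i mod ?n)))" by simp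
  next
    fix i
    show "head (double_quiver H) (g (fst (w ! (i mod ?n))), snd (w ! (i mod ?n))) =
        tail (double_quiver H) (g (fst (w ! (Suc i mod ?n))), snd (w ! (Suc i mod ?n)))"
      using nxt'[of i] g[OF arc[of i]] g[OF arc[of "Suc i"]]
      by (cases "w ! (i mod ?n)"; cases "w ! (Suc i mod ?n)") (auto split: if_splits)
  next
    fix i
    assume eq: "fst (g (fst (w ! (Suc i mod ?n))), snd (w ! (Suc i mod ?n))) =
        fst (g (fst (w ! (i mod ?n))), snd (w ! (i mod ?n)))"
    have "snd (w ! (i mod ?n)) = snd (w ! (Suc i mod ?n))"
    proof (rule ccontr)
      assume ne': "\<not> ?thesis"
      have "fst (w ! (i mod ?n)) = fst (w ! (Suc i mod ?n))"
        by (rule winding_no_backtrack[OF wind arc arc nxt' gc[OF arc arc] ne']) (use eq in simp)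
      moreover have "i mod ?n < length (map fst w)" "Suc i mod ?n < length (map fst w)"
        using ne by simp_all
      ultimately have "i mod ?n = Suc i mod ?n"
        using nth_eq_iff_index_eq[OF dist, of "i mod ?n" "Suc i mod ?n"] by simp
      then show False using ne' by simp
    qed
    then show "(g (fst (w ! (Suc i mod ?n))), snd (w ! (Suc i mod ?n))) =
        (g (fst (w ! (i mod ?n))), snd (w ! (i mod ?n)))"
      using eq by simp
  qed
qed

text \<open>
  On a cycle the only obstruction to a potential is the value of the cochain on the cycle itself.
\<close>

lemma cycle_potential:
  assumes wf: "wf_digraph \<Gamma>" and w: "once_around \<Gamma> w" and zero: "walk_sum f w = 0"
  obtains d where "\<And>\<beta>. \<beta> \<in> arcs \<Gamma> \<Longrightarrow> d (head \<Gamma> \<beta>) - d (tail \<Gamma> \<beta>) = f \<beta>"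
proof -
  let ?D = "double_quiver \<Gamma>" and ?n = "length w"
  have cyc: "undirected_cycle \<Gamma> w" and arcs: "fst ` set w = arcs \<Gamma>"
    using w by (auto simp: once_around_def)
  have ne: "w \<noteq> []" and dist: "distinct (map (tail ?D) w)"
    and nxt: "\<And>i. i < ?n \<Longrightarrow> head ?D (w ! i) = tail ?D (w ! (Suc i mod ?n))"
    using cyc unfolding undirected_cycle_iff[OF wf] by auto
  define d where "d z = walk_sum f (take (THE i. i < ?n \<and> tail ?D (w ! i) = z) w)" for z
  have d: "d (tail ?D (w ! i)) = walk_sum f (take i w)" if "i < ?n" for i
  proof -
    have "(THE j. j < ?n \<and> tail ?D (w ! j) = tail ?D (w ! i)) = i"
      using that nth_eq_iff_index_eq[OF dist] by (intro the_equality) auto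
    then show ?thesis by (simp add: d_def)
  qed
  have diff: "d (head ?D (w ! i)) - d (tail ?D (w ! i)) = signed f (w ! i)" if "i < ?n" for i
  proof (cases "Suc i = ?n")
    case True
    then have "w = take i w @ [w ! i]" using that take_Suc_conv_app_nth[of i w] by simp
    then have "walk_sum f w = walk_sum f (take i w @ [w ! i])" by (rule arg_cong)
    then have "walk_sum f (take i w) + signed f (w ! i) = 0" using zero by simp
    moreover have "d (head ?D (w ! i)) = 0"
      using nxt[OF that] True d[of 0] ne by simp
    ultimately show ?thesis using d[OF that] by simp
  next
    case False
    then have "d (head ?D (w ! i)) = walk_sum f (take (Suc i) w)"
      using nxt[OF that] d[of "Suc i"] that by simp
    then show ?thesis using d[OF that] that by (simp add: take_Suc_conv_app_nth)
  qed
  have "d (head \<Gamma> \<beta>) - d (tail \<Gamma> \<beta>) = f \<beta>" if "\<beta> \<in> arcs \<Gamma>" for \<beta>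
  proof -
    from that arcs obtain i where i: "i < ?n" "fst (w ! i) = \<beta>"
      by (metis (no_types, lifting) imageE in_set_conv_nth)
    show ?thesis using diff[OF i(1)] i(2) by (cases "w ! i") (auto split: if_splits)
  qed
  then show ?thesis using that by blast
qed

lemma periodic_list_is_power:
  assumes "length xs = k * n" "\<And>i. i + n < length xs \<Longrightarrow> xs ! (i + n) = xs ! i"
  shows "xs = concat (replicate k (take n xs))"
  using assms
proof (induction k arbitrary: xs)
  case (Suc k)
  have "drop n xs = concat (replicate k (take n (drop n xs)))"
  proof (rule Suc.IH)
    fix i assume i: "i + n < length (drop n xs)"
    then have "xs ! (i + n + n) = xs ! (i + n)" by (intro Suc.prems(2)) simp
    then show "drop n xs ! (i + n) = drop n xs ! i" using i by (simp add: add.commute add.left_commute)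
  qed (use Suc.prems(1) in simp)
  also have "\<dots> = concat (replicate k (take n xs))"
  proof (cases "k = 0")
    case False
    then have "2 * n \<le> length xs" using Suc.prems(1) by (cases k) auto
    then have "take n (drop n xs) = take n xs"
      using Suc.prems(2) by (intro nth_equalityI) (auto simp: add.commute)
    then show ?thesis by simp
  qed simp
  finally show ?case by (metis append_take_drop_id concat.simps(2) replicate_Suc)
qed simp

text \<open>
  In the stuck situation a cochain on the quotient that vanishes on the image \<open>W\<close> of the whole cycle
  vanishes on every closed arc of \<open>W\<close>. Applied to combinations of two indicators, this shows that
  the arrows off a shortest closed arc are crossed zero times by every closed arc, so \<open>W\<close> is a power of that
  arc. It is a proper power, because two distinct vertices with equal \<open>\<kappa>\<close> bound a closed arc shorter
  than the cycle. The base \<open>q\<close> is closed in \<open>Q\<close> even if \<open>\<kappa>\<close> does not determine the vertex of \<open>Q\<close>: the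
  letter after \<open>q\<close> is its first letter, and their images start at the same vertex.
\<close>

lemma unseparated_once_around_is_power:
  assumes wf: "wf_digraph \<Gamma>" and wind: "winding \<Gamma> Q c" and w: "once_around \<Gamma> w"
    and ninj: "\<not> inj_on \<kappa> (verts \<Gamma>)"
    and stuck: "\<And>d x y. nice_modulo \<Gamma> c \<kappa> d \<Longrightarrow> x \<in> verts \<Gamma> \<Longrightarrow> y \<in> verts \<Gamma> \<Longrightarrow> \<kappa> x = \<kappa> y \<Longrightarrow> d x = d y"
  shows "\<exists>q k. closed_walk Q q \<and> k > 1 \<and>
           map (\<lambda>(\<beta>, \<delta>). (on_arcs c \<beta>, \<delta>)) w = concat (replicate k q)"
proof -
  let ?D = "double_quiver \<Gamma>" and ?N = "length w"
  have cyc: "undirected_cycle \<Gamma> w" and arcs: "fst ` set w = arcs \<Gamma>"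
    and verts: "tail ?D ` set w = verts \<Gamma>"
    using w by (auto simp: once_around_def)
  have ne: "w \<noteq> []" and nxt: "\<And>i. i < ?N \<Longrightarrow> head ?D (w ! i) = tail ?D (w ! (Suc i mod ?N))"
    using cyc unfolding undirected_cycle_iff[OF wf] by auto
  define L where "L i = w ! (i mod ?N)" for i
  define x where "x i = tail ?D (L i)" for i
  have L_set: "L i \<in> set w" for i using ne by (simp add: L_def)
  have L_arc: "fst (L i) \<in> arcs \<Gamma>" for i using L_set arcs by blast
  have x_verts: "x i \<in> verts \<Gamma>" for i using L_set verts by (auto simp: x_def)
  have L_head: "head ?D (L i) = x (Suc i)" for i
    using nxt[of "i mod ?N"] ne by (simp add: L_def x_def mod_Suc_eq)
  let ?k = "quotient_arrow \<Gamma> c \<kappa>"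
  let ?l = "\<lambda>i. (?k (fst (L i)), snd (L i))"
  interpret W: periodic_reduced_walk "quotient_quiver \<Gamma> c \<kappa>" ?l ?N
    unfolding L_def
    by (rule cycle_image[OF wf wind cyc, where h = \<kappa>]) (auto simp: quotient_quiver_def quotient_arrow_def)
  have pos: "W.pos i = \<kappa> (x i)" for i
    unfolding W.pos_def x_def by (cases "L i") (auto simp: quotient_quiver_def quotient_arrow_def)
  have arc_sum: "W.arc_sum \<phi> a b = (\<Sum>i\<in>{a..<b}. signed (\<lambda>\<beta>. \<phi> (?k \<beta>)) (L i))" for \<phi> a b
    unfolding W.arc_sum_def by (simp add: signed_def cong: if_cong)
  have closed_zero: "W.arc_sum \<phi> a b = 0"
    if zero: "W.arc_sum \<phi> 0 ?N = 0" and ab: "a \<le> b" "W.pos a = W.pos b" for \<phi> a b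
  proof -
    have "walk_sum (\<lambda>\<beta>. \<phi> (?k \<beta>)) w = (\<Sum>i\<in>{0..<?N}. signed (\<lambda>\<beta>. \<phi> (?k \<beta>)) (L i))"
      by (simp add: sum_list_sum_nth L_def)
    then have "walk_sum (\<lambda>\<beta>. \<phi> (?k \<beta>)) w = 0" using zero arc_sum by simp
    then obtain d where d: "\<And>\<beta>. \<beta> \<in> arcs \<Gamma> \<Longrightarrow> d (head \<Gamma> \<beta>) - d (tail \<Gamma> \<beta>) = \<phi> (?k \<beta>)"
      using cycle_potential[OF wf w] by blast
    have step: "signed (\<lambda>\<beta>. \<phi> (?k \<beta>)) (L i) = d (x (Suc i)) - d (x i)" for i
    proof -
      have "signed (\<lambda>\<beta>. \<phi> (?k \<beta>)) (L i) = d (head ?D (L i)) - d (tail ?D (L i))"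
        using d[OF L_arc[of i]] by (cases "L i") (auto split: if_splits)
      then show ?thesis by (simp add: L_head x_def)
    qed
    have "W.arc_sum \<phi> a b = d (x b) - d (x a)"
      unfolding arc_sum step using ab(1) by (rule sum_Suc_diff')
    moreover have "d (x a) = d (x b)"
      by (rule stuck[OF nice_modulo_if_cochain[where \<phi> = \<phi>] x_verts x_verts]) (use d ab pos in auto)
    ultimately show ?thesis by simp
  qed
  obtain i n where C: "W.shortest_closed_arc i n" by (rule W.ex_shortest_closed_arc)
  then have n: "n > 0" "W.pos (i + n) = W.pos i"
    and min: "\<And>a b. a < b \<Longrightarrow> W.pos a = W.pos b \<Longrightarrow> n \<le> b - a"
    unfolding W.shortest_closed_arc_def by blast+
  let ?one = "\<lambda>e x. of_bool (x = e) :: int" and ?f = "fst (?l i)"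
  have linear: "W.arc_sum (\<lambda>e. A * \<phi> e + B * \<psi> e) a b = A * W.arc_sum \<phi> a b + B * W.arc_sum \<psi> a b"
    for A B \<phi> \<psi> a b
    unfolding W.arc_sum_def sum_distrib_left sum.distrib[symmetric]
    by (rule sum.cong) (auto simp: signed_def)
  have f: "W.arc_sum (?one ?f) i (i + n) \<noteq> 0"
    using W.arc_sum_indicator_of_letter[of i "i + n" i] W.short_arc_inj[OF C, of "i + n" i] n by auto
  have off: "W.arc_sum (?one e) a b = 0"
    if e: "e \<notin> (\<lambda>p. fst (?l p)) ` {i..<i + n}" and ab: "a < b" "W.pos a = W.pos b" for e a b
  proof -
    have e0: "W.arc_sum (?one e) i (i + n) = 0"
      unfolding W.arc_sum_def using e by (intro sum.neutral) (auto simp: signed_def)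
    \<comment> \<open>The combination of the indicators of \<open>e\<close> and of an arrow \<open>f\<close> of \<open>C\<close> that vanishes on the whole
      cycle. Its value on \<open>C\<close> is \<open>?B\<close> up to sign, so \<open>?B = 0\<close> and the indicator of \<open>e\<close> alone is
      admissible.\<close>
    let ?A = "W.arc_sum (?one ?f) 0 ?N" and ?B = "- W.arc_sum (?one e) 0 ?N"
    have "W.arc_sum (\<lambda>y. ?A * ?one e y + ?B * ?one ?f y) i (i + n) = 0"
    proof (rule closed_zero)
      show "W.arc_sum (\<lambda>y. ?A * ?one e y + ?B * ?one ?f y) 0 ?N = 0" unfolding linear by simp
    qed (use n in auto)
    then have "?B * W.arc_sum (?one ?f) i (i + n) = 0"
      unfolding linear using e0 by simp
    then have "W.arc_sum (?one e) 0 ?N = 0" using f by simp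
    then show ?thesis using closed_zero ab by simp
  qed
  have rep: "?l (p + n) = ?l p" for p
    by (rule W.shortest_closed_arc_repeats(1)[OF C off])
  have dvd: "n dvd ?N"
    by (rule W.shortest_closed_arc_repeats(2)[OF C off])
  have "n < ?N"
  proof -
    obtain y z where yz: "y \<in> verts \<Gamma>" "z \<in> verts \<Gamma>" "y \<noteq> z" "\<kappa> y = \<kappa> z"
      using ninj by (auto simp: inj_on_def)
    have "\<exists>p < ?N. u = x p" if "u \<in> verts \<Gamma>" for u
    proof -
      from that verts obtain p where "p < ?N" "u = tail ?D (w ! p)"
        by (metis (no_types, lifting) imageE in_set_conv_nth)
      then show ?thesis by (intro exI[of _ p]) (simp add: x_def L_def)
    qed
    then obtain p q where pq: "p < ?N" "q < ?N" "y = x p" "z = x q" using yz by blast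
    then have "p \<noteq> q" "W.pos p = W.pos q" using yz pos by auto
    then have "n \<le> p - q \<or> n \<le> q - p"
      using min[of p q] min[of q p] by (cases p q rule: linorder_cases) auto
    then show ?thesis using pq by auto
  qed
  define k where "k = ?N div n"
  have k: "?N = k * n" using dvd by (simp add: k_def)
  have "k > 1" using \<open>n < ?N\<close> unfolding k by (cases k; cases "k - 1") auto
  let ?W = "map (\<lambda>(\<beta>, \<delta>). (on_arcs c \<beta>, \<delta>)) w"
  have W_nth: "?W ! i = (fst (snd (fst (?l i))), snd (?l i))" if "i < ?N" for i
    using that by (cases "w ! i") (simp add: L_def quotient_arrow_def)
  have "?W = concat (replicate k (take n ?W))"
  proof (rule periodic_list_is_power)
    fix i assume "i + n < length ?W"
    then show "?W ! (i + n) = ?W ! i" using W_nth[of "i + n"] W_nth[of i] rep[of i] by simp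
  qed (simp add: k)
  moreover have "closed_walk Q (take n ?W)"
  proof -
    have map: "is_quiver_map \<Gamma> Q c" using wind by (simp add: winding_def)
    have letter: "?W ! i \<in> arcs (double_quiver Q) \<and>
        tail (double_quiver Q) (?W ! i) = on_verts c (x i) \<and>
        head (double_quiver Q) (?W ! i) = on_verts c (x (Suc i))" if "i < ?N" for i
      using that map L_arc[of i] L_head[of i]
      by (cases "w ! i") (auto simp: is_quiver_map_def L_def x_def split: if_splits)
    have "on_verts c (x n) = on_verts c (x 0)"
    proof -
      have "?W ! n = ?W ! 0"
        using W_nth[of n] W_nth[of 0] rep[of 0] \<open>n < ?N\<close> ne by simp
      then show ?thesis using letter[of n] letter[of 0] \<open>n < ?N\<close> by (metis gr_implies_not0 neq0_conv)
    qed
    moreover have "set (take n ?W) \<subseteq> arcs (double_quiver Q)"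
    proof
      fix y assume "y \<in> set (take n ?W)"
      then obtain j where "j < ?N" "y = ?W ! j"
        by (metis in_set_conv_nth in_set_takeD length_map)
      then show "y \<in> arcs (double_quiver Q)" using letter by blast
    qed
    moreover have "on_verts c (x 0) \<in> verts Q"
      using map x_verts[of 0] by (simp add: is_quiver_map_def)
    ultimately show ?thesis
      unfolding closed_walk_def awalk_iff_positions
      using letter \<open>n < ?N\<close>
      by (intro exI[of _ "on_verts c (x 0)"] conjI exI[of _ "\<lambda>i. on_verts c (x i)"]) auto
  qed
  ultimately show ?thesis using \<open>k > 1\<close> by blast
qed

section \<open>Finite nice length\<close>

text \<open>
  For a coefficient quiver with its winding this is finiteness of the nice length; trees and cycles are
  treated for arbitrary windings, without reference to a representation.
\<close>

definition separated :: "('w, 'b) pre_digraph \<Rightarrow> ('w, 'b, 'v, 'a) quiver_map \<Rightarrow> bool" where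
  "separated \<Gamma> c \<longleftrightarrow> (\<exists>ds n. nice_sequence \<Gamma> c ds \<and> separates_up_to \<Gamma> ds n)"

lemma nice_relative_to_iff_nice_modulo:
  "nice_relative_to \<Gamma> c ds i d \<longleftrightarrow> nice_modulo \<Gamma> c (\<lambda>x. map (\<lambda>j. ds j x) [0..<i]) d"
  unfolding nice_relative_to_def nice_modulo_def quotient_arrow_def by (auto simp: Ball_def)

lemma nice_relative_to_cong:
  assumes "\<And>j. j < i \<Longrightarrow> ds j = ds' j"
  shows "nice_relative_to \<Gamma> c ds i d \<longleftrightarrow> nice_relative_to \<Gamma> c ds' i d"
proof -
  have "(\<lambda>x. map (\<lambda>j. ds j x) [0..<i]) = (\<lambda>x. map (\<lambda>j. ds' j x) [0..<i])"
    using assms by auto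
  then show ?thesis by (simp add: nice_relative_to_iff_nice_modulo)
qed

lemma nice_sequence_iff:
  "nice_sequence \<Gamma> c ds \<longleftrightarrow> (\<forall>i. nice_relative_to \<Gamma> c ds i (ds i))"
proof -
  have "nice_grading \<Gamma> c d \<longleftrightarrow> nice_relative_to \<Gamma> c ds 0 d" for d
    by (simp add: nice_grading_def nice_relative_to_def)
  then show ?thesis unfolding nice_sequence_def by (metis neq0_conv)
qed

text \<open>
  Each refinement strictly decreases the finite set of pairs not yet separated. Zero gradings are
  nice relative to anything, so a finite sequence of refinements extends to an infinite nice one.
\<close>

lemma separated_if_refinable:
  fixes \<Gamma> :: "('w, 'b) pre_digraph" and c :: "('w, 'b, 'v, 'a) quiver_map"
  assumes fin: "finite (verts \<Gamma>)"
    and refine: "\<And>\<kappa> :: 'w \<Rightarrow> int list. \<not> inj_on \<kappa> (verts \<Gamma>) \<Longrightarrow>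
       \<exists>d x y. nice_modulo \<Gamma> c \<kappa> d \<and> x \<in> verts \<Gamma> \<and> y \<in> verts \<Gamma> \<and> \<kappa> x = \<kappa> y \<and> d x \<noteq> d y"
  shows "separated \<Gamma> c"
proof -
  define pairs where "pairs ds N = {(x, y). x \<in> verts \<Gamma> \<and> y \<in> verts \<Gamma> \<and> x \<noteq> y \<and> (\<forall>j<N. ds j x = ds j y)}"
    for ds :: "nat \<Rightarrow> 'w \<Rightarrow> int" and N :: nat
  have fin_pairs: "finite (pairs ds N)" for ds N
    by (rule finite_subset[of _ "verts \<Gamma> \<times> verts \<Gamma>"]) (use fin in \<open>auto simp: pairs_def\<close>)
  have "separated \<Gamma> c"
    if "\<forall>i. nice_relative_to \<Gamma> c ds i (ds i)" "\<forall>i\<ge>N. ds i = (\<lambda>_. 0)" for ds N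
    using that
  proof (induction "card (pairs ds N)" arbitrary: ds N rule: less_induct)
    case less
    let ?\<kappa> = "\<lambda>x. map (\<lambda>j. ds j x) [0..<N]"
    note nice = less.prems(1) and tail_zero = less.prems(2)
    show ?case
    proof (cases "inj_on ?\<kappa> (verts \<Gamma>)")
      case True
      have "separates_up_to \<Gamma> ds N"
        unfolding separates_up_to_def
      proof (intro ballI impI)
        fix x y assume xy: "x \<in> verts \<Gamma>" "y \<in> verts \<Gamma>" "x \<noteq> y"
        then have "?\<kappa> x \<noteq> ?\<kappa> y" using True by (auto dest: inj_onD)
        then obtain j where "j < N" "ds j x \<noteq> ds j y" by auto
        then show "\<exists>i\<le>N. ds i x \<noteq> ds i y" by (auto intro: exI[of _ j])
      qed
      with less.prems show ?thesis unfolding separated_def nice_sequence_iff by blast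
    next
      case False
      then obtain d x y where d: "nice_modulo \<Gamma> c ?\<kappa> d" and
        xy: "x \<in> verts \<Gamma>" "y \<in> verts \<Gamma>" "?\<kappa> x = ?\<kappa> y" "d x \<noteq> d y"
        using refine by blast
      let ?ds = "ds(N := d)"
      have "pairs ?ds (Suc N) \<subset> pairs ds N"
      proof
        show "pairs ?ds (Suc N) \<subseteq> pairs ds N" by (auto simp: pairs_def less_Suc_eq)
        have "(x, y) \<in> pairs ds N" using xy by (auto simp: pairs_def)
        moreover have "(x, y) \<notin> pairs ?ds (Suc N)" using xy by (auto simp: pairs_def)
        ultimately show "pairs ?ds (Suc N) \<noteq> pairs ds N" by blast
      qed
      then have "card (pairs ?ds (Suc N)) < card (pairs ds N)"
        by (rule psubset_card_mono[OF fin_pairs])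
      moreover have "nice_relative_to \<Gamma> c ?ds i (?ds i)" for i
      proof (cases i N rule: linorder_cases)
        case less
        then show ?thesis
          using nice[rule_format, of i] nice_relative_to_cong[of i ?ds ds \<Gamma> c "ds i"] by simp
      next
        case equal
        then show ?thesis
          using d nice_relative_to_cong[of i ?ds ds \<Gamma> c d]
          unfolding nice_relative_to_iff_nice_modulo[symmetric] by simp
      next
        case greater
        then show ?thesis using tail_zero by (simp add: nice_relative_to_def)
      qed
      moreover have "\<forall>i\<ge>Suc N. ?ds i = (\<lambda>_. 0)" using tail_zero by simp
      ultimately show ?thesis using less.hyps by blast
    qed
  qed
  from this[of "\<lambda>_ _. 0" 0] show ?thesis by (simp add: nice_relative_to_def)
qed

theorem tree_separated:
  assumes "fin_digraph \<Gamma>" "winding \<Gamma> Q c" "tree_quiver \<Gamma>"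
  shows "separated \<Gamma> c"
proof (rule separated_if_refinable)
  interpret fin_digraph \<Gamma> by fact
  show "finite (verts \<Gamma>)" by simp
  fix \<kappa> :: "_ \<Rightarrow> int list"
  assume ninj: "\<not> inj_on \<kappa> (verts \<Gamma>)"
  show "\<exists>d x y. nice_modulo \<Gamma> c \<kappa> d \<and> x \<in> verts \<Gamma> \<and> y \<in> verts \<Gamma> \<and> \<kappa> x = \<kappa> y \<and> d x \<noteq> d y"
    using tree_separating_grading[OF wf_digraph_axioms assms(2,3) ninj] by metis
qed

theorem primitive_imp_separated:
  assumes "fin_digraph \<Gamma>" "winding \<Gamma> Q c" "primitive \<Gamma> Q c"
  shows "separated \<Gamma> c"
proof (rule separated_if_refinable)
  interpret fin_digraph \<Gamma> by fact
  show "finite (verts \<Gamma>)" by simp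
  fix \<kappa> :: "_ \<Rightarrow> int list"
  assume ninj: "\<not> inj_on \<kappa> (verts \<Gamma>)"
  obtain w where w: "once_around \<Gamma> w" and np: "\<not> (\<exists>q k. closed_walk Q q \<and> k > 1 \<and>
           map (\<lambda>(\<beta>, \<delta>). (on_arcs c \<beta>, \<delta>)) w = concat (replicate k q))"
    using assms(3) unfolding primitive_def by blast
  show "\<exists>d x y. nice_modulo \<Gamma> c \<kappa> d \<and> x \<in> verts \<Gamma> \<and> y \<in> verts \<Gamma> \<and> \<kappa> x = \<kappa> y \<and> d x \<noteq> d y"
    using unseparated_once_around_is_power[OF wf_digraph_axioms assms(2) w ninj] np by metis
qed

text \<open>
  By induction on \<open>i\<close>, the \<open>i\<close>-th grading is invariant under the shift by the length of \<open>q\<close>: arrows that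
  correspond under the shift have the same image and, by induction, ends that agree in all earlier gradings, so
  the grading increases equally along them. Hence the shift changes it by a constant \<open>t\<close>, and
  \<open>k t = 0\<close> because \<open>k\<close> shifts lead back to the starting vertex.
\<close>

theorem separated_imp_primitive:
  assumes wf: "wf_digraph \<Gamma>" and w: "once_around \<Gamma> w" and sep: "separated \<Gamma> c"
  shows "primitive \<Gamma> Q c"
proof (rule ccontr)
  assume "\<not> primitive \<Gamma> Q c"
  then obtain q k where qk: "k > 1" "map (\<lambda>(\<beta>, \<delta>). (on_arcs c \<beta>, \<delta>)) w = concat (replicate k q)"
    using w unfolding primitive_def by blast
  let ?D = "double_quiver \<Gamma>" and ?N = "length w" and ?n = "length q"
  have cyc: "undirected_cycle \<Gamma> w" and arcs: "fst ` set w = arcs \<Gamma>"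
    and verts: "tail ?D ` set w = verts \<Gamma>"
    using w by (auto simp: once_around_def)
  have ne: "w \<noteq> []" and dist: "distinct (map (tail ?D) w)"
    and nxt: "\<And>i. i < ?N \<Longrightarrow> head ?D (w ! i) = tail ?D (w ! (Suc i mod ?N))"
    using cyc unfolding undirected_cycle_iff[OF wf] by auto
  have N: "?N = k * ?n" using arg_cong[OF qk(2), of length] by (simp add: length_concat sum_list_replicate)
  have n: "?n > 0" using N ne by (cases "?n = 0") auto
  then have "?n < ?N" using N qk(1) by simp
  define L where "L i = w ! (i mod ?N)" for i
  define x where "x i = tail ?D (L i)" for i
  have L_set: "L i \<in> set w" for i using ne by (simp add: L_def)
  have L_arc: "fst (L i) \<in> arcs \<Gamma>" for i using L_set arcs by blast
  have L_head: "head ?D (L i) = x (Suc i)" for i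
    using nxt[of "i mod ?N"] ne by (simp add: L_def x_def mod_Suc_eq)
  have concat_nth: "concat (replicate m q) ! i = q ! (i mod ?n)" if "i < m * ?n" for m i
    using that
  proof (induction m arbitrary: i)
    case (Suc m)
    show ?case
    proof (cases "i < ?n")
      case False
      then show ?thesis using Suc.IH[of "i - ?n"] Suc.prems
        by (simp add: nth_append le_mod_geq)
    qed (simp add: nth_append)
  qed simp
  have letter: "(on_arcs c (fst (L i)), snd (L i)) = q ! (i mod ?n)" for i
  proof -
    have "i mod ?N < ?N" using ne by simp
    then have "(on_arcs c (fst (L i)), snd (L i)) = map (\<lambda>(\<beta>, \<delta>). (on_arcs c \<beta>, \<delta>)) w ! (i mod ?N)"
      by (simp add: L_def split: prod.splits)
    also have "\<dots> = q ! (i mod ?N mod ?n)"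
      unfolding qk(2) by (rule concat_nth) (use \<open>i mod ?N < ?N\<close> N in simp)
    finally show ?thesis by (simp add: N mod_mod_cancel)
  qed
  obtain ds m where ds: "nice_sequence \<Gamma> c ds" "separates_up_to \<Gamma> ds m"
    using sep unfolding separated_def by blast
  have const: "\<forall>p. ds i (x (p + ?n)) = ds i (x p)" for i
  proof (induction i rule: less_induct)
    case (less i)
    have nice: "nice_relative_to \<Gamma> c ds i (ds i)" using ds(1) nice_sequence_iff by blast
    have diff: "ds i (x (Suc (p + ?n))) - ds i (x (p + ?n)) = ds i (x (Suc p)) - ds i (x p)" for p
    proof -
      obtain \<beta> \<delta> \<beta>' where L: "L p = (\<beta>, \<delta>)" "L (p + ?n) = (\<beta>', \<delta>)" "on_arcs c \<beta> = on_arcs c \<beta>'"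
      proof -
        have "(on_arcs c (fst (L p)), snd (L p)) = (on_arcs c (fst (L (p + ?n))), snd (L (p + ?n)))"
          unfolding letter by simp
        then show ?thesis using that by (cases "L p"; cases "L (p + ?n)") auto
      qed
      have x: "x p = tail ?D (\<beta>, \<delta>)" "x (Suc p) = head ?D (\<beta>, \<delta>)"
        "x (p + ?n) = tail ?D (\<beta>', \<delta>)" "x (Suc (p + ?n)) = head ?D (\<beta>', \<delta>)"
        using L L_head[of p] L_head[of "p + ?n"] by (simp_all add: x_def)
      have same: "ds j (x p) = ds j (x (p + ?n))" "ds j (x (Suc p)) = ds j (x (Suc (p + ?n)))" if "j < i" for j
        using less.IH[OF that] by (metis, metis add_Suc)
      have "ds j (tail \<Gamma> \<beta>) = ds j (tail \<Gamma> \<beta>') \<and> ds j (head \<Gamma> \<beta>) = ds j (head \<Gamma> \<beta>')"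
        if "j < i" for j
        using same[OF that] unfolding x by (cases \<delta>) auto
      note same' = this
      have "ds i (head \<Gamma> \<beta>) - ds i (tail \<Gamma> \<beta>) = ds i (head \<Gamma> \<beta>') - ds i (tail \<Gamma> \<beta>')"
        by (rule nice[unfolded nice_relative_to_def, rule_format])
          (use L_arc[of p] L_arc[of "p + ?n"] L same' in auto)
      then show ?thesis unfolding x by (cases \<delta>) auto
    qed
    define t where "t = ds i (x ?n) - ds i (x 0)"
    have t: "ds i (x (p + ?n)) - ds i (x p) = t" for p
    proof (induction p)
      case (Suc p)
      then show ?case using diff[of p] by simp
    qed (simp add: t_def)
    have "ds i (x (a * ?n)) = ds i (x 0) + int a * t" for a
    proof (induction a)
      case (Suc a)
      then show ?case using t[of "a * ?n"] by (simp add: algebra_simps)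
    qed simp
    moreover have "x (k * ?n) = x 0" by (simp add: x_def L_def N[symmetric])
    ultimately have "int k * t = 0" by (metis add_cancel_left_right)
    then have "t = 0" using qk(1) by simp
    then show ?case using t by simp
  qed
  have "x ?n \<noteq> x 0"
    using nth_eq_iff_index_eq[OF dist, of ?n 0] n \<open>?n < ?N\<close> ne by (auto simp: x_def L_def)
  moreover have "x ?n \<in> verts \<Gamma>" "x 0 \<in> verts \<Gamma>" using verts L_set by (auto simp: x_def)
  ultimately show False
    using ds(2) const unfolding separates_up_to_def by (metis add_0)
qed

section \<open>Isomorphism classes of representations\<close>

text \<open>
  An isomorphism induces an isomorphism of coefficient quivers over \<open>Q\<close>, along which nice sequences are
  pulled back.
\<close>

lemma nice_length_le_if_iso:
  assumes "(M, N) \<in> f1_iso Q" "wf_digraph Q"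
  shows "nice_length Q M \<le> nice_length Q N"
proof -
  from assms(1) obtain \<phi> where
    repM: "f1_representation Q M" and
    bij: "\<And>v. v \<in> verts Q \<Longrightarrow> bij_betw (\<phi> v) (pcarrier (rep_space M v)) (pcarrier (rep_space N v))" and
    zero: "\<And>v. v \<in> verts Q \<Longrightarrow> \<phi> v (pzero (rep_space M v)) = pzero (rep_space N v)" and
    comm: "\<And>\<alpha> x. \<alpha> \<in> arcs Q \<Longrightarrow> x \<in> pcarrier (rep_space M (tail Q \<alpha>)) \<Longrightarrow>
       \<phi> (head Q \<alpha>) (rep_map M \<alpha> x) = rep_map N \<alpha> (\<phi> (tail Q \<alpha>) x)"
    unfolding f1_iso_def by blast
  interpret wf_digraph Q by fact
  let ?G = "coeff_quiver Q M" and ?G' = "coeff_quiver Q N"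
  define F where "F = (\<lambda>(v, x). (v, \<phi> v x))"
  define F' where "F' = (\<lambda>(\<alpha>, x). (\<alpha>, \<phi> (tail Q \<alpha>) x))"
  have pz: "pzero (rep_space M v) \<in> pcarrier (rep_space M v)" if "v \<in> verts Q" for v
    using repM that by (simp add: f1_representation_def f1_space_def)
  have nz: "\<phi> v x \<noteq> pzero (rep_space N v)" "\<phi> v x \<in> pcarrier (rep_space N v)"
    if "v \<in> verts Q" "x \<in> pcarrier (rep_space M v)" "x \<noteq> pzero (rep_space M v)" for v x
  proof -
    show "\<phi> v x \<in> pcarrier (rep_space N v)" using bij[OF that(1)] that(2) by (rule bij_betwE[rule_format])
    show "\<phi> v x \<noteq> pzero (rep_space N v)"
      using bij_betw_imp_inj_on[OF bij[OF that(1)]] that pz[OF that(1)] zero[OF that(1)]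
      by (metis inj_onD)
  qed
  have F_verts: "F z \<in> verts ?G'" if "z \<in> verts ?G" for z
    using that nz by (auto simp: coeff_quiver_def F_def)
  have F_inj: "inj_on F (verts ?G)"
    using bij[THEN bij_betw_imp_inj_on] by (auto simp: coeff_quiver_def F_def inj_on_def)
  have F'_arcs: "F' \<beta> \<in> arcs ?G'" if "\<beta> \<in> arcs ?G" for \<beta>
  proof -
    obtain \<alpha> x where b: "\<beta> = (\<alpha>, x)" by force
    have h: "\<alpha> \<in> arcs Q" "x \<in> pcarrier (rep_space M (tail Q \<alpha>))" "x \<noteq> pzero (rep_space M (tail Q \<alpha>))"
      "rep_map M \<alpha> x \<noteq> pzero (rep_space M (head Q \<alpha>))"
      using that b by (auto simp: coeff_quiver_def)
    have "rep_map M \<alpha> x \<in> pcarrier (rep_space M (head Q \<alpha>))"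
      using repM h by (auto simp: f1_representation_def f1_linear_def)
    then have "\<phi> (head Q \<alpha>) (rep_map M \<alpha> x) \<noteq> pzero (rep_space N (head Q \<alpha>))"
      using nz(1)[of "head Q \<alpha>" "rep_map M \<alpha> x"] h by simp
    then show ?thesis
      using h nz[of "tail Q \<alpha>" x] comm[of \<alpha> x] by (simp add: coeff_quiver_def F'_def b)
  qed
  have F_ends: "tail ?G' (F' \<beta>) = F (tail ?G \<beta>) \<and> head ?G' (F' \<beta>) = F (head ?G \<beta>) \<and>
      on_arcs (coeff_winding Q N) (F' \<beta>) = on_arcs (coeff_winding Q M) \<beta>"
    if "\<beta> \<in> arcs ?G" for \<beta>
    using that comm by (auto simp: coeff_quiver_def coeff_winding_def F_def F'_def)
  have "\<exists>ds'. nice_sequence ?G (coeff_winding Q M) ds' \<and> separates_up_to ?G ds' n"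
    if ds: "nice_sequence ?G' (coeff_winding Q N) ds" "separates_up_to ?G' ds n" for ds n
  proof (intro exI conjI)
    let ?ds = "\<lambda>j. ds j \<circ> F"
    have "nice_relative_to ?G (coeff_winding Q M) ?ds i (?ds i)" for i
      unfolding nice_relative_to_def
    proof (intro ballI impI)
      fix \<beta> \<beta>' assume b: "\<beta> \<in> arcs ?G" "\<beta>' \<in> arcs ?G" and
        eq: "on_arcs (coeff_winding Q M) \<beta> = on_arcs (coeff_winding Q M) \<beta>' \<and>
          (\<forall>j<i. ?ds j (tail ?G \<beta>) = ?ds j (tail ?G \<beta>') \<and> ?ds j (head ?G \<beta>) = ?ds j (head ?G \<beta>'))"
      have "nice_relative_to ?G' (coeff_winding Q N) ds i (ds i)"
        using ds(1) nice_sequence_iff by blast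
      from this[unfolded nice_relative_to_def, rule_format, OF F'_arcs[OF b(1)] F'_arcs[OF b(2)]]
      have "ds i (head ?G' (F' \<beta>)) - ds i (tail ?G' (F' \<beta>)) =
          ds i (head ?G' (F' \<beta>')) - ds i (tail ?G' (F' \<beta>'))"
        using eq by (simp add: F_ends[OF b(1)] F_ends[OF b(2)])
      then show "?ds i (head ?G \<beta>) - ?ds i (tail ?G \<beta>) = ?ds i (head ?G \<beta>') - ?ds i (tail ?G \<beta>')"
        using F_ends[OF b(1)] F_ends[OF b(2)] by simp
    qed
    then show "nice_sequence ?G (coeff_winding Q M) ?ds" by (simp add: nice_sequence_iff)
    show "separates_up_to ?G ?ds n"
      unfolding separates_up_to_def
    proof (intro ballI impI)
      fix x y assume xy: "x \<in> verts ?G" "y \<in> verts ?G" "x \<noteq> y"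
      then have "F x \<noteq> F y" using F_inj by (auto dest: inj_onD)
      then show "\<exists>i\<le>n. ?ds i x \<noteq> ?ds i y"
        using ds(2) F_verts xy unfolding separates_up_to_def by simp
    qed
  qed
  then show ?thesis unfolding nice_length_def by (intro Inf_superset_mono) blast
qed

lemma f1_iso_refl: "f1_representation Q M \<Longrightarrow> (M, M) \<in> f1_iso Q"
  unfolding f1_iso_def by (auto intro!: exI[of _ "\<lambda>_ x. x"] simp: bij_betw_def)

text \<open>
  Equality of the two classes gives an isomorphism in both directions, since each class contains its
  representative; so the one-sided estimate of the nice length suffices.
\<close>

lemma iso_class_in_I_nil_iff:
  assumes "wf_digraph Q" "M \<in> indec_nil Q"
  shows "iso_class Q M \<in> I_nil Q n \<longleftrightarrow> nice_length Q M = enat n"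
proof
  assume "nice_length Q M = enat n"
  then show "iso_class Q M \<in> I_nil Q n"
    using assms(2) by (auto simp: I_nil_def iso_class_def quotient_def)
next
  assume "iso_class Q M \<in> I_nil Q n"
  then obtain M' where M': "M' \<in> indec_nil Q" "nice_length Q M' = enat n"
    "f1_iso Q `` {M} = f1_iso Q `` {M'}"
    by (auto simp: I_nil_def iso_class_def quotient_def)
  have "(M, M) \<in> f1_iso Q" "(M', M') \<in> f1_iso Q"
    using assms(2) M'(1) by (auto simp: indec_nil_def intro: f1_iso_refl)
  then have "(M', M) \<in> f1_iso Q" "(M, M') \<in> f1_iso Q" using M'(3) by blast+
  then show "nice_length Q M = enat n"
    using nice_length_le_if_iso[OF _ assms(1)] M'(2) by (metis order_antisym)
qed

lemma nice_length_finite_iff: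
  "(\<exists>n. nice_length Q M = enat n) \<longleftrightarrow> separated (coeff_quiver Q M) (coeff_winding Q M)"
proof -
  let ?A = "{enat n | n. \<exists>ds. nice_sequence (coeff_quiver Q M) (coeff_winding Q M) ds \<and>
                           separates_up_to (coeff_quiver Q M) ds n}"
  have "separated (coeff_quiver Q M) (coeff_winding Q M) \<longleftrightarrow> ?A \<noteq> {}"
    by (auto simp: separated_def)
  also have "\<dots> \<longleftrightarrow> (\<exists>n. Inf ?A = enat n)"
  proof
    assume "?A \<noteq> {}"
    then obtain n where "enat n \<in> ?A" by blast
    then have "Inf ?A \<le> enat n" by (rule Inf_lower)
    then show "\<exists>n. Inf ?A = enat n" by (cases "Inf ?A") auto
  next
    assume "\<exists>n. Inf ?A = enat n"
    then show "?A \<noteq> {}" by (metis Inf_empty enat.distinct(1) top_enat_def)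
  qed
  finally show ?thesis by (simp add: nice_length_def)
qed

lemma nice_length_zero_iff:
  "nice_length Q M = enat 0 \<longleftrightarrow>
     (\<exists>d. nice_grading (coeff_quiver Q M) (coeff_winding Q M) d \<and> inj_on d (verts (coeff_quiver Q M)))"
proof -
  let ?G = "coeff_quiver Q M" and ?c = "coeff_winding Q M"
  let ?A = "{enat n | n. \<exists>ds. nice_sequence ?G ?c ds \<and> separates_up_to ?G ds n}"
  have "Inf ?A = 0 \<longleftrightarrow> 0 \<in> ?A"
  proof
    assume "Inf ?A = 0"
    then have "?A \<noteq> {}" by (metis Inf_empty enat.distinct(1) top_enat_def zero_enat_def)
    then have "(LEAST n. n \<in> ?A) \<in> ?A" by (metis (mono_tags, lifting) LeastI_ex ex_in_conv)
    then show "0 \<in> ?A" using \<open>Inf ?A = 0\<close> \<open>?A \<noteq> {}\<close> by (simp only: Inf_enat_def if_False)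
  next
    assume "0 \<in> ?A"
    then have "Inf ?A \<le> 0" by (rule Inf_lower)
    then show "Inf ?A = 0" by simp
  qed
  also have "\<dots> \<longleftrightarrow> (\<exists>ds. nice_sequence ?G ?c ds \<and> separates_up_to ?G ds 0)"
    by (auto simp: zero_enat_def)
  also have "\<dots> \<longleftrightarrow> (\<exists>d. nice_grading ?G ?c d \<and> inj_on d (verts ?G))"
  proof
    assume "\<exists>ds. nice_sequence ?G ?c ds \<and> separates_up_to ?G ds 0"
    then obtain ds where "nice_sequence ?G ?c ds" "separates_up_to ?G ds 0" by blast
    then show "\<exists>d. nice_grading ?G ?c d \<and> inj_on d (verts ?G)"
      by (intro exI[of _ "ds 0"]) (auto simp: nice_sequence_def separates_up_to_def inj_on_def)
  next
    assume "\<exists>d. nice_grading ?G ?c d \<and> inj_on d (verts ?G)"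
    then obtain d where d: "nice_grading ?G ?c d" "inj_on d (verts ?G)" by blast
    have "nice_sequence ?G ?c (\<lambda>i. if i = 0 then d else (\<lambda>_. 0))"
      using d(1) by (simp add: nice_sequence_def nice_relative_to_def)
    moreover have "separates_up_to ?G (\<lambda>i. if i = 0 then d else (\<lambda>_. 0)) 0"
      using d(2) by (auto simp: separates_up_to_def dest: inj_onD)
    ultimately show "\<exists>ds. nice_sequence ?G ?c ds \<and> separates_up_to ?G ds 0" by blast
  qed
  finally show ?thesis by (simp add: nice_length_def zero_enat_def)
qed

text \<open>
  If \<open>e\<close> numbers the vertices of \<open>Q\<close> by \<open>0, \<dots>, N - 1\<close>, then \<open>N d + e \<circ> c\<close> is still nice, since its
  coboundary differs from \<open>N\<close> times that of \<open>d\<close> by a pulled back one. Its residue modulo \<open>N\<close> recovers the fibre.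
\<close>

lemma injective_nice_grading_if_injective_on_fibres:
  assumes fin: "finite (verts Q)" and map: "is_quiver_map \<Gamma> Q c" and nice: "nice_grading \<Gamma> c d"
    and inj: "\<And>v. v \<in> verts Q \<Longrightarrow> inj_on d {x \<in> verts \<Gamma>. on_verts c x = v}"
  obtains d' where "nice_grading \<Gamma> c d'" "inj_on d' (verts \<Gamma>)"
proof -
  obtain e :: "_ \<Rightarrow> nat" and N where e: "e ` verts Q = {i. i < N}" "inj_on e (verts Q)"
    using finite_imp_inj_to_nat_seg[OF fin] by metis
  define d' where "d' x = int N * d x + int (e (on_verts c x))" for x
  have "nice_grading \<Gamma> c d'"
    unfolding nice_grading_def
  proof (intro ballI impI)
    fix \<beta> \<beta>' assume b: "\<beta> \<in> arcs \<Gamma>" "\<beta>' \<in> arcs \<Gamma>" "on_arcs c \<beta> = on_arcs c \<beta>'"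
    then have "d (head \<Gamma> \<beta>) - d (tail \<Gamma> \<beta>) = d (head \<Gamma> \<beta>') - d (tail \<Gamma> \<beta>')"
      using nice unfolding nice_grading_def by blast
    then have "int N * d (head \<Gamma> \<beta>) - int N * d (tail \<Gamma> \<beta>) =
        int N * d (head \<Gamma> \<beta>') - int N * d (tail \<Gamma> \<beta>')"
      by (metis right_diff_distrib)
    moreover have ends: "on_verts c (head \<Gamma> y) = head Q (on_arcs c y) \<and> on_verts c (tail \<Gamma> y) = tail Q (on_arcs c y)"
      if "y \<in> arcs \<Gamma>" for y
      using map that unfolding is_quiver_map_def by simp
    ultimately show "d' (head \<Gamma> \<beta>) - d' (tail \<Gamma> \<beta>) = d' (head \<Gamma> \<beta>') - d' (tail \<Gamma> \<beta>')"
      using b(3) ends[OF b(1)] ends[OF b(2)] unfolding d'_def by simp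
  qed
  moreover have "inj_on d' (verts \<Gamma>)"
  proof (rule inj_onI)
    fix x y assume xy: "x \<in> verts \<Gamma>" "y \<in> verts \<Gamma>" "d' x = d' y"
    have Q: "on_verts c x \<in> verts Q" "on_verts c y \<in> verts Q"
      using map xy by (auto simp: is_quiver_map_def)
    then have lt: "e (on_verts c x) < N" "e (on_verts c y) < N" using e(1) by auto
    have rem: "d' z mod int N = int (e (on_verts c z))" if "e (on_verts c z) < N" for z
      using that unfolding d'_def by simp
    have "int (e (on_verts c x)) = int (e (on_verts c y))"
      using rem[OF lt(1)] rem[OF lt(2)] xy(3) by simp
    then have "on_verts c x = on_verts c y" using e(2) Q by (auto dest: inj_onD)
    moreover from this have "d x = d y" using xy(3) lt by (simp add: d'_def)
    ultimately show "x = y" using inj[OF Q(2)] xy by (auto dest: inj_onD)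
  qed
  ultimately show ?thesis using that by blast
qed

text \<open>
  A connected component and its complement are closed under all the maps, so they would decompose \<open>M\<close>.
\<close>

lemma indecomposable_imp_connected:
  assumes "wf_digraph Q" and rep: "f1_representation Q M" and indec: "indecomposable Q M"
  shows "connected (coeff_quiver Q M)"
proof -
  let ?G = "coeff_quiver Q M"
  let ?S = "with_proj (mk_symmetric ?G)"
  interpret wf_digraph Q by fact
  have zero_in: "pzero (rep_space M v) \<in> pcarrier (rep_space M v)" if "v \<in> verts Q" for v
    using rep that by (simp add: f1_representation_def f1_space_def)
  have map_in: "rep_map M \<alpha> x \<in> pcarrier (rep_space M (head Q \<alpha>))"
    if "\<alpha> \<in> arcs Q" "x \<in> pcarrier (rep_space M (tail Q \<alpha>))" for \<alpha> x
    using rep that by (auto simp: f1_representation_def f1_linear_def)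
  have map_zero: "rep_map M \<alpha> (pzero (rep_space M (tail Q \<alpha>))) = pzero (rep_space M (head Q \<alpha>))"
    if "\<alpha> \<in> arcs Q" for \<alpha>
    using rep that by (auto simp: f1_representation_def f1_linear_def)
  have verts_iff: "(v, x) \<in> verts ?G \<longleftrightarrow> v \<in> verts Q \<and> x \<in> pcarrier (rep_space M v) \<and> x \<noteq> pzero (rep_space M v)"
    for v x by (auto simp: coeff_quiver_def)
  have wfG: "wf_digraph ?G"
    by unfold_locales (use map_in in \<open>auto simp: coeff_quiver_def\<close>)
  have wfS: "wf_digraph ?S"
    by unfold_locales (use wfG in \<open>auto simp: mk_symmetric_def wf_digraph.head_in_verts wf_digraph.tail_in_verts\<close>)
  have "z \<rightarrow>\<^sup>*\<^bsub>?S\<^esub> z'" if z: "z \<in> verts ?G" "z' \<in> verts ?G" for z z'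
  proof (rule ccontr)
    assume nr: "\<not> z \<rightarrow>\<^sup>*\<^bsub>?S\<^esub> z'"
    define R where "R = {y. z \<rightarrow>\<^sup>*\<^bsub>?S\<^esub> y}"
    have R_verts: "R \<subseteq> verts ?G"
    proof
      fix y assume "y \<in> R"
      then have "z \<rightarrow>\<^sup>*\<^bsub>?S\<^esub> y" by (simp add: R_def)
      from wf_digraph.reachable_in_verts(2)[OF wfS this] show "y \<in> verts ?G" by simp
    qed
    have R_arc: "(tail Q \<alpha>, x) \<in> R \<longleftrightarrow> (head Q \<alpha>, rep_map M \<alpha> x) \<in> R"
      if h: "\<alpha> \<in> arcs Q" "x \<in> pcarrier (rep_space M (tail Q \<alpha>))" "x \<noteq> pzero (rep_space M (tail Q \<alpha>))"
        "rep_map M \<alpha> x \<noteq> pzero (rep_space M (head Q \<alpha>))" for \<alpha> x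
    proof -
      have "(\<alpha>, x) \<in> arcs ?G" "tail ?G (\<alpha>, x) = (tail Q \<alpha>, x)" "head ?G (\<alpha>, x) = (head Q \<alpha>, rep_map M \<alpha> x)"
        using h by (auto simp: coeff_quiver_def)
      then have "((tail Q \<alpha>, x), (head Q \<alpha>, rep_map M \<alpha> x)) \<in> arcs_ends ?S"
        "((head Q \<alpha>, rep_map M \<alpha> x), (tail Q \<alpha>, x)) \<in> arcs_ends ?S"
        by (force simp: mk_symmetric_def arcs_ends_def arc_to_ends_def)+
      then show ?thesis
        unfolding R_def using wf_digraph.reachable_adj_trans[OF wfS] by blast
    qed
    define U where "U v = {pzero (rep_space M v)} \<union> {x. (v, x) \<in> R}" for v
    define W where "W v = {pzero (rep_space M v)} \<union> {x \<in> pcarrier (rep_space M v). (v, x) \<notin> R}" for v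
    have "subrepresentation Q M U"
      unfolding subrepresentation_def
    proof (intro conjI ballI)
      fix v assume "v \<in> verts Q"
      then show "U v \<subseteq> pcarrier (rep_space M v)" using R_verts verts_iff zero_in by (auto simp: U_def)
      show "pzero (rep_space M v) \<in> U v" by (simp add: U_def)
    next
      fix \<alpha> x assume "\<alpha> \<in> arcs Q" "x \<in> U (tail Q \<alpha>)"
      then show "rep_map M \<alpha> x \<in> U (head Q \<alpha>)"
        using R_arc[of \<alpha> x] map_zero[of \<alpha>] R_verts verts_iff by (auto simp: U_def)
    qed
    moreover have "subrepresentation Q M W"
      unfolding subrepresentation_def
    proof (intro conjI ballI)
      fix v assume "v \<in> verts Q"
      then show "W v \<subseteq> pcarrier (rep_space M v)" using zero_in by (auto simp: W_def)
      show "pzero (rep_space M v) \<in> W v" by (simp add: W_def)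
    next
      fix \<alpha> x assume "\<alpha> \<in> arcs Q" "x \<in> W (tail Q \<alpha>)"
      then show "rep_map M \<alpha> x \<in> W (head Q \<alpha>)"
        using R_arc[of \<alpha> x] map_zero[of \<alpha>] map_in[of \<alpha> x] by (auto simp: W_def)
    qed
    moreover have "U v \<union> W v = pcarrier (rep_space M v) \<and> U v \<inter> W v = {pzero (rep_space M v)}"
      if "v \<in> verts Q" for v
      using that R_verts verts_iff zero_in by (auto simp: U_def W_def)
    ultimately have "is_direct_sum Q M U W" by (simp add: is_direct_sum_def)
    moreover have "nonzero_family Q M U"
    proof -
      obtain v x where vx: "z = (v, x)" by force
      have "z \<in> R" using z(1) wf_digraph.reachable_refl[OF wfS] by (simp add: R_def mk_symmetric_def)
      then show ?thesis
        using z(1) unfolding nonzero_family_def vx verts_iff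
        by (intro bexI[of _ v]) (auto simp: U_def)
    qed
    moreover have "nonzero_family Q M W"
    proof -
      obtain v x where vx: "z' = (v, x)" by force
      have "z' \<notin> R" using nr by (simp add: R_def)
      then show ?thesis
        using z(2) unfolding nonzero_family_def vx verts_iff
        by (intro bexI[of _ v]) (auto simp: W_def)
    qed
    ultimately show False using indec by (auto simp: indecomposable_def)
  qed
  moreover have "verts ?G \<noteq> {}"
  proof -
    obtain v where v: "v \<in> verts Q" "pcarrier (rep_space M v) \<noteq> {pzero (rep_space M v)}"
      using indec by (auto simp: indecomposable_def nonzero_family_def)
    then obtain x where "(v, x) \<in> verts ?G" using zero_in[OF v(1)] verts_iff by blast
    then show ?thesis by blast
  qed
  ultimately show ?thesis
    by (simp add: connected_def strongly_connected_def mk_symmetric_def)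
qed

section \<open>Homology of pseudotrees\<close>

text \<open>
  The \<open>1\<close>-chain carried by a walk.
\<close>

definition walk_class :: "('a \<times> bool) list \<Rightarrow> ('a \<Rightarrow>\<^sub>0 int)" where
  "walk_class p = sum_list (map (\<lambda>(a, \<delta>). if \<delta> then frag_of a else - frag_of a) p)"

lemma lookup_walk_class:
  "Poly_Mapping.lookup (walk_class p) a = walk_sum (\<lambda>x. of_bool (x = a)) p"
  by (induction p) (auto simp: walk_class_def lookup_add)

lemma walk_class_boundary:
  assumes "wf_digraph Q" "uwalk Q u p v"
  shows "frag_extend (\<lambda>\<alpha>. frag_of (head Q \<alpha>) - frag_of (tail Q \<alpha>)) (walk_class p) = frag_of v - frag_of u"
  using assms(2)
proof (induction p arbitrary: u)
  case Nil
  then show ?case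
    by (simp add: walk_class_def wf_digraph.awalk_Nil_iff[OF wf_digraph_double_quiver[OF assms(1)]])
next
  case (Cons l p)
  interpret D: wf_digraph "double_quiver Q" by (rule wf_digraph_double_quiver) fact
  obtain e \<delta> where l: "l = (e, \<delta>)" by force
  have h: "u = tail (double_quiver Q) l" "D.awalk (head (double_quiver Q) l) p v"
    using Cons.prems l by (auto simp: D.awalk_Cons_iff)
  have "walk_class (l # p) = (if \<delta> then frag_of e else - frag_of e) + walk_class p"
    by (simp add: walk_class_def l)
  then show ?case
    using Cons.IH[OF h(2)] h(1) l by (cases \<delta>) (simp_all add: frag_extend_add frag_extend_minus frag_extend_diff)
qed

lemma closed_walk_class_in_H1:
  assumes "wf_digraph Q" "uwalk Q u p u"
  shows "walk_class p \<in> H1 Q"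
proof -
  have "set p \<subseteq> arcs Q \<times> UNIV" using assms(2) by (simp add: awalk_iff_positions)
  have "Poly_Mapping.keys (walk_class p) \<subseteq> arcs Q"
  proof
    fix a assume "a \<in> Poly_Mapping.keys (walk_class p)"
    then have ne: "walk_sum (\<lambda>x. of_bool (x = a)) p \<noteq> 0"
      by (simp add: in_keys_iff lookup_walk_class)
    have "a \<in> fst ` set p"
    proof (rule ccontr)
      assume "a \<notin> fst ` set p"
      then have "walk_sum (\<lambda>x. of_bool (x = a)) p = 0"
        by (induction p) (auto simp: signed_def)
      then show False using ne by simp
    qed
    then show "a \<in> arcs Q" using \<open>set p \<subseteq> arcs Q \<times> UNIV\<close> by auto
  qed
  then show ?thesis using walk_class_boundary[OF assms] by (simp add: H1_def)
qed

lemma walk_sum_eq_pairing: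
  assumes "finite A" "fst ` set p \<subseteq> A"
  shows "walk_sum f p = (\<Sum>a\<in>A. Poly_Mapping.lookup (walk_class p) a * f a)"
  using assms(2)
proof (induction p)
  case (Cons l p)
  obtain e \<delta> where l: "l = (e, \<delta>)" by force
  have "walk_class (l # p) = (if \<delta> then frag_of e else - frag_of e) + walk_class p"
    by (simp add: walk_class_def l)
  then have "Poly_Mapping.lookup (walk_class (l # p)) a * f a =
      (if a = e then signed f l else 0) + Poly_Mapping.lookup (walk_class p) a * f a" for a
    by (auto simp: lookup_add l algebra_simps)
  then show ?case
    using Cons l assms(1) by (simp add: sum.distrib)
qed (simp add: walk_class_def)

lemma module_frag_cmul: "module frag_cmul"
  by unfold_locales (simp_all add: frag_cmul_distrib frag_cmul_distrib2)

text \<open>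
  For \<open>z = z'\<close> the set \<open>{z, z'}\<close> has only one element and may well be independent; the relation
  \<open>z - z' = 0\<close> covers that case.
\<close>

lemma H1_elements_dependent:
  assumes rank: "rank_H1 Q \<le> 1" and z: "z \<in> H1 Q" "z' \<in> H1 Q"
  shows "\<exists>A B. (A \<noteq> 0 \<or> B \<noteq> 0) \<and> frag_cmul A z + frag_cmul B z' = 0"
proof (cases "z = z'")
  case True
  then show ?thesis by (intro exI[of _ 1] exI[of _ "-1"]) simp
next
  case False
  have "module.dependent frag_cmul {z, z'}"
  proof (rule ccontr)
    assume "\<not> ?thesis"
    then have "enat (card {z, z'}) \<le> rank_H1 Q"
      unfolding rank_H1_def using z by (intro SUP_upper) auto
    then have "enat (card {z, z'}) \<le> 1" using rank by (rule order_trans)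
    then show False using False by (simp add: one_enat_def)
  qed
  then obtain u where "\<exists>v\<in>{z, z'}. u v \<noteq> 0" "(\<Sum>v\<in>{z, z'}. frag_cmul (u v) v) = 0"
    using module.dependent_finite[OF module_frag_cmul, of "{z, z'}"] by auto
  then show ?thesis using False by (intro exI[of _ "u z"] exI[of _ "u z'"]) auto
qed

lemma closed_walks_dependent:
  assumes "fin_digraph Q" "rank_H1 Q \<le> 1" "uwalk Q u p u" "uwalk Q v q v"
  obtains A B where "A \<noteq> 0 \<or> B \<noteq> 0" "\<And>f. A * walk_sum f p + B * walk_sum f q = 0"
proof -
  interpret fin_digraph Q by fact
  obtain A B where AB: "A \<noteq> 0 \<or> B \<noteq> 0" "frag_cmul A (walk_class p) + frag_cmul B (walk_class q) = 0"
    using H1_elements_dependent[OF assms(2) closed_walk_class_in_H1[OF wf_digraph_axioms assms(3)]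
        closed_walk_class_in_H1[OF wf_digraph_axioms assms(4)]] by blast
  have "A * Poly_Mapping.lookup (walk_class p) a + B * Poly_Mapping.lookup (walk_class q) a = 0" for a
    using arg_cong[OF AB(2), of "\<lambda>z. Poly_Mapping.lookup z a"] by (simp add: lookup_add)
  then have zero: "(\<Sum>a\<in>arcs Q. (A * Poly_Mapping.lookup (walk_class p) a
      + B * Poly_Mapping.lookup (walk_class q) a) * f a) = 0" for f :: "'b \<Rightarrow> int"
    by simp
  have "fst ` set p \<subseteq> arcs Q" "fst ` set q \<subseteq> arcs Q"
    using assms(3,4) by (auto simp: awalk_iff_positions)
  then have "A * walk_sum f p + B * walk_sum f q = 0" for f
    using zero[of f]
    by (simp add: walk_sum_eq_pairing[OF finite_arcs] sum_distrib_left distrib_right sum.distrib mult.assoc)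
  with AB(1) show ?thesis using that by blast
qed

lemma uwalk_image:
  assumes map: "is_quiver_map \<Gamma> Q c" and p: "uwalk \<Gamma> u p v"
  shows "uwalk Q (on_verts c u) (map (\<lambda>(\<beta>, \<delta>). (on_arcs c \<beta>, \<delta>)) p) (on_verts c v)"
proof -
  obtain x where x: "x 0 = u" "x (length p) = v" "u \<in> verts \<Gamma>" "set p \<subseteq> arcs \<Gamma> \<times> UNIV"
    "\<And>i. i < length p \<Longrightarrow> tail (double_quiver \<Gamma>) (p ! i) = x i \<and> head (double_quiver \<Gamma>) (p ! i) = x (Suc i)"
    using p unfolding awalk_iff_positions by auto
  have "tail (double_quiver Q) (map (\<lambda>(\<beta>, \<delta>). (on_arcs c \<beta>, \<delta>)) p ! i) = on_verts c (x i) \<and>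
      head (double_quiver Q) (map (\<lambda>(\<beta>, \<delta>). (on_arcs c \<beta>, \<delta>)) p ! i) = on_verts c (x (Suc i))"
    if "i < length p" for i
  proof -
    obtain \<beta> \<delta> where l: "p ! i = (\<beta>, \<delta>)" by force
    have "\<beta> \<in> arcs \<Gamma>" using x(4) nth_mem[OF that] l by auto
    then show ?thesis
      using map x(5)[OF that] l that by (cases \<delta>) (simp_all add: is_quiver_map_def)
  qed
  moreover have "set (map (\<lambda>(\<beta>, \<delta>). (on_arcs c \<beta>, \<delta>)) p) \<subseteq> arcs (double_quiver Q)"
    using map x(4) by (auto simp: is_quiver_map_def)
  moreover have "on_verts c u \<in> verts (double_quiver Q)"
    using map x(3) by (simp add: is_quiver_map_def)
  ultimately show ?thesis
    unfolding awalk_iff_positions using x(1,2)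
    by (intro conjI exI[of _ "\<lambda>i. on_verts c (x i)"]) auto
qed

context periodic_reduced_walk
begin

lemma walk_sum_arc: "walk_sum f (map l [a..<b]) = arc_sum f a b"
  by (simp add: arc_sum_def interv_sum_list_conv_sum_set_nat comp_def)

lemma arc_is_walk:
  assumes "wf_digraph H" "\<And>i. fst (l i) \<in> arcs H" "a \<le> b"
  shows "uwalk H (pos a) (map l [a..<b]) (pos b)"
proof -
  have "l i \<in> arcs (double_quiver H)" for i using assms(2)[of i] by (cases "l i") auto
  moreover have "pos a \<in> verts (double_quiver H)"
    unfolding pos_def
    by (rule wf_digraph.tail_in_verts[OF wf_digraph_double_quiver[OF assms(1)]]) (rule calculation)
  moreover have "set (map l [a..<b]) \<subseteq> arcs (double_quiver H)"
    unfolding set_map image_subset_iff using calculation(1) by blast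
  ultimately show ?thesis
    unfolding awalk_iff_positions using assms(3) ends
    by (intro conjI exI[of _ "\<lambda>i. pos (a + i)"]) auto
qed

text \<open>
  A shortest closed arc is simple, hence of nonzero class, and by the bound on the rank every closed arc has
  a class proportional to it. So the walk is a positive power of that arc, without cancellation.
\<close>

lemma arc_sum_nonzero_if_rank_le_1:
  assumes fin: "fin_digraph H" and rank: "rank_H1 H \<le> 1" and arcs: "\<And>i. fst (l i) \<in> arcs H"
  obtains f where "arc_sum f 0 D \<noteq> 0"
proof -
  interpret H: fin_digraph H by fact
  obtain i n where C: "shortest_closed_arc i n" by (rule ex_shortest_closed_arc)
  have n: "n > 0" "pos (i + n) = pos i" using C unfolding shortest_closed_arc_def by blast+
  let ?one = "\<lambda>e x. of_bool (x = e) :: int" and ?f = "fst (l i)"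
  have f: "arc_sum (?one ?f) i (i + n) \<noteq> 0"
    using arc_sum_indicator_of_letter[of i "i + n" i] short_arc_inj[OF C, of "i + n" i] n by auto
  have off: "arc_sum (?one e) a b = 0"
    if e: "e \<notin> (\<lambda>p. fst (l p)) ` {i..<i + n}" and ab: "a < b" "pos a = pos b" for e a b
  proof -
    have w: "uwalk H (pos a) (map l [a..<b]) (pos a)" "uwalk H (pos i) (map l [i..<i + n]) (pos i)"
      using arc_is_walk[OF H.wf_digraph_axioms arcs, of a b]
        arc_is_walk[OF H.wf_digraph_axioms arcs, of i "i + n"] ab n by auto
    obtain A B where AB: "A \<noteq> 0 \<or> B \<noteq> 0"
      "\<And>g. A * arc_sum g a b + B * arc_sum g i (i + n) = 0"
      using closed_walks_dependent[OF fin rank w, unfolded walk_sum_arc] by blast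
    have e0: "arc_sum (?one e) i (i + n) = 0"
      unfolding arc_sum_def using e by (intro sum.neutral) (auto simp: signed_def)
    \<comment> \<open>The class of the shortest closed arc is nonzero, as its first arrow is crossed once.\<close>
    have "A \<noteq> 0"
    proof
      assume "A = 0"
      then show False using AB(1) AB(2)[of "?one ?f"] f by simp
    qed
    then show ?thesis using AB(2)[of "?one e"] e0 by simp
  qed
  have rep: "l (p + n) = l p" for p by (rule shortest_closed_arc_repeats(1)[OF C off])
  obtain k where k: "D = k * n"
    using shortest_closed_arc_repeats(2)[OF C off] by (metis dvdE mult.commute)
  have rep': "l (p + m * n) = l p" for p m
  proof (induction m)
    case (Suc m)
    then show ?case using rep[of "p + m * n"] by (simp add: algebra_simps)
  qed simp
  have mult: "arc_sum g 0 (m * n) = int m * arc_sum g 0 n" for g m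
  proof (induction m)
    case (Suc m)
    have "arc_sum g 0 (Suc m * n) = arc_sum g 0 (m * n) + arc_sum g (m * n) (m * n + n)"
      unfolding arc_sum_def by (simp add: sum.atLeastLessThan_concat add.commute)
    also have "arc_sum g (m * n) (m * n + n) = arc_sum g 0 n"
      unfolding arc_sum_def
      using sum.shift_bounds_nat_ivl[of "\<lambda>i. signed g (l i)" 0 "m * n" n] rep'
      by (simp add: add.commute)
    finally show ?case using Suc by (simp add: algebra_simps)
  qed (simp add: arc_sum_def)
  have "arc_sum (?one (fst (l 0))) 0 n \<noteq> 0"
    using arc_sum_indicator_of_letter[of 0 n 0] short_arc_inj[OF C, of n 0] n by auto
  moreover have "k > 0" using k period_pos by (cases k) auto
  ultimately have "arc_sum (?one (fst (l 0))) 0 D \<noteq> 0" using mult k by simp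
  then show ?thesis using that by blast
qed

end

text \<open>
  If the earlier gradings are constant on the fibres of \<open>c\<close>, then being nice relative to them is no weaker than
  being nice, so the coboundary of the next grading is pulled back from a cochain \<open>\<eta>\<close> on \<open>Q\<close>. It
  vanishes on the image of the cycle \<open>w\<close>, whose class is nonzero, and all classes of closed walks are proportional;
  hence it vanishes on the image of any path between two vertices of one fibre.
\<close>

lemma nice_sequence_constant_on_fibres:
  assumes Q: "fin_digraph Q" "rank_H1 Q \<le> 1"
    and wf: "wf_digraph \<Gamma>" and con: "connected \<Gamma>" and wind: "winding \<Gamma> Q c"
    and cyc: "undirected_cycle \<Gamma> w" and ds: "nice_sequence \<Gamma> c ds"
    and xy: "x \<in> verts \<Gamma>" "y \<in> verts \<Gamma>" "on_verts c x = on_verts c y"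
  shows "ds i x = ds i y"
  using xy
proof (induction i arbitrary: x y rule: less_induct)
  case (less i)
  have map: "is_quiver_map \<Gamma> Q c" using wind by (simp add: winding_def)
  have ends: "tail Q (on_arcs c \<beta>) = on_verts c (tail \<Gamma> \<beta>)" "head Q (on_arcs c \<beta>) = on_verts c (head \<Gamma> \<beta>)"
    "on_arcs c \<beta> \<in> arcs Q" if "\<beta> \<in> arcs \<Gamma>" for \<beta>
    using map that by (simp_all add: is_quiver_map_def)
  define \<eta> where "\<eta> a = (SOME k. \<exists>\<beta> \<in> arcs \<Gamma>. on_arcs c \<beta> = a \<and> k = ds i (head \<Gamma> \<beta>) - ds i (tail \<Gamma> \<beta>))" for a
  have \<eta>: "ds i (head \<Gamma> \<beta>) - ds i (tail \<Gamma> \<beta>) = \<eta> (on_arcs c \<beta>)" if b: "\<beta> \<in> arcs \<Gamma>" for \<beta>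
  proof -
    have "\<exists>\<beta>' \<in> arcs \<Gamma>. on_arcs c \<beta>' = on_arcs c \<beta> \<and> \<eta> (on_arcs c \<beta>) = ds i (head \<Gamma> \<beta>') - ds i (tail \<Gamma> \<beta>')"
      unfolding \<eta>_def by (rule someI_ex) (use b in blast)
    then obtain \<beta>' where b': "\<beta>' \<in> arcs \<Gamma>" "on_arcs c \<beta>' = on_arcs c \<beta>"
      "\<eta> (on_arcs c \<beta>) = ds i (head \<Gamma> \<beta>') - ds i (tail \<Gamma> \<beta>')" by blast
    have v: "tail \<Gamma> \<beta> \<in> verts \<Gamma>" "head \<Gamma> \<beta> \<in> verts \<Gamma>" "tail \<Gamma> \<beta>' \<in> verts \<Gamma>" "head \<Gamma> \<beta>' \<in> verts \<Gamma>"
      using wf b b'(1) by (simp_all add: wf_digraph.head_in_verts wf_digraph.tail_in_verts)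
    have same: "on_verts c (tail \<Gamma> \<beta>) = on_verts c (tail \<Gamma> \<beta>')" "on_verts c (head \<Gamma> \<beta>) = on_verts c (head \<Gamma> \<beta>')"
      using ends[OF b] ends[OF b'(1)] b'(2) by simp_all
    have "ds j (tail \<Gamma> \<beta>) = ds j (tail \<Gamma> \<beta>') \<and> ds j (head \<Gamma> \<beta>) = ds j (head \<Gamma> \<beta>')" if "j < i" for j
      using less.IH[OF that v(1,3) same(1)] less.IH[OF that v(2,4) same(2)] by simp
    moreover have "nice_relative_to \<Gamma> c ds i (ds i)" using ds nice_sequence_iff by blast
    ultimately show ?thesis
      unfolding b'(3) nice_relative_to_def using b b'(1,2) by metis
  qed
  let ?img = "map (\<lambda>(\<beta>, \<delta>). (on_arcs c \<beta>, \<delta>))"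
  have img: "walk_sum \<eta> (?img q) = ds i b - ds i a" if "uwalk \<Gamma> a q b" for a q b
  proof -
    have "walk_sum \<eta> (?img q) = walk_sum (\<lambda>\<beta>. \<eta> (on_arcs c \<beta>)) q"
      by (induction q) (auto simp: signed_def)
    then show ?thesis using walk_sum_coboundary[OF wf that \<eta>] by simp
  qed
  obtain p where p: "uwalk \<Gamma> x p y" using connected_imp_uwalk[OF wf con less.prems(1,2)] .
  obtain u where u: "uwalk \<Gamma> u w u"
    using cyc by (auto simp: undirected_cycle_def pre_digraph.cycle_def)
  have p': "uwalk Q (on_verts c x) (?img p) (on_verts c x)"
    using uwalk_image[OF map p] less.prems(3) by simp
  obtain A B where AB: "A \<noteq> 0 \<or> B \<noteq> 0" "\<And>f. A * walk_sum f (?img p) + B * walk_sum f (?img w) = 0"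
    using closed_walks_dependent[OF Q p' uwalk_image[OF map u]] by blast
  obtain f where f: "walk_sum f (?img w) \<noteq> 0"
  proof -
    let ?l = "\<lambda>i. (on_arcs c (fst (w ! (i mod length w))), snd (w ! (i mod length w)))"
    interpret W: periodic_reduced_walk Q ?l "length w"
      by (rule cycle_image[OF wf wind cyc, where h = "on_verts c"]) (use ends in auto)
    have "w \<noteq> []" and arcs: "fst ` set w \<subseteq> arcs \<Gamma>"
      using cyc by (simp_all add: undirected_cycle_iff[OF wf])
    have "fst (?l i) \<in> arcs Q" for i
      using ends(3) arcs \<open>w \<noteq> []\<close> by (simp add: image_subset_iff)
    then obtain f where f: "W.arc_sum f 0 (length w) \<noteq> 0"
      using W.arc_sum_nonzero_if_rank_le_1[OF Q] by blast
    have "map ?l [0..<length w] = ?img w"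
      by (rule nth_equalityI) (auto split: prod.splits)
    then have "walk_sum f (?img w) = W.arc_sum f 0 (length w)"
      using W.walk_sum_arc[of f 0 "length w"] by simp
    then have "walk_sum f (?img w) \<noteq> 0" using f by simp
    then show ?thesis by (rule that)
  qed
  have "A \<noteq> 0"
  proof
    assume "A = 0"
    then show False using AB f by (metis add_0 mult_eq_0_iff)
  qed
  moreover have "A * walk_sum \<eta> (?img p) = 0" using AB(2)[of \<eta>] img[OF u] by simp
  ultimately show ?case using img[OF p] by simp
qed

text \<open>
  Gradings that are constant on fibres can only separate if the fibres are singletons; then the zero
  grading is injective on each fibre.
\<close>

theorem pseudotree_separated_imp_nice_length_zero:
  assumes Q: "pseudotree Q" and M: "M \<in> indec_nil Q"
    and sep: "separated (coeff_quiver Q M) (coeff_winding Q M)"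
    and cyc: "undirected_cycle (coeff_quiver Q M) w"
  shows "nice_length Q M = enat 0"
proof -
  let ?G = "coeff_quiver Q M" and ?c = "coeff_winding Q M"
  have finQ: "fin_digraph Q" and rank: "rank_H1 Q \<le> 1" using Q by (simp_all add: pseudotree_def)
  interpret Q: fin_digraph Q by fact
  have rep: "f1_representation Q M" and indec: "indecomposable Q M" using M by (auto simp: indec_nil_def)
  interpret G: fin_digraph ?G by (rule fin_digraph_coeff_quiver[OF finQ rep])
  have wind: "winding ?G Q ?c" by (rule winding_coeff_winding[OF finQ rep])
  have con: "connected ?G" by (rule indecomposable_imp_connected[OF Q.wf_digraph_axioms rep indec])
  obtain ds n where ds: "nice_sequence ?G ?c ds" "separates_up_to ?G ds n"
    using sep unfolding separated_def by blast
  have const: "ds i x = ds i y" if "x \<in> verts ?G" "y \<in> verts ?G" "on_verts ?c x = on_verts ?c y" for i x y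
    by (rule nice_sequence_constant_on_fibres[OF finQ rank G.wf_digraph_axioms con wind cyc ds(1) that])
  have "inj_on (\<lambda>_. 0 :: int) {x \<in> verts ?G. on_verts ?c x = v}" for v
    using const ds(2) unfolding separates_up_to_def inj_on_def by blast
  moreover have "nice_grading ?G ?c (\<lambda>_. 0)" by (simp add: nice_grading_def)
  ultimately obtain d where "nice_grading ?G ?c d" "inj_on d (verts ?G)"
    using injective_nice_grading_if_injective_on_fibres[OF Q.finite_verts, of ?G ?c "\<lambda>_. 0"] wind
    unfolding winding_def by blast
  then show ?thesis using nice_length_zero_iff by blast
qed

section \<open>Examples on a quiver with one vertex\<close>

definition rose :: "'v \<Rightarrow> nat \<Rightarrow> ('v, nat) pre_digraph" where
  "rose v n = \<lparr>verts = {v}, arcs = {..<n}, tail = \<lambda>_. v, head = \<lambda>_. v\<rparr>"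

definition rose_rep :: "nat \<Rightarrow> (nat \<Rightarrow> nat \<Rightarrow> nat) \<Rightarrow> ('v, nat, nat) f1_rep" where
  "rose_rep N f = \<lparr>rep_space = \<lambda>_. \<lparr>pcarrier = {0..N}, pzero = 0\<rparr>, rep_map = f\<rparr>"

lemma fin_digraph_rose: "fin_digraph (rose v n)"
  by unfold_locales (auto simp: rose_def)

text \<open>
  Maps that lower every nonzero element make the representation nilpotent; no nonempty proper set of nonzero
  elements may be closed under the maps in both directions, which makes it indecomposable.
\<close>

lemma rose_rep_in_indec_nil:
  assumes zero: "\<And>\<alpha>. \<alpha> < n \<Longrightarrow> f \<alpha> 0 = 0"
    and dec: "\<And>\<alpha> x. \<alpha> < n \<Longrightarrow> 0 < x \<Longrightarrow> x \<le> N \<Longrightarrow> f \<alpha> x < x"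
    and inj: "\<And>\<alpha> x y. \<alpha> < n \<Longrightarrow> f \<alpha> x = f \<alpha> y \<Longrightarrow> f \<alpha> x \<noteq> 0 \<Longrightarrow> x = y"
    and pos: "N > 0"
    and conn: "\<And>A. A \<subseteq> {1..N} \<Longrightarrow> A \<noteq> {} \<Longrightarrow>
       (\<And>\<alpha> x. \<alpha> < n \<Longrightarrow> x \<in> {1..N} \<Longrightarrow> f \<alpha> x \<noteq> 0 \<Longrightarrow> x \<in> A \<longleftrightarrow> f \<alpha> x \<in> A) \<Longrightarrow> A = {1..N}"
  shows "rose_rep N f \<in> indec_nil (rose v n)"
proof -
  let ?Q = "rose v n" and ?M = "rose_rep N f"
  have le: "f \<alpha> x \<le> x - 1" if "\<alpha> < n" "x \<le> N" for \<alpha> x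
    using zero[OF that(1)] dec[OF that(1), of x] that(2) by (cases "x = 0") auto
  have "f1_representation ?Q ?M"
    unfolding f1_representation_def f1_space_def f1_linear_def
  proof (intro conjI ballI)
    fix \<alpha> x assume "\<alpha> \<in> arcs ?Q" "x \<in> pcarrier (rep_space ?M (tail ?Q \<alpha>))"
    then show "rep_map ?M \<alpha> x \<in> pcarrier (rep_space ?M (head ?Q \<alpha>))"
      using le[of \<alpha> x] by (simp add: rose_def rose_rep_def)
  next
    fix \<alpha> assume "\<alpha> \<in> arcs ?Q"
    then show "inj_on (rep_map ?M \<alpha>)
        {x \<in> pcarrier (rep_space ?M (tail ?Q \<alpha>)). rep_map ?M \<alpha> x \<noteq> pzero (rep_space ?M (head ?Q \<alpha>))}"
      using inj by (auto simp: rose_def rose_rep_def inj_on_def)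
  qed (use zero in \<open>auto simp: rose_def rose_rep_def\<close>)
  moreover have "indecomposable ?Q ?M"
    unfolding indecomposable_def
  proof (intro conjI notI)
    show "nonzero_family ?Q ?M (\<lambda>v. pcarrier (rep_space ?M v))"
      using pos by (auto simp: nonzero_family_def rose_def rose_rep_def)
    assume "\<exists>U W. is_direct_sum ?Q ?M U W \<and> nonzero_family ?Q ?M U \<and> nonzero_family ?Q ?M W"
    then obtain U W where UW: "is_direct_sum ?Q ?M U W" "nonzero_family ?Q ?M U" "nonzero_family ?Q ?M W"
      by blast
    have sum: "U v \<union> W v = {0..N}" "U v \<inter> W v = {0}" "U v \<noteq> {0}" "W v \<noteq> {0}"
      and closed: "\<And>\<alpha> x. \<alpha> < n \<Longrightarrow> x \<in> U v \<Longrightarrow> f \<alpha> x \<in> U v"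
        "\<And>\<alpha> x. \<alpha> < n \<Longrightarrow> x \<in> W v \<Longrightarrow> f \<alpha> x \<in> W v"
      using UW by (auto simp: is_direct_sum_def subrepresentation_def nonzero_family_def rose_def rose_rep_def)
    have "U v - {0} = {1..N}"
    proof (rule conn)
      have "U v \<subseteq> {0..N}" using sum(1) by blast
      then show "U v - {0} \<subseteq> {1..N}" by auto
      show "U v - {0} \<noteq> {}" using sum(2,3) by blast
      fix \<alpha> x assume h: "\<alpha> < n" "x \<in> {1..N}" "f \<alpha> x \<noteq> 0"
      have "x \<in> U v \<union> W v" unfolding sum(1) using h(2) by simp
      moreover have "f \<alpha> x \<notin> U v \<inter> W v" unfolding sum(2) using h(3) by simp
      moreover have "x \<noteq> 0" using h(2) by simp
      ultimately show "x \<in> U v - {0} \<longleftrightarrow> f \<alpha> x \<in> U v - {0}"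
        using closed[OF h(1), of x] h(3) by blast
    qed
    have "W v \<subseteq> {0}"
    proof
      fix y assume y: "y \<in> W v"
      show "y \<in> {0}"
      proof (rule ccontr)
        assume "y \<notin> {0}"
        moreover have "y \<in> U v \<union> W v" using y by blast
        ultimately have "y \<in> U v - {0}" unfolding \<open>U v - {0} = {1..N}\<close> sum(1) by simp
        then have "y \<in> U v \<inter> W v" using y by blast
        then show False unfolding sum(2) using \<open>y \<notin> {0}\<close> by blast
      qed
    qed
    moreover have "0 \<in> U v \<inter> W v" unfolding sum(2) by simp
    ultimately show False using sum(4) by blast
  qed
  moreover have "nilpotent ?Q ?M"
    unfolding nilpotent_def
  proof (intro exI[of _ N] allI impI ballI)
    fix k u p v' x
    assume k: "N \<le> k" and p: "pre_digraph.awalk ?Q u p v' \<and> length p = k"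
      and x: "x \<in> pcarrier (rep_space ?M u)"
    have "set p \<subseteq> {..<n}" using p by (simp add: pre_digraph.awalk_def rose_def)
    moreover have "x \<le> N" using x by (simp add: rose_rep_def)
    ultimately have "fold f p x \<le> x - length p"
    proof (induction p arbitrary: x)
      case (Cons \<alpha> p)
      have "f \<alpha> x \<le> x - 1" using le Cons.prems by simp
      moreover from this have "fold f p (f \<alpha> x) \<le> f \<alpha> x - length p"
        using Cons.IH[of "f \<alpha> x"] Cons.prems by simp
      ultimately show ?case by simp
    qed simp
    then show "fold (rep_map ?M) p x = pzero (rep_space ?M v')"
      using k p \<open>x \<le> N\<close> by (simp add: rose_rep_def)
  qed
  ultimately show ?thesis by (simp add: indec_nil_def)
qed

text \<open>
  Loop \<open>0\<close> acts as \<open>a\<close> and loop \<open>1\<close> as \<open>b\<close>; all others commutator_action as zero, which allows any number of loops.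
  The parameter \<open>m\<close> is \<open>4\<close> for the commutator path \<open>4 \<rightarrow> 3 \<rightarrow> 1 \<leftarrow> 2 \<leftarrow> 5\<close>, \<open>5\<close> for the cycle that
  \<open>5 \<rightarrow> 4\<close> closes, and \<open>6\<close> for the cycle with the additional arrow \<open>6 \<rightarrow> 5\<close>.
\<close>

definition commutator_action :: "nat \<Rightarrow> nat \<Rightarrow> nat \<Rightarrow> nat" where
  "commutator_action m \<alpha> x =
     (if \<alpha> = 0 then (if x = 2 then 1 else if 4 \<le> x \<and> x \<le> m then x - 1 else 0)
      else if \<alpha> = 1 then (if x = 3 then 1 else if x = 5 then 2 else 0)
      else 0)"

lemma commutator_action_less: "0 < x \<Longrightarrow> commutator_action m \<alpha> x < x"
  by (auto simp: commutator_action_def)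

text \<open>
  The preimage under each loop is an explicit function of the image, so the two maps are injective
  where they are nonzero.
\<close>

lemma commutator_action_left_inverse:
  "commutator_action m \<alpha> x \<noteq> 0 \<Longrightarrow>
     (if \<alpha> = 0 then (if commutator_action m \<alpha> x = 1 then 2 else commutator_action m \<alpha> x + 1)
      else if commutator_action m \<alpha> x = 1 then 3 else 5) = x"
  by (auto simp: commutator_action_def split: if_splits)

lemma commutator_action_inj: "commutator_action m \<alpha> x = commutator_action m \<alpha> y \<Longrightarrow> commutator_action m \<alpha> x \<noteq> 0 \<Longrightarrow> x = y"
proof -
  assume e: "commutator_action m \<alpha> x = commutator_action m \<alpha> y" and n: "commutator_action m \<alpha> x \<noteq> 0"
  from trans[OF commutator_action_left_inverse[OF n, unfolded e, symmetric] commutator_action_left_inverse[OF n[unfolded e]]]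
  show "x = y" .
qed

lemma commutator_rep_in_indec_nil:
  assumes "2 \<le> n" "4 \<le> m" "m \<le> 6" "N = max 5 m"
  shows "rose_rep N (commutator_action m) \<in> indec_nil (rose v n)"
proof (rule rose_rep_in_indec_nil)
  fix A assume A: "A \<subseteq> {1..N}" "A \<noteq> {}"
    "\<And>\<alpha> x. \<alpha> < n \<Longrightarrow> x \<in> {1..N} \<Longrightarrow> commutator_action m \<alpha> x \<noteq> 0 \<Longrightarrow> x \<in> A \<longleftrightarrow> commutator_action m \<alpha> x \<in> A"
  have iff: "4 \<in> A \<longleftrightarrow> 3 \<in> A" "2 \<in> A \<longleftrightarrow> 1 \<in> A" "3 \<in> A \<longleftrightarrow> 1 \<in> A" "5 \<in> A \<longleftrightarrow> 2 \<in> A"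
    "m = 6 \<Longrightarrow> 6 \<in> A \<longleftrightarrow> 5 \<in> A"
    using A(3)[of 0 4] A(3)[of 0 2] A(3)[of 1 3] A(3)[of 1 5] A(3)[of 0 6] assms
    by (simp_all add: commutator_action_def)
  have set: "x \<in> {1..N} \<longleftrightarrow> x = 1 \<or> x = 2 \<or> x = 3 \<or> x = 4 \<or> x = 5 \<or> (m = 6 \<and> x = 6)" for x
    using assms by auto
  obtain a where "a \<in> A" using A(2) by blast
  then have "a = 1 \<or> a = 2 \<or> a = 3 \<or> a = 4 \<or> a = 5 \<or> (m = 6 \<and> a = 6)" using A(1) set by blast
  then have one: "1 \<in> A" using \<open>a \<in> A\<close> iff by blast
  show "A = {1..N}"
  proof
    show "{1..N} \<subseteq> A"
    proof
      fix x assume "x \<in> {1..N}"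
      then have "x = 1 \<or> x = 2 \<or> x = 3 \<or> x = 4 \<or> x = 5 \<or> (m = 6 \<and> x = 6)" using set by blast
      then show "x \<in> A" using one iff by blast
    qed
  qed (rule A(1))
next
  show "commutator_action m \<alpha> 0 = 0" for \<alpha> using assms(2) by (simp add: commutator_action_def)
  show "N > 0" using assms(4) by simp
qed (rule commutator_action_less commutator_action_inj, assumption+)+

lemma commutator_coeff_quiver:
  assumes "2 \<le> n" "4 \<le> m" "m \<le> 6" "N = max 5 m"
  shows "verts (coeff_quiver (rose v n) (rose_rep N (commutator_action m))) = {v} \<times> {1..N}"
    "arcs (coeff_quiver (rose v n) (rose_rep N (commutator_action m))) =
       {(0, 2), (0, 4), (1, 3), (1, 5)} \<union> {0} \<times> {5..m}"
    "tail (coeff_quiver (rose v n) (rose_rep N (commutator_action m))) (\<alpha>, x) = (v, x)"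
    "head (coeff_quiver (rose v n) (rose_rep N (commutator_action m))) (\<alpha>, x) = (v, commutator_action m \<alpha> x)"
  using assms
  by (auto simp: coeff_quiver_def rose_def rose_rep_def commutator_action_def split: if_splits)

text \<open>
  Both loops are crossed once in each direction on the way from \<open>4\<close> to \<open>5\<close>, so every nice grading
  agrees there.
\<close>

lemma commutator_nice_length_pos:
  assumes h: "2 \<le> n" "4 \<le> m" "m \<le> 6" "N = max 5 m"
  shows "nice_length (rose v n) (rose_rep N (commutator_action m)) \<noteq> enat 0"
proof
  let ?G = "coeff_quiver (rose v n) (rose_rep N (commutator_action m))"
  let ?c = "coeff_winding (rose v n) (rose_rep N (commutator_action m))"
  assume "nice_length (rose v n) (rose_rep N (commutator_action m)) = enat 0"
  then obtain d where d: "nice_grading ?G ?c d" "inj_on d (verts ?G)"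
    using nice_length_zero_iff by blast
  note q = commutator_coeff_quiver[OF h, where v = v]
  have "d (head ?G (0, 4)) - d (tail ?G (0, 4)) = d (head ?G (0, 2)) - d (tail ?G (0, 2))"
    "d (head ?G (1, 5)) - d (tail ?G (1, 5)) = d (head ?G (1, 3)) - d (tail ?G (1, 3))"
    using d(1)[unfolded nice_grading_def, rule_format, of "(0, 4)" "(0, 2)"]
      d(1)[unfolded nice_grading_def, rule_format, of "(1, 5)" "(1, 3)"]
    by (simp_all add: q coeff_winding_def)
  then have "d (v, 4) = d (v, 5)" using h(2) by (simp add: q(3,4) commutator_action_def)
  moreover have "(v, 4) \<in> verts ?G" "(v, 5) \<in> verts ?G" unfolding q(1) using h(4) by auto
  ultimately show False using inj_onD[OF d(2), of "(v, 4)" "(v, 5)"] by simp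
qed

text \<open>
  Around the cycle \<open>a\<close> is crossed twice forwards and once backwards, so a nice grading increases by \<open>0\<close>
  along \<open>a\<close>. The first grading gives \<open>b\<close> the increment \<open>1\<close> and thereby distinguishes the arrow
  \<open>2 \<rightarrow> 1\<close> from the other arrows over \<open>a\<close>. The second may then give it the increment \<open>2\<close> against \<open>1\<close> for the
  others, which balances the cycle; the increment \<open>10\<close> along \<open>b\<close> keeps all values distinct.
\<close>

lemma commutator_separated:
  assumes h: "2 \<le> n" "5 \<le> m" "m \<le> 6" "N = max 5 m"
  shows "separated (coeff_quiver (rose v n) (rose_rep N (commutator_action m))) (coeff_winding (rose v n) (rose_rep N (commutator_action m)))"
proof -
  let ?G = "coeff_quiver (rose v n) (rose_rep N (commutator_action m))"
  let ?c = "coeff_winding (rose v n) (rose_rep N (commutator_action m))"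
  have q: "verts ?G = {v} \<times> {1..N}"
    "arcs ?G = {(0, 2), (0, 4), (1, 3), (1, 5)} \<union> {0} \<times> {5..m}"
    "\<And>\<alpha> x. tail ?G (\<alpha>, x) = (v, x)" "\<And>\<alpha> x. head ?G (\<alpha>, x) = (v, commutator_action m \<alpha> x)"
    using commutator_coeff_quiver[of n m N v] h by auto
  define d0 d1 :: "nat \<Rightarrow> int" where
    "d0 x = (if x = 1 \<or> x = 2 then 1 else 0)" and
    "d1 x = (if x = 1 then 11 else if x = 2 then 9 else 4 - int x)" for x
  define ds where "ds i z = (if i = 0 then d0 (snd z) else if i = 1 then d1 (snd z) else 0)"
    for i :: nat and z :: "'a \<times> nat"
  have arc: "\<beta> \<in> arcs ?G \<Longrightarrow> \<beta> = (0, 2) \<or> \<beta> = (0, 4) \<or> \<beta> = (1, 3) \<or> \<beta> = (1, 5) \<or> \<beta> = (0, 5) \<or> \<beta> = (0, 6) \<and> 6 \<le> m" for \<beta>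
    unfolding q(2) using h(2,3) by auto
  have diff0: "ds 0 (head ?G \<beta>) - ds 0 (tail ?G \<beta>) = of_bool (fst \<beta> = 1)"
    if "\<beta> \<in> arcs ?G" for \<beta>
    using arc[OF that] h(2) by (elim disjE conjE) (simp_all add: q(3,4) commutator_action_def ds_def d0_def)
  have diff1: "ds 1 (head ?G \<beta>) - ds 1 (tail ?G \<beta>) =
      (if fst \<beta> = 1 then 10 else if ds 0 (tail ?G \<beta>) = 1 then 2 else 1)"
    if "\<beta> \<in> arcs ?G" for \<beta>
    using arc[OF that] h(2) by (elim disjE conjE) (simp_all add: q(3,4) commutator_action_def ds_def d0_def d1_def)
  have on: "on_arcs ?c \<beta> = fst \<beta>" for \<beta> by (simp add: coeff_winding_def)
  have "nice_relative_to ?G ?c ds 0 (ds 0)"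
    unfolding nice_relative_to_def on
  proof (intro ballI impI)
    fix \<beta> \<beta>' assume "\<beta> \<in> arcs ?G" "\<beta>' \<in> arcs ?G" and "fst \<beta> = fst \<beta>' \<and>
      (\<forall>j<0. ds j (tail ?G \<beta>) = ds j (tail ?G \<beta>') \<and> ds j (head ?G \<beta>) = ds j (head ?G \<beta>'))"
    then have "fst \<beta> = fst \<beta>'" by blast
    then show "ds 0 (head ?G \<beta>) - ds 0 (tail ?G \<beta>) = ds 0 (head ?G \<beta>') - ds 0 (tail ?G \<beta>')"
      unfolding diff0[OF \<open>\<beta> \<in> arcs ?G\<close>] diff0[OF \<open>\<beta>' \<in> arcs ?G\<close>] by simp
  qed
  moreover have "nice_relative_to ?G ?c ds 1 (ds 1)"
    unfolding nice_relative_to_def on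
  proof (intro ballI impI)
    fix \<beta> \<beta>' assume "\<beta> \<in> arcs ?G" "\<beta>' \<in> arcs ?G" and "fst \<beta> = fst \<beta>' \<and>
      (\<forall>j<1. ds j (tail ?G \<beta>) = ds j (tail ?G \<beta>') \<and> ds j (head ?G \<beta>) = ds j (head ?G \<beta>'))"
    then have "fst \<beta> = fst \<beta>'" "ds 0 (tail ?G \<beta>) = ds 0 (tail ?G \<beta>')" by simp_all
    then show "ds 1 (head ?G \<beta>) - ds 1 (tail ?G \<beta>) = ds 1 (head ?G \<beta>') - ds 1 (tail ?G \<beta>')"
      unfolding diff1[OF \<open>\<beta> \<in> arcs ?G\<close>] diff1[OF \<open>\<beta>' \<in> arcs ?G\<close>] by simp
  qed
  moreover have "nice_relative_to ?G ?c ds i (ds i)" if "i > 1" for i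
    using that by (simp add: nice_relative_to_def ds_def)
  ultimately have "nice_relative_to ?G ?c ds i (ds i)" for i
    by (cases i rule: linorder_cases[of _ 1]) auto
  moreover have "separates_up_to ?G ds 1"
    unfolding separates_up_to_def
  proof (intro ballI impI)
    fix x y assume "x \<in> verts ?G" "y \<in> verts ?G" "x \<noteq> y"
    then have "d1 (snd x) \<noteq> d1 (snd y)" by (auto simp: q(1) d1_def)
    then show "\<exists>i\<le>1. ds i x \<noteq> ds i y" by (intro exI[of _ 1]) (simp add: ds_def)
  qed
  ultimately show ?thesis unfolding separated_def nice_sequence_iff by blast
qed

text \<open>
  If a function on the vertices jumps along a single arrow only, a cycle through that arrow would
  cross the jump once and could not return to its initial value.
\<close>

lemma cut_arc_not_in_cycle:
  assumes wf: "wf_digraph \<Gamma>" and cyc: "undirected_cycle \<Gamma> w"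
    and ne: "h (head \<Gamma> \<beta>) \<noteq> (h (tail \<Gamma> \<beta>) :: int)"
    and eq: "\<And>\<beta>'. \<beta>' \<in> arcs \<Gamma> \<Longrightarrow> \<beta>' \<noteq> \<beta> \<Longrightarrow> h (head \<Gamma> \<beta>') = h (tail \<Gamma> \<beta>')"
  shows "\<beta> \<notin> fst ` set w"
proof
  assume "\<beta> \<in> fst ` set w"
  then obtain i where i: "i < length w" "fst (w ! i) = \<beta>"
    by (metis (no_types, lifting) imageE in_set_conv_nth)
  let ?f = "\<lambda>\<beta>. h (head \<Gamma> \<beta>) - h (tail \<Gamma> \<beta>)"
  obtain u where u: "uwalk \<Gamma> u w u" and dist: "distinct (map fst w)"
    using cyc by (auto simp: undirected_cycle_def pre_digraph.cycle_def)
  have arcs: "fst (w ! j) \<in> arcs \<Gamma>" if "j < length w" for j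
    using u nth_mem[OF that] by (cases "w ! j") (auto simp: awalk_iff_positions)
  have "signed ?f (w ! j) = (if j = i then signed ?f (w ! i) else 0)" if "j < length w" for j
  proof (cases "j = i")
    case False
    then have "fst (w ! j) \<noteq> \<beta>" using nth_eq_iff_index_eq[OF dist, of j i] that i by simp
    then show ?thesis using eq[OF arcs[OF that]] False by (simp add: signed_def)
  qed simp
  then have "(\<Sum>j<length w. signed ?f (w ! j)) = (\<Sum>j<length w. if j = i then signed ?f (w ! i) else 0)"
    by (intro sum.cong) auto
  then have "walk_sum ?f w = signed ?f (w ! i)"
    using i(1) by (simp add: sum_list_sum_nth atLeast0LessThan)
  moreover have "walk_sum ?f w = 0" using walk_sum_coboundary[OF wf u, of h ?f] by simp
  ultimately show False using ne i(2) by (simp add: signed_def split: if_splits)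
qed

text \<open>
  Each of the four arrows is a bridge. It is excluded from all cycles by the indicator of one side of it.
\<close>

lemma commutator_tree:
  assumes "2 \<le> n"
  shows "tree_quiver (coeff_quiver (rose v n) (rose_rep 5 (commutator_action 4)))"
proof -
  let ?M = "rose_rep 5 (commutator_action 4) :: ('a, nat, nat) f1_rep"
  let ?G = "coeff_quiver (rose v n) ?M"
  have M: "?M \<in> indec_nil (rose v n)" by (rule commutator_rep_in_indec_nil) (use assms in auto)
  have q: "arcs ?G = {(0, 2), (0, 4), (1, 3), (1, 5)}"
    "\<And>\<alpha> x. tail ?G (\<alpha>, x) = (v, x)" "\<And>\<alpha> x. head ?G (\<alpha>, x) = (v, commutator_action 4 \<alpha> x)"
    using commutator_coeff_quiver[of n 4 5 v] assms by auto
  interpret R: fin_digraph "rose v n" by (rule fin_digraph_rose)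
  interpret G: fin_digraph ?G
    by (rule fin_digraph_coeff_quiver[OF R.fin_digraph]) (use M in \<open>simp add: indec_nil_def\<close>)
  have "connected ?G"
    by (rule indecomposable_imp_connected[OF R.wf_digraph_axioms]) (use M in \<open>simp_all add: indec_nil_def\<close>)
  moreover have "\<not> undirected_cycle ?G w" for w
  proof
    assume cyc: "undirected_cycle ?G w"
    note cut = cut_arc_not_in_cycle[OF G.wf_digraph_axioms cyc]
    have "(0, 4) \<notin> fst ` set w"
      by (rule cut[where h = "\<lambda>z. of_bool (snd z \<in> {4})"]) (auto simp: q commutator_action_def)
    moreover have "(1, 3) \<notin> fst ` set w"
      by (rule cut[where h = "\<lambda>z. of_bool (snd z \<in> {4, 3})"]) (auto simp: q commutator_action_def)
    moreover have "(0, 2) \<notin> fst ` set w"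
      by (rule cut[where h = "\<lambda>z. of_bool (snd z \<in> {4, 3, 1})"]) (auto simp: q commutator_action_def)
    moreover have "(1, 5) \<notin> fst ` set w"
      by (rule cut[where h = "\<lambda>z. of_bool (snd z \<in> {5})"]) (auto simp: q commutator_action_def)
    moreover have "w \<noteq> []" "fst ` set w \<subseteq> arcs ?G"
      using cyc unfolding undirected_cycle_iff[OF G.wf_digraph_axioms] by auto
    ultimately show False unfolding q(1) by (cases w) auto
  qed
  ultimately show ?thesis by (simp add: tree_quiver_def)
qed

abbreviation commutator_cycle :: "((nat \<times> nat) \<times> bool) list" where
  "commutator_cycle \<equiv> [((0, 4), True), ((1, 3), True), ((0, 2), False), ((1, 5), False), ((0, 5), True)]"

lemma commutator_undirected_cycle:
  assumes h: "2 \<le> n" "5 \<le> m" "m \<le> 6" "N = max 5 m"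
  shows "undirected_cycle (coeff_quiver (rose v n) (rose_rep N (commutator_action m))) commutator_cycle"
proof -
  let ?M = "rose_rep N (commutator_action m) :: ('a, nat, nat) f1_rep"
  let ?G = "coeff_quiver (rose v n) ?M"
  have M: "?M \<in> indec_nil (rose v n)" by (rule commutator_rep_in_indec_nil) (use h in auto)
  interpret R: fin_digraph "rose v n" by (rule fin_digraph_rose)
  interpret G: fin_digraph ?G
    by (rule fin_digraph_coeff_quiver[OF R.fin_digraph]) (use M in \<open>simp add: indec_nil_def\<close>)
  have q: "arcs ?G = {(0, 2), (0, 4), (1, 3), (1, 5)} \<union> {0} \<times> {5..m}"
    "\<And>\<alpha> x. tail ?G (\<alpha>, x) = (v, x)" "\<And>\<alpha> x. head ?G (\<alpha>, x) = (v, commutator_action m \<alpha> x)"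
    using commutator_coeff_quiver[of n m N v] h by auto
  show ?thesis
    unfolding undirected_cycle_iff[OF G.wf_digraph_axioms]
    using h(2) by (auto simp: q commutator_action_def less_Suc_eq)
qed

lemma commutator_once_around:
  assumes "2 \<le> n"
  shows "once_around (coeff_quiver (rose v n) (rose_rep 5 (commutator_action 5))) commutator_cycle"
proof -
  let ?G = "coeff_quiver (rose v n) (rose_rep 5 (commutator_action 5))"
  have q: "verts ?G = {v} \<times> {1..5}" "arcs ?G = {(0, 2), (0, 4), (1, 3), (1, 5)} \<union> {0} \<times> {5..5}"
    "\<And>\<alpha> x. tail ?G (\<alpha>, x) = (v, x)" "\<And>\<alpha> x. head ?G (\<alpha>, x) = (v, commutator_action 5 \<alpha> x)"
    using commutator_coeff_quiver[of n 5 5 v] assms by auto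
  show ?thesis
    unfolding once_around_def using commutator_undirected_cycle[of n 5 5 v] assms
    by (auto simp: q commutator_action_def)
qed

text \<open>
  The arrow from \<open>6\<close> is the only one at that vertex, so no cycle contains it.
\<close>

lemma commutator_not_affine:
  assumes h: "2 \<le> n"
  shows "\<not> affine_A_quiver (coeff_quiver (rose v n) (rose_rep 6 (commutator_action 6)))"
proof
  let ?M = "rose_rep 6 (commutator_action 6) :: ('a, nat, nat) f1_rep"
  let ?G = "coeff_quiver (rose v n) ?M"
  assume "affine_A_quiver ?G"
  then obtain w where cyc: "undirected_cycle ?G w" and arcs: "fst ` set w = arcs ?G"
    by (auto simp: affine_A_quiver_def once_around_def)
  have M: "?M \<in> indec_nil (rose v n)" by (rule commutator_rep_in_indec_nil) (use h in auto)
  interpret R: fin_digraph "rose v n" by (rule fin_digraph_rose)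
  interpret G: fin_digraph ?G
    by (rule fin_digraph_coeff_quiver[OF R.fin_digraph]) (use M in \<open>simp add: indec_nil_def\<close>)
  have q: "arcs ?G = {(0, 2), (0, 4), (1, 3), (1, 5)} \<union> {0} \<times> {5..6}"
    "\<And>\<alpha> x. tail ?G (\<alpha>, x) = (v, x)" "\<And>\<alpha> x. head ?G (\<alpha>, x) = (v, commutator_action 6 \<alpha> x)"
    using commutator_coeff_quiver[of n 6 6 v] h by auto
  have "(0, 6) \<notin> fst ` set w"
    by (rule cut_arc_not_in_cycle[OF G.wf_digraph_axioms cyc, where h = "\<lambda>z. of_bool (snd z = 6)"])
      (auto simp: q commutator_action_def)
  then show False unfolding arcs q(1) by simp
qed

section \<open>The classification\<close>

lemma iso_class_in_I_nil_nice_iff: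
  assumes "wf_digraph Q" "M \<in> indec_nil Q"
  shows "iso_class Q M \<in> I_nil_nice Q \<longleftrightarrow> separated (coeff_quiver Q M) (coeff_winding Q M)"
  unfolding I_nil_nice_def
  by (simp add: iso_class_in_I_nil_iff[OF assms] nice_length_finite_iff)

lemma iso_class_in_I_nil_zero_iff:
  assumes "fin_digraph Q" "M \<in> indec_nil Q"
  shows "iso_class Q M \<in> I_nil Q 0 \<longleftrightarrow>
     (\<exists>d. nice_grading (coeff_quiver Q M) (coeff_winding Q M) d \<and>
          (\<forall>v \<in> verts Q. inj_on d {x \<in> verts (coeff_quiver Q M). on_verts (coeff_winding Q M) x = v}))"
proof -
  interpret fin_digraph Q by fact
  have "f1_representation Q M" using assms(2) by (simp add: indec_nil_def)
  then have "winding (coeff_quiver Q M) Q (coeff_winding Q M)"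
    by (rule winding_coeff_winding[OF assms(1)])
  then have map: "is_quiver_map (coeff_quiver Q M) Q (coeff_winding Q M)" by (simp add: winding_def)
  show ?thesis
    unfolding iso_class_in_I_nil_iff[OF wf_digraph_axioms assms(2)] nice_length_zero_iff
  proof
    assume "\<exists>d. nice_grading (coeff_quiver Q M) (coeff_winding Q M) d \<and> inj_on d (verts (coeff_quiver Q M))"
    then show "\<exists>d. nice_grading (coeff_quiver Q M) (coeff_winding Q M) d \<and>
        (\<forall>v \<in> verts Q. inj_on d {x \<in> verts (coeff_quiver Q M). on_verts (coeff_winding Q M) x = v})"
      using inj_on_subset[of _ "verts (coeff_quiver Q M)"
          "{x \<in> verts (coeff_quiver Q M). on_verts (coeff_winding Q M) x = v}" for v] by blast
  next
    assume "\<exists>d. nice_grading (coeff_quiver Q M) (coeff_winding Q M) d \<and>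
        (\<forall>v \<in> verts Q. inj_on d {x \<in> verts (coeff_quiver Q M). on_verts (coeff_winding Q M) x = v})"
    then obtain d where d: "nice_grading (coeff_quiver Q M) (coeff_winding Q M) d"
      "\<And>v. v \<in> verts Q \<Longrightarrow> inj_on d {x \<in> verts (coeff_quiver Q M). on_verts (coeff_winding Q M) x = v}"
      by blast
    obtain d' where "nice_grading (coeff_quiver Q M) (coeff_winding Q M) d'"
      "inj_on d' (verts (coeff_quiver Q M))"
      by (rule injective_nice_grading_if_injective_on_fibres[OF finite_verts map d])
    then show "\<exists>d. nice_grading (coeff_quiver Q M) (coeff_winding Q M) d \<and> inj_on d (verts (coeff_quiver Q M))"
      by blast
  qed
qed

theorem theoremE:
  shows
    "(\<forall>(Q :: ('v, 'a) pre_digraph) (M :: ('v, 'a, 'x) f1_rep).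
        fin_digraph Q \<and> M \<in> indec_nil Q \<longrightarrow>
          (iso_class Q M \<in> I_nil Q 0 \<longleftrightarrow>
             (\<exists>d. nice_grading (coeff_quiver Q M) (coeff_winding Q M) d \<and>
                  (\<forall>v \<in> verts Q.
                     inj_on d {x \<in> verts (coeff_quiver Q M). on_verts (coeff_winding Q M) x = v}))) \<and>
          (tree_quiver (coeff_quiver Q M) \<longrightarrow> iso_class Q M \<in> I_nil_nice Q) \<and>
          (affine_A_quiver (coeff_quiver Q M) \<longrightarrow>
             (iso_class Q M \<in> I_nil_nice Q \<longleftrightarrow>
              primitive (coeff_quiver Q M) Q (coeff_winding Q M)))) \<and>
     (\<exists>(Q :: (nat, nat) pre_digraph) (M :: (nat, nat, nat) f1_rep).
        fin_digraph Q \<and> M \<in> indec_nil Q \<and>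
        tree_quiver (coeff_quiver Q M) \<and> iso_class Q M \<notin> I_nil Q 0) \<and>
     (\<exists>(Q :: (nat, nat) pre_digraph) (M :: (nat, nat, nat) f1_rep).
        fin_digraph Q \<and> M \<in> indec_nil Q \<and>
        affine_A_quiver (coeff_quiver Q M) \<and>
        iso_class Q M \<in> I_nil_nice Q \<and> iso_class Q M \<notin> I_nil Q 0) \<and>
     (\<forall>(Q :: ('v, 'a) pre_digraph) (M :: ('v, 'a, 'x) f1_rep).
        pseudotree Q \<and> M \<in> indec_nil Q \<and> iso_class Q M \<in> I_nil_nice Q \<longrightarrow>
          iso_class Q M \<in> I_nil Q 0 \<or>
          tree_quiver (coeff_quiver Q M) \<or>
          (affine_A_quiver (coeff_quiver Q M) \<and>
           primitive (coeff_quiver Q M) Q (coeff_winding Q M))) \<and>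
     (\<forall>n \<ge> 2. \<exists>M :: (unit, nat, nat) f1_rep.
        M \<in> indec_nil (loop_quiver n) \<and>
        iso_class (loop_quiver n) M \<in> I_nil_nice (loop_quiver n) \<and>
        iso_class (loop_quiver n) M \<notin> I_nil (loop_quiver n) 0 \<and>
        \<not> tree_quiver (coeff_quiver (loop_quiver n) M) \<and>
        \<not> (affine_A_quiver (coeff_quiver (loop_quiver n) M) \<and>
           primitive (coeff_quiver (loop_quiver n) M) (loop_quiver n)
             (coeff_winding (loop_quiver n) M)))"
proof (intro conjI allI impI)
  fix Q :: "('v, 'a) pre_digraph" and M :: "('v, 'a, 'x) f1_rep"
  let ?G = "coeff_quiver Q M" and ?c = "coeff_winding Q M"
  assume "fin_digraph Q \<and> M \<in> indec_nil Q"
  then have Q: "fin_digraph Q" and M: "M \<in> indec_nil Q" by blast+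
  interpret Q: fin_digraph Q by fact
  have rep: "f1_representation Q M" using M by (simp add: indec_nil_def)
  have fin: "fin_digraph ?G" and wind: "winding ?G Q ?c"
    using fin_digraph_coeff_quiver[OF Q rep] winding_coeff_winding[OF Q rep] by blast+
  interpret G: fin_digraph ?G by (rule fin)
  note nice_iff = iso_class_in_I_nil_nice_iff[OF Q.wf_digraph_axioms M]
  show "iso_class Q M \<in> I_nil Q 0 \<longleftrightarrow>
      (\<exists>d. nice_grading ?G ?c d \<and> (\<forall>v \<in> verts Q. inj_on d {x \<in> verts ?G. on_verts ?c x = v}))"
    by (rule iso_class_in_I_nil_zero_iff[OF Q M])
  show "iso_class Q M \<in> I_nil_nice Q" if "tree_quiver ?G"
    using tree_separated[OF fin wind that] nice_iff by blast
  show "iso_class Q M \<in> I_nil_nice Q \<longleftrightarrow> primitive ?G Q ?c" if "affine_A_quiver ?G"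
    using that primitive_imp_separated[OF fin wind] separated_imp_primitive[OF G.wf_digraph_axioms]
    unfolding nice_iff affine_A_quiver_def by blast
next
  interpret R: fin_digraph "rose 0 2 :: (nat, nat) pre_digraph" by (rule fin_digraph_rose)
  let ?Q = "rose 0 2 :: (nat, nat) pre_digraph"
  have M: "rose_rep 5 (commutator_action m) \<in> indec_nil ?Q" if "m = 4 \<or> m = 5" for m
    by (rule commutator_rep_in_indec_nil) (use that in auto)
  have pos: "iso_class ?Q (rose_rep 5 (commutator_action m)) \<notin> I_nil ?Q 0" if "m = 4 \<or> m = 5" for m
    unfolding iso_class_in_I_nil_iff[OF R.wf_digraph_axioms M[OF that]]
    by (rule commutator_nice_length_pos) (use that in auto)
  show "\<exists>(Q :: (nat, nat) pre_digraph) (M :: (nat, nat, nat) f1_rep).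
      fin_digraph Q \<and> M \<in> indec_nil Q \<and>
      tree_quiver (coeff_quiver Q M) \<and> iso_class Q M \<notin> I_nil Q 0"
    using R.fin_digraph M[of 4] pos[of 4] commutator_tree[of 2 0] by blast
  have "separated (coeff_quiver ?Q (rose_rep 5 (commutator_action 5))) (coeff_winding ?Q (rose_rep 5 (commutator_action 5)))"
    by (rule commutator_separated) auto
  then have "iso_class ?Q (rose_rep 5 (commutator_action 5)) \<in> I_nil_nice ?Q"
    using iso_class_in_I_nil_nice_iff[OF R.wf_digraph_axioms M[of 5]] by blast
  moreover have "affine_A_quiver (coeff_quiver ?Q (rose_rep 5 (commutator_action 5)))"
    unfolding affine_A_quiver_def using commutator_once_around[of 2 0] by blast
  ultimately show "\<exists>(Q :: (nat, nat) pre_digraph) (M :: (nat, nat, nat) f1_rep).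
      fin_digraph Q \<and> M \<in> indec_nil Q \<and> affine_A_quiver (coeff_quiver Q M) \<and>
      iso_class Q M \<in> I_nil_nice Q \<and> iso_class Q M \<notin> I_nil Q 0"
    using R.fin_digraph M[of 5] pos[of 5] by blast
next
  fix Q :: "('v, 'a) pre_digraph" and M :: "('v, 'a, 'x) f1_rep"
  let ?G = "coeff_quiver Q M" and ?c = "coeff_winding Q M"
  assume h: "pseudotree Q \<and> M \<in> indec_nil Q \<and> iso_class Q M \<in> I_nil_nice Q"
  then interpret Q: fin_digraph Q by (simp add: pseudotree_def)
  have M: "M \<in> indec_nil Q" using h by blast
  have con: "connected ?G"
    by (rule indecomposable_imp_connected[OF Q.wf_digraph_axioms]) (use M in \<open>simp_all add: indec_nil_def\<close>)
  have sep: "separated ?G ?c" using h iso_class_in_I_nil_nice_iff[OF Q.wf_digraph_axioms M] by blast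
  have "iso_class Q M \<in> I_nil Q 0 \<or> tree_quiver ?G"
    using pseudotree_separated_imp_nice_length_zero[OF _ M sep] h con
      iso_class_in_I_nil_iff[OF Q.wf_digraph_axioms M, of 0]
    unfolding tree_quiver_def by blast
  then show "iso_class Q M \<in> I_nil Q 0 \<or> tree_quiver ?G \<or> (affine_A_quiver ?G \<and> primitive ?G Q ?c)"
    by blast
next
  fix n :: nat assume n: "2 \<le> n"
  let ?Q = "rose () n" and ?M = "rose_rep 6 (commutator_action 6) :: (unit, nat, nat) f1_rep"
  have loops: "loop_quiver n = ?Q" by (simp add: loop_quiver_def rose_def)
  interpret R: fin_digraph ?Q by (rule fin_digraph_rose)
  have M: "?M \<in> indec_nil ?Q" by (rule commutator_rep_in_indec_nil) (use n in auto)
  have "separated (coeff_quiver ?Q ?M) (coeff_winding ?Q ?M)"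
    by (rule commutator_separated) (use n in auto)
  then have "iso_class ?Q ?M \<in> I_nil_nice ?Q"
    using iso_class_in_I_nil_nice_iff[OF R.wf_digraph_axioms M] by blast
  moreover have "iso_class ?Q ?M \<notin> I_nil ?Q 0"
    unfolding iso_class_in_I_nil_iff[OF R.wf_digraph_axioms M]
    by (rule commutator_nice_length_pos) (use n in auto)
  moreover have "undirected_cycle (coeff_quiver ?Q ?M) commutator_cycle"
    by (rule commutator_undirected_cycle[OF n]) auto
  then have "\<not> tree_quiver (coeff_quiver ?Q ?M)" unfolding tree_quiver_def by blast
  moreover have "\<not> affine_A_quiver (coeff_quiver ?Q ?M)" by (rule commutator_not_affine[OF n])
  ultimately show "\<exists>M :: (unit, nat, nat) f1_rep.
      M \<in> indec_nil (loop_quiver n) \<and>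
      iso_class (loop_quiver n) M \<in> I_nil_nice (loop_quiver n) \<and>
      iso_class (loop_quiver n) M \<notin> I_nil (loop_quiver n) 0 \<and>
      \<not> tree_quiver (coeff_quiver (loop_quiver n) M) \<and>
      \<not> (affine_A_quiver (coeff_quiver (loop_quiver n) M) \<and>
         primitive (coeff_quiver (loop_quiver n) M) (loop_quiver n)
           (coeff_winding (loop_quiver n) M))"
    unfolding loops using M by blast
qed

end
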